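(* Let $f_\pm\colon\mathbb R\to\mathbb R$ be smooth, and let $u_0\in\mathbb R$ satisfy $f_+'(u_0)=f_-'(u_0)$, $f_+''(u_0)<f_-''(u_0)$, $f_-'''(u_0)<0$. For small $\varepsilon>0$ let $u_-$ be the unique root in $(u_0-2\varepsilon,u_0)$ of the equation $$f_-'(u-\varepsilon)-f_+'(u+\varepsilon)+2\varepsilon f_-''(u-\varepsilon)=0.$$ Then for all sufficiently small $\varepsilon>0$ there exists an NE-fissure with a spine function $T$ defined on some interval $[u_--\varepsilon,v_+-\varepsilon]$ such that: 1. $T(u_0-\varepsilon)=0$ and $T(u_--\varepsilon)=-\varepsilon$; 2. $v_+>u_0+\varepsilon$ and $T(v_+-\varepsilon)=\varepsilon$; 3. the function $$B(x)=\begin{cases}\dfrac{\varepsilon-x_2}{\varepsilon-T}A+\dfrac{x_2-T}{\varepsilon-T}f_+, & x_2\ge T(u),\\[2mm] \dfrac{\varepsilon+x_2}{\varepsilon+T}A+\dfrac{T-x_2}{\varepsilon+T}f_-, & x_2\le T(u),\end{cases}\qquad u=u(x),$$ with $$A=\frac{\varepsilon^2-T^2}{2\varepsilon T}\Big[(\varepsilon-T)f_-'-(\varepsilon+T)f_+'\Big]+\frac{(\varepsilon+T)f_++(\varepsilon-T)f_-}{2\varepsilon},$$ is a Bellman candidate on the region $\Omega^{NE}_\varepsilon(u_-,v_+)$ foliated by this fissure; 4. there exists $\delta=\delta(\varepsilon)>0$ such that the function equal to $$\frac{\varepsilon+x_2}{2\varepsilon}f_+(x_1-x_2+\varepsilon)+\frac{\varepsilon-x_2}{2\varepsilon}f_-(x_1-x_2-\varepsilon)\quad\text{on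 }\Omega^R_\varepsilon(u_--\delta,u_-),$$ $$\frac{\varepsilon+x_2}{2\varepsilon}f_+(x_1+x_2-\varepsilon)+\frac{\varepsilon-x_2}{2\varepsilon}f_-(x_1+x_2+\varepsilon)\quad\text{on }\Omega^L_\varepsilon(v_+,v_++\delta),$$ and to the function $B$ of item 3 on $\Omega^{NE}_\varepsilon(u_-,v_+)$, is a $C^1$-smooth Bellman candidate on the union of these three regions.
   Context: Let $\Omega_\varepsilon=\{(x_1,x_2)\in\mathbb R^2: -\varepsilon\le x_2\le\varepsilon\}$, $\partial\Omega_\varepsilon=\{x_2=\pm\varepsilon\}$. For $a<b$ put $\Omega^{R}_\varepsilon(a,b)=\{x\in\Omega_\varepsilon: a\le x_1-x_2\le b\}$ and $\Omega^{L}_\varepsilon(a,b)=\{x\in\Omega_\varepsilon: a\le x_1+x_2\le b\}$. The functions $f_\pm$ do not depend on $\varepsilon$. The root $u_-$ exists and is unique for small $\varepsilon$. A function on a two-dimensional domain is diagonally concave if it is concave along every segment of the domain lying on a line $x_1+x_2=\mathrm{const}$ or $x_1-x_2=\mathrm{const}$. A function $B$ on a subdomain $\Omega\subset\Omega_\varepsilon$ is a Bellman candidate on $\Omega$ if: (1) $B$ is diagonally concave on $\Omega$; (2) $B(x_1,\pm\varepsilon)=f_\pm(x_1)$ at the points of $\Omega\cap\partial\Omega_\varepsilon$; (3) for every $y\in\Omega$, either there is a straight line segment in one of the directions $x_1\pm x_2=\mathrm{const}$ connecting $y$ with some point of $\partial\Omega_\varepsilon$ on which $B$ is linear, or $B$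 is linear in both directions $x_1\pm x_2=\mathrm{const}$ in a neighborhood of $y$. Right horizontal herringbone: given a $C^1$ spine function $T$ on an interval, with values in $[-\varepsilon,\varepsilon]$, $|T'|\le1$ and $|T'|<1$ except possibly at finitely many points, from each spine point $(u,T(u))$ start two ribs: the upper rib, the segment to $(u-T(u)+\varepsilon,\varepsilon)$, and the lower rib, the segment to $(u+T(u)+\varepsilon,-\varepsilon)$ (a rib degenerates to a point when $T(u)=\varepsilon$, resp. $T(u)=-\varepsilon$). A fissure is a horizontal herringbone whose spine connects the two opposite boundaries of the strip; an NE-fissure is a right herringbone whose spine goes, from right to left, from the top boundary $x_2=\varepsilon$ to the bottom boundary $x_2=-\varepsilon$. The region $\Omega^{NE}_\varepsilon(u_-,v_+)$ is the union of all ribs, i.e. $\{x\in\Omega_\varepsilon: x_1-x_2\ge u_-,\ x_1+x_2\le v_+\}$. For $x$ in this region, $u=u(x)$ is the parameter of the rib containing $x$: $x_1-x_2=u-T(u)$ on upper ribs ($x_2\ge T(u)$), $x_1+x_2=u+T(u)$ on lower ribs ($x_2\le T(u)$). In the formulas for $B$ and $A$ in item 3, $A,T$ are evaluated at $u$, $f_+$ and its derivatives at $u-T(u)+\varepsilon$, $f_-$ and its derivatives at $u+T(u)+\varepsilon$. At $u=u_0-\varepsilon$ (where $T=0$) $A$ is understood as extended by continuity; on the degenerate ribs at the endpoints of the spine $B$ equals the boundary value. *)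

theory Defs
  imports "HOL-Analysis.Analysis"
begin

text \<open>Points of the plane are pairs of reals. The boundary data \<open>f\<^sub>+\<close>, \<open>f\<^sub>-\<close> are written
  \<open>fp\<close>, \<open>fm\<close>; the parameters \<open>u\<^sub>-\<close>, \<open>v\<^sub>+\<close> are written \<open>um\<close>, \<open>vp\<close>.\<close>

definition smooth_fun :: "(real \<Rightarrow> real) \<Rightarrow> bool" where
  "smooth_fun f \<longleftrightarrow> (\<forall>n x. ((deriv ^^ n) f) field_differentiable (at x))"

definition strip :: "real \<Rightarrow> (real \<times> real) set" where
  "strip \<epsilon> = {x. - \<epsilon> \<le> snd x \<and> snd x \<le> \<epsilon>}"

definition strip_boundary :: "real \<Rightarrow> (real \<times> real) set" where
  "strip_boundary \<epsilon> = {x. snd x = \<epsilon> \<or> snd x = - \<epsilon>}"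

definition Omega_R :: "real \<Rightarrow> real \<Rightarrow> real \<Rightarrow> (real \<times> real) set" where
  "Omega_R \<epsilon> a b = {x \<in> strip \<epsilon>. a \<le> fst x - snd x \<and> fst x - snd x \<le> b}"

definition Omega_L :: "real \<Rightarrow> real \<Rightarrow> real \<Rightarrow> (real \<times> real) set" where
  "Omega_L \<epsilon> a b = {x \<in> strip \<epsilon>. a \<le> fst x + snd x \<and> fst x + snd x \<le> b}"

definition Omega_NE :: "real \<Rightarrow> real \<Rightarrow> real \<Rightarrow> (real \<times> real) set" where
  "Omega_NE \<epsilon> um vp = {x \<in> strip \<epsilon>. fst x - snd x \<ge> um \<and> fst x + snd x \<le> vp}"

definition same_diagonal :: "real \<times> real \<Rightarrow> real \<times> real \<Rightarrow> bool" where
  "same_diagonal p q \<longleftrightarrow>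
     fst p + snd p = fst q + snd q \<or> fst p - snd p = fst q - snd q"

definition diagonally_concave_on :: "(real \<times> real) set \<Rightarrow> (real \<times> real \<Rightarrow> real) \<Rightarrow> bool" where
  "diagonally_concave_on S B \<longleftrightarrow>
     (\<forall>p q. same_diagonal p q \<and> closed_segment p q \<subseteq> S \<longrightarrow> concave_on (closed_segment p q) B)"

text \<open>``Linear on a segment'' means affine there.\<close>

definition linear_on_segment :: "(real \<times> real \<Rightarrow> real) \<Rightarrow> real \<times> real \<Rightarrow> real \<times> real \<Rightarrow> bool" where
  "linear_on_segment B p q \<longleftrightarrow>
     (\<forall>t\<in>{0..1}. B ((1 - t) *\<^sub>R p + t *\<^sub>R q) = (1 - t) * B p + t * B q)"

text \<open>In the third condition the connecting segment may reduce to a point when \<open>y\<close> itself lies on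
  the boundary of the strip, and neighbourhoods are relative to \<open>S\<close>, where \<open>B\<close> lives.\<close>

definition bellman_candidate ::
  "(real \<Rightarrow> real) \<Rightarrow> (real \<Rightarrow> real) \<Rightarrow> real \<Rightarrow> (real \<times> real) set \<Rightarrow> (real \<times> real \<Rightarrow> real) \<Rightarrow> bool" where
  "bellman_candidate fp fm \<epsilon> S B \<longleftrightarrow>
     diagonally_concave_on S B \<and>
     (\<forall>x1. (x1, \<epsilon>) \<in> S \<longrightarrow> B (x1, \<epsilon>) = fp x1) \<and>
     (\<forall>x1. (x1, - \<epsilon>) \<in> S \<longrightarrow> B (x1, - \<epsilon>) = fm x1) \<and>
     (\<forall>y\<in>S.
        (\<exists>z\<in>strip_boundary \<epsilon>. same_diagonal y z \<and> closed_segment y z \<subseteq> S \<and> linear_on_segment B y z) \<or>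
        (\<exists>U. open U \<and> y \<in> U \<and>
           (\<forall>p q. same_diagonal p q \<and> closed_segment p q \<subseteq> U \<inter> S \<longrightarrow> linear_on_segment B p q)))"

text \<open>\<open>C\<^sup>1\<close>-smoothness on a (not necessarily open) planar set: \<open>g\<close> is the gradient,
  one-sided at points of the frontier.\<close>

definition C1_smooth_on :: "(real \<times> real) set \<Rightarrow> (real \<times> real \<Rightarrow> real) \<Rightarrow> bool" where
  "C1_smooth_on S B \<longleftrightarrow>
     (\<exists>g. continuous_on S g \<and>
        (\<forall>x\<in>S. (B has_derivative (\<lambda>h. g x \<bullet> h)) (at x within S)))"

definition herringbone_spine :: "real \<Rightarrow> real \<Rightarrow> real \<Rightarrow> (real \<Rightarrow> real) \<Rightarrow> bool" where
  "herringbone_spine \<epsilon> a b T \<longleftrightarrow>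
     a < b \<and> T ` {a..b} \<subseteq> {- \<epsilon>..\<epsilon>} \<and>
     (\<exists>T'. continuous_on {a..b} T' \<and>
        (\<forall>u\<in>{a..b}. (T has_real_derivative T' u) (at u within {a..b})) \<and>
        (\<forall>u\<in>{a..b}. \<bar>T' u\<bar> \<le> 1) \<and>
        finite {u\<in>{a..b}. \<not> \<bar>T' u\<bar> < 1})"

definition NE_fissure :: "real \<Rightarrow> real \<Rightarrow> real \<Rightarrow> (real \<Rightarrow> real) \<Rightarrow> bool" where
  "NE_fissure \<epsilon> a b T \<longleftrightarrow> herringbone_spine \<epsilon> a b T \<and> T a = - \<epsilon> \<and> T b = \<epsilon>"

definition upper_rib :: "real \<Rightarrow> (real \<Rightarrow> real) \<Rightarrow> real \<Rightarrow> (real \<times> real) set" where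
  "upper_rib \<epsilon> T u = closed_segment (u, T u) (u - T u + \<epsilon>, \<epsilon>)"

definition lower_rib :: "real \<Rightarrow> (real \<Rightarrow> real) \<Rightarrow> real \<Rightarrow> (real \<times> real) set" where
  "lower_rib \<epsilon> T u = closed_segment (u, T u) (u + T u + \<epsilon>, - \<epsilon>)"

text \<open>The parameter \<open>u(x)\<close> of the rib through \<open>x\<close>; it is unique because \<open>u - T u\<close> and \<open>u + T u\<close>
  are strictly increasing for a herringbone spine.\<close>

definition rib_param :: "real \<Rightarrow> real \<Rightarrow> real \<Rightarrow> (real \<Rightarrow> real) \<Rightarrow> real \<times> real \<Rightarrow> real" where
  "rib_param \<epsilon> a b T x =
     (THE u. u \<in> {a..b} \<and> x \<in> upper_rib \<epsilon> T u \<union> lower_rib \<epsilon> T u)"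

definition spine_formula ::
  "(real \<Rightarrow> real) \<Rightarrow> (real \<Rightarrow> real) \<Rightarrow> real \<Rightarrow> (real \<Rightarrow> real) \<Rightarrow> real \<Rightarrow> real" where
  "spine_formula fp fm \<epsilon> T u =
     (let t = T u; p = u - T u + \<epsilon>; m = u + T u + \<epsilon> in
       (\<epsilon>\<^sup>2 - t\<^sup>2) / (2 * \<epsilon> * t) * ((\<epsilon> - t) * deriv fm m - (\<epsilon> + t) * deriv fp p)
       + ((\<epsilon> + t) * fp p + (\<epsilon> - t) * fm m) / (2 * \<epsilon>))"

text \<open>The value \<open>A\<close> on the spine. Where \<open>T = 0\<close> the formula is meaningless and \<open>A\<close> is its limit
  along the points with \<open>T \<noteq> 0\<close>.\<close>

definition spine_value ::
  "(real \<Rightarrow> real) \<Rightarrow> (real \<Rightarrow> real) \<Rightarrow> real \<Rightarrow> real \<Rightarrow> real \<Rightarrow> (real \<Rightarrow> real) \<Rightarrow> real \<Rightarrow> real" where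
  "spine_value fp fm \<epsilon> a b T u =
     (if T u = 0
      then Lim (at u within {v\<in>{a..b}. T v \<noteq> 0}) (spine_formula fp fm \<epsilon> T)
      else spine_formula fp fm \<epsilon> T u)"

text \<open>The case \<open>T u = \<epsilon>\<close> is the degenerate upper rib, where the formula would read \<open>0 / 0\<close>. A
  degenerate lower rib (\<open>T u = -\<epsilon>\<close>) never reaches the last branch inside the strip; there the
  upper formula yields \<open>A = fm\<close>, the boundary value.\<close>

definition fissure_function ::
  "(real \<Rightarrow> real) \<Rightarrow> (real \<Rightarrow> real) \<Rightarrow> real \<Rightarrow> real \<Rightarrow> real \<Rightarrow> (real \<Rightarrow> real) \<Rightarrow> real \<times> real \<Rightarrow> real" where
  "fissure_function fp fm \<epsilon> a b T x =
     (let u = rib_param \<epsilon> a b T x; t = T u; A = spine_value fp fm \<epsilon> a b T u; x2 = snd x in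
       if x2 \<ge> t then
         (if t = \<epsilon> then fp (u - t + \<epsilon>)
          else (\<epsilon> - x2) / (\<epsilon> - t) * A + (x2 - t) / (\<epsilon> - t) * fp (u - t + \<epsilon>))
       else (\<epsilon> + x2) / (\<epsilon> + t) * A + (t - x2) / (\<epsilon> + t) * fm (u + t + \<epsilon>))"

definition right_tangent_function ::
  "(real \<Rightarrow> real) \<Rightarrow> (real \<Rightarrow> real) \<Rightarrow> real \<Rightarrow> real \<times> real \<Rightarrow> real" where
  "right_tangent_function fp fm \<epsilon> x =
     (\<epsilon> + snd x) / (2 * \<epsilon>) * fp (fst x - snd x + \<epsilon>)
     + (\<epsilon> - snd x) / (2 * \<epsilon>) * fm (fst x - snd x - \<epsilon>)"

definition left_tangent_function ::
  "(real \<Rightarrow> real) \<Rightarrow> (real \<Rightarrow> real) \<Rightarrow> real \<Rightarrow> real \<times> real \<Rightarrow> real" where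
  "left_tangent_function fp fm \<epsilon> x =
     (\<epsilon> + snd x) / (2 * \<epsilon>) * fp (fst x + snd x - \<epsilon>)
     + (\<epsilon> - snd x) / (2 * \<epsilon>) * fm (fst x + snd x + \<epsilon>)"

definition is_root_um ::
  "(real \<Rightarrow> real) \<Rightarrow> (real \<Rightarrow> real) \<Rightarrow> real \<Rightarrow> real \<Rightarrow> real \<Rightarrow> bool" where
  "is_root_um fp fm u0 \<epsilon> u \<longleftrightarrow>
     u0 - 2 * \<epsilon> < u \<and> u < u0 \<and>
     deriv fm (u - \<epsilon>) - deriv fp (u + \<epsilon>) + 2 * \<epsilon> * deriv (deriv fm) (u - \<epsilon>) = 0"

end

theory Submission
  imports Defs
begin

text \<open>
  Let \<open>p = x\<^sub>1 - x\<^sub>2 + \<epsilon>\<close> and \<open>m = x\<^sub>1 + x\<^sub>2 + \<epsilon>\<close> be the abscissae of the top and bottom ends of the diagonals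
  through a point, so that \<open>2 T = m - p\<close> on the spine. Second-order matching of the two families of ribs
  along the spine forces the mixed second derivative of \<open>B\<close> to equal, up to a constant factor, the chord
  slope \<open>k = (f\<^sub>-'(m) - f\<^sub>+'(p)) / (m - p)\<close>, and in the parameter \<open>T\<close> the spine solves
  \<open>(\<epsilon> - T) k' = (f\<^sub>+''(p) - k) p'\<close>, \<open>(\<epsilon> + T) k' = (f\<^sub>-''(m) - k) m'\<close>. With \<open>k\<close> as an unknown of its own
  the point \<open>T = 0\<close> is regular, and the chord relation is a conserved quantity. The only
  singular end is \<open>T = -\<epsilon>\<close>, where regularity means \<open>k = f\<^sub>-''(m)\<close>; by the chord relation this is the
  equation for \<open>u\<^sub>-\<close>. After rescaling by \<open>\<epsilon>\<close>, the regular solution with \<open>p = m = u\<^sub>0\<close> at \<open>T = 0\<close> is the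
  fixed point of a contraction. The hypotheses on \<open>f\<^sub>-'''\<close> and \<open>f\<^sub>+'' - f\<^sub>-''\<close> at \<open>u\<^sub>0\<close> become \<open>f\<^sub>-''(m) < k\<close> and
  \<open>f\<^sub>+''(p) < k\<close> along the spine; these two signs give both \<open>|T'| < 1\<close> and the concavity
  of \<open>B\<close> across the ribs.
\<close>

section \<open>The spine equation\<close>

text \<open>On upper ribs \<open>B\<close> has the form
  \<open>fp(p) - (\<epsilon> - x2) S(p)\<close>, on lower ribs
  \<open>fm(m) - (\<epsilon> + x2) R(m)\<close>. If \<open>S' = R' = k\<close> on the spine,
  agreement of the x1-derivatives there reads
  \<open>fp'(p) - (\<epsilon> - T) k = fm'(m) - (\<epsilon> + T) k\<close>, which is the chord
  relation \<open>2 T k = fm'(m) - fp'(p)\<close>. Solving it for \<open>k\<close> would divide by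
  \<open>T\<close> exactly at the prescribed point. Subtracting the two equations for
  \<open>k\<close> gives instead \<open>(2 T k)' = (fm'(m) - fp'(p))'\<close>, so the relation
  propagates from \<open>T = 0\<close>, where it is the hypothesis \<open>fp'(u0) = fm'(u0)\<close>.
  At \<open>T = -\<epsilon>\<close> the substitution \<open>k = fm''(m) - (\<epsilon> + T) V\<close>
  leaves a linear left-hand side with homogeneous solution \<open>(\<epsilon> + T)^(-3)\<close>. The
  bounded \<open>V\<close> is therefore a weighted mean of the right-hand side and has no initial
  value to choose; the only free constant puts \<open>p = u0\<close> at \<open>T = 0\<close>. At
  \<open>T = \<epsilon>\<close> nothing is singular once the system is solved for \<open>p'\<close>,
  which then carries the factor \<open>\<epsilon> - T\<close>. Hence \<open>p' > 0\<close> except at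
  that end, while \<open>T' = 1 / (1 + p')\<close> along the spine.\<close>

lemma continuous_on_weighted_mean:
  fixes g w :: "real \<Rightarrow> real" and a :: "real \<Rightarrow> real \<Rightarrow> real"
  assumes g: "continuous_on S g" and w: "continuous_on {0..1} w"
    and a: "continuous_on (UNIV \<times> {0..1}) (\<lambda>(t, s). a t s)"
    and S: "\<And>t s. s \<in> {0..1} \<Longrightarrow> a t s \<in> S"
  shows "continuous_on UNIV (\<lambda>t. integral {0..1} (\<lambda>s. w s * g (a t s)))"
proof -
  have "continuous_on (UNIV \<times> cbox 0 1) (\<lambda>(t, s). w s * g (a t s))"
    unfolding case_prod_beta
  proof (intro continuous_intros)
    show "continuous_on (UNIV \<times> cbox 0 1) (\<lambda>x::real\<times>real. w (snd x))"
      by (rule continuous_on_compose2[OF w]) (auto intro!: continuous_intros)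
    show "continuous_on (UNIV \<times> cbox 0 1) (\<lambda>x. g (a (fst x) (snd x)))"
      by (rule continuous_on_compose2[OF g])
        (use a S in \<open>auto simp: case_prod_beta\<close>)
  qed
  from integral_continuous_on_param[OF this] show ?thesis by simp
qed

text \<open>With \<open>h\<close> equal to zero this doubles as the sup bound for the means.\<close>

lemma weighted_mean_lipschitz:
  fixes g h w :: "real \<Rightarrow> real"
  assumes "continuous_on {0..1} (\<lambda>s. w s * g s)" "continuous_on {0..1} (\<lambda>s. w s * h s)"
    and w: "\<And>s. s \<in> {0..1} \<Longrightarrow> \<bar>w s\<bar> \<le> 1"
    and d: "\<And>s. s \<in> {0..1} \<Longrightarrow> \<bar>g s - h s\<bar> \<le> d"
  shows "\<bar>integral {0..1} (\<lambda>s. w s * g s) - integral {0..1} (\<lambda>s. w s * h s)\<bar> \<le> d"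
proof -
  have i: "(\<lambda>s. w s * g s) integrable_on {0..1}" "(\<lambda>s. w s * h s) integrable_on {0..1}"
    using assms(1,2) by (auto intro: integrable_continuous_real)
  have "\<bar>w s * g s - w s * h s\<bar> \<le> d" if "s \<in> {0..1}" for s
    using mult_mono[OF w[OF that] d[OF that]] by (simp add: abs_mult flip: right_diff_distrib)
  moreover have "(\<lambda>s. w s * g s - w s * h s) integrable_on {0..1}"
    using i by (rule integrable_diff)
  ultimately have "norm (integral {0..1} (\<lambda>s. w s * g s - w s * h s)) \<le> integral {0..1} (\<lambda>s::real. d)"
    by (intro integral_norm_bound_integral) auto
  then show ?thesis
    using integral_diff[OF i] by simp
qed

text \<open>Picard iteration with different starting points: the first component integrates from
  \<open>t = 0\<close>, the second from the singular end \<open>t = -1\<close>. The weight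
  \<open>s\<^sup>2\<close> is what \<open>((1 + t)^3 y)' = (1 + t)^2 F2\<close> becomes after
  scaling the integration variable to \<open>[0, 1]\<close>. All weights are at most 1, so bounds
  and Lipschitz constants of \<open>F1\<close> and \<open>F2\<close> pass to the means, and 1/4 +
  1/4 gives the contraction factor 1/2.\<close>

lemma singular_volterra_pair:
  fixes A C :: real and F1 F2 :: "real \<Rightarrow> real \<times> real \<Rightarrow> real"
  defines "X \<equiv> {-A..A} \<times> {-C..C}"
  assumes "0 \<le> A" "0 \<le> C"
    and cont: "continuous_on ({-1..1} \<times> X) (\<lambda>(t, y). F1 t y)"
      "continuous_on ({-1..1} \<times> X) (\<lambda>(t, y). F2 t y)"
    and bound: "\<And>t y. t \<in> {-1..1} \<Longrightarrow> y \<in> X \<Longrightarrow> \<bar>F1 t y\<bar> \<le> A"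
      "\<And>t y. t \<in> {-1..1} \<Longrightarrow> y \<in> X \<Longrightarrow> \<bar>F2 t y\<bar> \<le> C"
    and lip: "\<And>t y z. t \<in> {-1..1} \<Longrightarrow> y \<in> X \<Longrightarrow> z \<in> X \<Longrightarrow> \<bar>F1 t y - F1 t z\<bar> \<le> dist y z / 4"
      "\<And>t y z. t \<in> {-1..1} \<Longrightarrow> y \<in> X \<Longrightarrow> z \<in> X \<Longrightarrow> \<bar>F2 t y - F2 t z\<bar> \<le> dist y z / 4"
  obtains \<phi> where "continuous_on {-1..1} \<phi>" "\<And>t. t \<in> {-1..1} \<Longrightarrow> \<phi> t \<in> X"
    "\<And>t. t \<in> {-1..1} \<Longrightarrow> fst (\<phi> t) = t * integral {0..1} (\<lambda>s. F1 (s * t) (\<phi> (s * t)))"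
    "\<And>t. t \<in> {-1..1} \<Longrightarrow> snd (\<phi> t) =
       integral {0..1} (\<lambda>s. s\<^sup>2 * F2 (s * (1 + t) - 1) (\<phi> (s * (1 + t) - 1)))"
proof -
  \<comment> \<open>Clamping the time lets the iteration act on bounded continuous functions on the
    whole line, where completeness is at hand.\<close>
  define c where "c t = max (-1) (min 1 t)" for t :: real
  have c: "c t \<in> {-1..1}" for t by (auto simp: c_def)
  have c_id: "c t = t" if "t \<in> {-1..1}" for t using that by (auto simp: c_def)
  have c_cont: "continuous_on S c" for S unfolding c_def by (intro continuous_intros)
  define a1 where "a1 t s = s * c t" for t s
  define a2 where "a2 t s = s * (1 + c t) - 1" for t s
  have a1: "a1 t s \<in> {-1..1}" if "s \<in> {0..1}" for t s
  proof -
    have "\<bar>s * c t\<bar> \<le> 1 * 1" unfolding abs_mult using that c[of t] by (intro mult_mono) auto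
    then show ?thesis by (auto simp: a1_def)
  qed
  have a2: "a2 t s \<in> {-1..1}" if "s \<in> {0..1}" for t s
  proof -
    have "s * (1 + c t) \<le> 1 * 2" using that c[of t] by (intro mult_mono) auto
    moreover have "0 \<le> s * (1 + c t)" using that c[of t] by auto
    ultimately show ?thesis by (auto simp: a2_def)
  qed
  have a_cont: "continuous_on (UNIV \<times> {0..1}) (\<lambda>(t, s). a1 t s)"
      "continuous_on (UNIV \<times> {0..1}) (\<lambda>(t, s). a2 t s)"
    unfolding a1_def a2_def case_prod_beta
    by (intro continuous_intros continuous_on_compose2[OF c_cont[of UNIV]]; auto)+
  have a_cont': "continuous_on {0..1} (a1 t)" "continuous_on {0..1} (a2 t)" for t
    unfolding a1_def a2_def by (intro continuous_intros)+
  define J1 where "J1 \<phi> t = integral {0..1} (\<lambda>s. 1 * F1 (a1 t s) (\<phi> (a1 t s)))" for \<phi> t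
  define J2 where "J2 \<phi> t = integral {0..1} (\<lambda>s. s\<^sup>2 * F2 (a2 t s) (\<phi> (a2 t s)))" for \<phi> t
  define S where "S = PiC UNIV (\<lambda>_::real. X)"
  have Sc: "apply_bcontfun \<phi> t \<in> X" if "\<phi> \<in> S" for \<phi> t
    using that by (auto simp: S_def mem_PiC_iff)
  have X: "closed X" unfolding X_def by (intro closed_Times) auto
  have "complete S" unfolding S_def by (metis X closed_PiC complete_eq_closed)
  have X0: "(0, 0) \<in> X" using assms by (auto simp: X_def)
  have "const_bcontfun (0, 0) \<in> S" using X0 by (auto simp: S_def mem_PiC_iff)
  then have "S \<noteq> {}" by blast
  have g_cont: "continuous_on {-1..1} (\<lambda>t. F1 t (apply_bcontfun \<phi> t))"
      "continuous_on {-1..1} (\<lambda>t. F2 t (apply_bcontfun \<phi> t))" if "\<phi> \<in> S" for \<phi>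
  proof -
    have "continuous_on {-1..1} (\<lambda>t. (t, apply_bcontfun \<phi> t))" by (intro continuous_intros) auto
    then show "continuous_on {-1..1} (\<lambda>t. F1 t (apply_bcontfun \<phi> t))"
      "continuous_on {-1..1} (\<lambda>t. F2 t (apply_bcontfun \<phi> t))"
      using continuous_on_compose2[OF cont(1), of "{-1..1}" "\<lambda>t. (t, apply_bcontfun \<phi> t)"]
        continuous_on_compose2[OF cont(2), of "{-1..1}" "\<lambda>t. (t, apply_bcontfun \<phi> t)"] Sc[OF that]
      by force+
  qed
  have J_cont: "continuous_on UNIV (J1 \<phi>)" "continuous_on UNIV (J2 \<phi>)" if "\<phi> \<in> S" for \<phi>
  proof -
    show "continuous_on UNIV (J1 \<phi>)" unfolding J1_def
      by (rule continuous_on_weighted_mean[OF g_cont(1)[OF that] _ a_cont(1)])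
        (use a1 in \<open>auto intro!: continuous_intros\<close>)
    show "continuous_on UNIV (J2 \<phi>)" unfolding J2_def
      by (rule continuous_on_weighted_mean[OF g_cont(2)[OF that] _ a_cont(2)])
        (use a2 in \<open>auto intro!: continuous_intros\<close>)
  qed
  have s_cont: "continuous_on {0..1} (\<lambda>s. 1 * F1 (a1 t s) (\<phi> (a1 t s)))"
    "continuous_on {0..1} (\<lambda>s. s\<^sup>2 * F2 (a2 t s) (\<phi> (a2 t s)))" if "\<phi> \<in> S" for \<phi> t
  proof -
    show "continuous_on {0..1} (\<lambda>s. 1 * F1 (a1 t s) (\<phi> (a1 t s)))"
      by (intro continuous_intros continuous_on_compose2[OF g_cont(1)[OF that] a_cont'(1)])
        (use a1 in auto)
    show "continuous_on {0..1} (\<lambda>s. s\<^sup>2 * F2 (a2 t s) (\<phi> (a2 t s)))"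
      by (intro continuous_intros continuous_on_compose2[OF g_cont(2)[OF that] a_cont'(2)])
        (use a2 in auto)
  qed
  have sq: "\<bar>s\<^sup>2\<bar> \<le> 1" if "s \<in> {0..1}" for s :: real
    using that by (auto simp: power_le_one)
  have z_cont: "continuous_on {0..1} (\<lambda>s::real. 1 * (0::real))" "continuous_on {0..1} (\<lambda>s::real. s\<^sup>2 * (0::real))"
    by (auto intro!: continuous_intros)
  have J_bound: "\<bar>J1 \<phi> t\<bar> \<le> A" "\<bar>J2 \<phi> t\<bar> \<le> C" if "\<phi> \<in> S" for \<phi> t
  proof -
    show "\<bar>J1 \<phi> t\<bar> \<le> A"
      using weighted_mean_lipschitz[OF s_cont(1)[OF that] z_cont(1)] bound(1) a1 Sc[OF that]
      by (simp add: J1_def)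
    show "\<bar>J2 \<phi> t\<bar> \<le> C"
      using weighted_mean_lipschitz[OF s_cont(2)[OF that] z_cont(2) sq] bound(2) a2 Sc[OF that]
      by (simp add: J2_def)
  qed
  define op where "op \<phi> t = (c t * J1 \<phi> t, J2 \<phi> t)" for \<phi> t
  have op_X: "op \<phi> t \<in> X" if "\<phi> \<in> S" for \<phi> t
  proof -
    have "\<bar>c t * J1 \<phi> t\<bar> \<le> 1 * A"
      unfolding abs_mult using c[of t] J_bound(1)[OF that, of t] by (intro mult_mono) auto
    then show ?thesis using J_bound(2)[OF that, of t] by (auto simp: op_def X_def)
  qed
  have op_b: "op \<phi> \<in> bcontfun" if "\<phi> \<in> S" for \<phi>
  proof -
    have "continuous_on UNIV (op \<phi>)"
      unfolding op_def using J_cont[OF that] c_cont[of UNIV] by (intro continuous_intros) auto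
    moreover have "bounded (range (op \<phi>))"
    proof (rule bounded_subset)
      show "bounded X" unfolding X_def by (intro bounded_Times) auto
    qed (use op_X[OF that] in auto)
    ultimately show ?thesis by (simp add: bcontfun_def)
  qed
  define Op where "Op \<phi> = Bcontfun (op (apply_bcontfun \<phi>))" for \<phi>
  have Op: "apply_bcontfun (Op \<phi>) = op \<phi>" if "\<phi> \<in> S" for \<phi>
    using op_b[OF that] by (simp add: Op_def Bcontfun_inverse)
  have "Op ` S \<subseteq> S"
    using op_X by (auto simp: S_def mem_PiC_iff Op)
  moreover have "dist (Op \<phi>) (Op \<psi>) \<le> 1/2 * dist \<phi> \<psi>" if *: "\<phi> \<in> S" "\<psi> \<in> S" for \<phi> \<psi>
  proof (rule dist_bound)
    fix t
    let ?d = "dist \<phi> \<psi> / 4"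
    have d: "dist (apply_bcontfun \<phi> s) (apply_bcontfun \<psi> s) / 4 \<le> ?d" for s
      using dist_bounded[of \<phi> s \<psi>] by simp
    have "\<bar>J1 \<phi> t - J1 \<psi> t\<bar> \<le> ?d"
      unfolding J1_def using order_trans[OF lip(1)[OF a1 Sc Sc] d] *
      by (intro weighted_mean_lipschitz s_cont) auto
    then have "\<bar>c t * (J1 \<phi> t - J1 \<psi> t)\<bar> \<le> 1 * ?d"
      unfolding abs_mult using c[of t] by (intro mult_mono) auto
    moreover have "\<bar>J2 \<phi> t - J2 \<psi> t\<bar> \<le> ?d"
      unfolding J2_def using order_trans[OF lip(2)[OF a2 Sc Sc] d] *
      by (intro weighted_mean_lipschitz s_cont sq) auto
    moreover have "dist (op \<phi> t) (op \<psi> t) \<le> \<bar>c t * (J1 \<phi> t - J1 \<psi> t)\<bar> + \<bar>J2 \<phi> t - J2 \<psi> t\<bar>"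
      unfolding op_def dist_Pair_Pair dist_real_def
      by (rule order_trans[OF sqrt_sum_squares_le_sum_abs]) (simp add: right_diff_distrib)
    ultimately show "dist (apply_bcontfun (Op \<phi>) t) (apply_bcontfun (Op \<psi>) t) \<le> 1/2 * dist \<phi> \<psi>"
      using * by (simp add: Op)
  qed
  ultimately have "\<exists>!\<phi>. \<phi> \<in> S \<and> Op \<phi> = \<phi>"
    using Banach_fix[OF \<open>complete S\<close> \<open>S \<noteq> {}\<close>, of "1/2" Op] by simp
  then obtain \<phi> where \<phi>: "\<phi> \<in> S" "Op \<phi> = \<phi>" by blast
  then have eq: "apply_bcontfun \<phi> t = op \<phi> t" for t using Op by metis
  show thesis
  proof (rule that)
    show "continuous_on {-1..1} \<phi>" by simp
    show "\<phi> t \<in> X" for t using Sc \<phi> by blast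
    fix t :: real assume t: "t \<in> {-1..1}"
    show "fst (\<phi> t) = t * integral {0..1} (\<lambda>s. F1 (s * t) (\<phi> (s * t)))"
      by (subst eq) (simp add: op_def J1_def a1_def c_id[OF t])
    show "snd (\<phi> t) = integral {0..1} (\<lambda>s. s\<^sup>2 * F2 (s * (1 + t) - 1) (\<phi> (s * (1 + t) - 1)))"
      by (subst eq) (simp add: op_def J2_def a2_def c_id[OF t])
  qed
qed

text \<open>Turns the means in the fixed-point equations back into antiderivatives. With the factor
  \<open>b - a\<close> under the integral, the case \<open>a = b\<close> is included.\<close>

lemma integral_along_segment:
  fixes G q :: "real \<Rightarrow> real"
  assumes G: "\<And>x. x \<in> S \<Longrightarrow> (G has_real_derivative q x) (at x within S)"
    and S: "\<And>s. s \<in> {0..1} \<Longrightarrow> a + s * (b - a) \<in> S"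
  shows "integral {0..1} (\<lambda>s. (b - a) * q (a + s * (b - a))) = G b - G a"
proof -
  have "((\<lambda>s. G (a + s * (b - a))) has_real_derivative q (a + s * (b - a)) * (b - a))
      (at s within {0..1})" if "s \<in> {0..1}" for s
  proof (rule DERIV_image_chain[of G _ "\<lambda>s. a + s * (b - a)", unfolded o_def])
    show "((\<lambda>s. a + s * (b - a)) has_real_derivative b - a) (at s within {0..1})"
      by (auto intro!: derivative_eq_intros)
    show "(G has_real_derivative q (a + s * (b - a))) (at (a + s * (b - a)) within (\<lambda>s. a + s * (b - a)) ` {0..1})"
      by (rule has_field_derivative_subset[OF G]) (use S that in auto)
  qed
  then have "((\<lambda>s. (b - a) * q (a + s * (b - a))) has_integral G (a + 1 * (b - a)) - G (a + 0 * (b - a))) {0..1}"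
    by (intro fundamental_theorem_of_calculus)
      (auto simp: has_real_derivative_iff_has_vector_derivative mult.commute)
  then show ?thesis by (intro integral_unique) simp
qed

lemma eventually_at_right_0_mult_le:
  fixes c K :: real
  assumes "0 < c"
  shows "\<forall>\<^sub>F e in at_right 0. e * K \<le> c"
proof -
  have "((\<lambda>e. e * K) \<longlongrightarrow> 0 * K) (at_right 0)" by (intro tendsto_intros)
  then have "\<forall>\<^sub>F e in at_right 0. e * K < c" using assms by (intro order_tendstoD) auto
  then show ?thesis by eventually_elim simp
qed

lemma abs_diff_le_of_derivative_bound:
  fixes f f' :: "real \<Rightarrow> real"
  assumes "\<And>x. (f has_real_derivative f' x) (at x)"
    and "\<And>x. x \<in> {a..b} \<Longrightarrow> \<bar>f' x\<bar> \<le> L" "x \<in> {a..b}" "y \<in> {a..b}"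
  shows "\<bar>f x - f y\<bar> \<le> L * \<bar>x - y\<bar>"
  using field_differentiable_bound[of "{a..b}" f f' L x y] assms
  by (force intro: has_field_derivative_at_within)

lemma quotient_diff_le:
  fixes n n' d d' :: real
  assumes "0 < c" "c \<le> \<bar>d\<bar>" "c \<le> \<bar>d'\<bar>" "\<bar>n'\<bar> \<le> N" "\<bar>n - n'\<bar> \<le> x" "\<bar>d - d'\<bar> \<le> y"
  shows "\<bar>n / d - n' / d'\<bar> \<le> x / c + N * y / c\<^sup>2"
proof -
  have nz: "d \<noteq> 0" "d' \<noteq> 0" using assms by auto
  have "n / d - n' / d' = (n - n') / d + n' * (d' - d) / (d * d')"
    using nz by (simp add: divide_simps) algebra
  also have "\<bar>\<dots>\<bar> \<le> \<bar>n - n'\<bar> / \<bar>d\<bar> + \<bar>n'\<bar> * \<bar>d' - d\<bar> / (\<bar>d\<bar> * \<bar>d'\<bar>)"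
    by (metis abs_triangle_ineq abs_divide abs_mult)
  also have "\<dots> \<le> x / c + N * y / (c * c)"
    using assms by (intro add_mono frac_le mult_mono) auto
  finally show ?thesis by (simp add: power2_eq_square)
qed

text \<open>The spine in the unknowns \<open>P\<close>, \<open>V\<close> rescaled by \<open>\<epsilon>\<close>: the ribs over \<open>T = \<epsilon> \<theta>\<close> end at
  \<open>u0 + \<epsilon> P\<close> above and at \<open>u0 + \<epsilon> (P + 2 \<theta>)\<close> below, and the chord slope \<open>k\<close> there is
  \<open>f\<^sub>-'' - \<epsilon> (1 + \<theta>) V\<close>. The system is singular at \<open>\<theta> = -1\<close>; \<open>V\<close> is the solution regular there.\<close>

lemma rescaled_spine_exists:
  fixes g2 g3 f2 f3 f4 :: "real \<Rightarrow> real" and u0 :: real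
  assumes g2: "\<And>x. (g2 has_real_derivative g3 x) (at x)"
    and f2: "\<And>x. (f2 has_real_derivative f3 x) (at x)"
    and f3: "\<And>x. (f3 has_real_derivative f4 x) (at x)"
    and cont: "continuous_on UNIV g3" "continuous_on UNIV f4"
    and neg: "g2 u0 < f2 u0" "f3 u0 < 0"
  shows "\<forall>\<^sub>F \<epsilon> in at_right 0. \<exists>P V E.
    continuous_on {-1..1} V \<and> continuous_on {-1..1} E \<and> P 0 = 0 \<and>
    (\<forall>t\<in>{-1..1}.
      (P has_real_derivative E t) (at t within {-1..1}) \<and> \<bar>P t\<bar> < 1 \<and> V t < 0 \<and>
      g2 (u0 + \<epsilon> * P t) - f2 (u0 + \<epsilon> * (P t + 2 * t)) + 2 * \<epsilon> * t * V t < 0 \<and>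
      E t * (g2 (u0 + \<epsilon> * P t) - f2 (u0 + \<epsilon> * (P t + 2 * t)) + 2 * \<epsilon> * t * V t) = 2 * \<epsilon> * (1 - t) * V t) \<and>
    (\<forall>t\<in>{-1<..<1}. ((\<lambda>t. (1 + t) * V t) has_real_derivative
      (2 + E t) * (f3 (u0 + \<epsilon> * (P t + 2 * t)) - V t)) (at t))"
proof -
  \<comment> \<open>For \<open>\<epsilon> \<le> 1\<close> both rib ends stay in \<open>I\<close>,
    because \<open>\<bar>P\<bar> \<le> 1/2\<close> and
    \<open>\<bar>2 t\<bar> \<le> 2\<close>.\<close>
  define I where "I = {u0 - 3..u0 + 3}"
  \<comment> \<open>One constant serves as Lipschitz constant of \<open>g2\<close>,
    \<open>f2\<close>, \<open>f3\<close> and as sup bound of \<open>f3\<close>.\<close>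
  obtain L where L: "1 \<le> L" "\<And>x. x \<in> I \<Longrightarrow> \<bar>g3 x\<bar> \<le> L" "\<And>x. x \<in> I \<Longrightarrow> \<bar>f3 x\<bar> \<le> L"
    "\<And>x. x \<in> I \<Longrightarrow> \<bar>f4 x\<bar> \<le> L"
  proof -
    have "compact I" by (simp add: I_def)
    moreover have "continuous_on I g3" "continuous_on I f3" "continuous_on I f4"
      using cont f3 by (auto intro: continuous_on_subset DERIV_continuous_on has_field_derivative_at_within)
    ultimately have "bounded (g3 ` I)" "bounded (f3 ` I)" "bounded (f4 ` I)"
      by (auto intro: compact_imp_bounded compact_continuous_image)
    then obtain a b c where "\<forall>x\<in>I. \<bar>g3 x\<bar> \<le> a" "\<forall>x\<in>I. \<bar>f3 x\<bar> \<le> b" "\<forall>x\<in>I. \<bar>f4 x\<bar> \<le> c"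
      unfolding bounded_iff by auto
    then show thesis by (intro that[of "max (max a b) (max c 1)"]) (auto simp: le_max_iff_disj)
  qed
  \<comment> \<open>\<open>F2\<close> is at most \<open>2 L\<close> from its first term plus 1 from
    the second, which carries a factor \<epsilon>. Half of the gap at \<open>u0\<close>, called
    \<open>\<beta>\<close>, is what remains as a lower bound for the modulus of the
    denominator.\<close>
  define C where "C = 2 * L + 1"
  define \<beta> where "\<beta> = (f2 u0 - g2 u0) / 2"
  have \<beta>: "0 < \<beta>" and C: "0 < C" using neg L by (auto simp: \<beta>_def C_def)
  \<comment> \<open>\<open>\<epsilon> K\<close> and \<open>\<epsilon> K2\<close> will be Lipschitz
    constants of \<open>F1\<close> (quotient estimate) and \<open>F2\<close> (product
    estimate).\<close>
  define K where "K = 4 / \<beta> + 4 * C * (2 * L + 2) / \<beta>\<^sup>2"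
  define K2 where "K2 = 2 * L + K * (L + C) + 4 * C / \<beta> * (L + 1)"
  \<comment> \<open>After the localization these requirements give, in turn, the bound on the
    denominator, the bounds on \<open>F1\<close> and \<open>F2\<close>, and the two constants 1/4.
    The last one keeps \<open>F2\<close> below \<open>f3 u0\<close>: since \<open>2 f3\<close> is at
    most \<open>2 f3 u0 + 6 L \<epsilon>\<close>, one copy of \<open>- f3 u0\<close> absorbs all
    errors.\<close>
  have "\<forall>\<^sub>F \<epsilon> in at_right 0. 0 < \<epsilon> \<and> \<epsilon> * 1 \<le> 1 \<and> \<epsilon> * (4 * L + 2 * C) \<le> \<beta> \<and> \<epsilon> * (4 * C / \<beta>) \<le> 1 / 2
     \<and> \<epsilon> * (4 * C / \<beta> * (L + C)) \<le> 1 \<and> \<epsilon> * K \<le> 1 / 4 \<and> \<epsilon> * K2 \<le> 1 / 4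
     \<and> \<epsilon> * (6 * L + 4 * C / \<beta> * (L + C)) \<le> - f3 u0"
    using \<beta> neg by (intro eventually_conj eventually_at_right_0_mult_le eventually_at_right_less) auto
  then show ?thesis
  proof (eventually_elim, elim conjE)
    fix \<epsilon> :: real
    assume e: "0 < \<epsilon>" "\<epsilon> * 1 \<le> 1" "\<epsilon> * (4 * L + 2 * C) \<le> \<beta>" "\<epsilon> * (4 * C / \<beta>) \<le> 1 / 2"
      "\<epsilon> * (4 * C / \<beta> * (L + C)) \<le> 1" "\<epsilon> * K \<le> 1 / 4" "\<epsilon> * K2 \<le> 1 / 4"
      "\<epsilon> * (6 * L + 4 * C / \<beta> * (L + C)) \<le> - f3 u0"
    define X :: "(real \<times> real) set" where "X = {-(1/2)..1/2} \<times> {-C..C}"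
    define pp where "pp y = u0 + \<epsilon> * fst y" for y :: "real \<times> real"
    define mm where "mm t y = u0 + \<epsilon> * (fst y + 2 * t)" for t and y :: "real \<times> real"
    define den where "den t y = g2 (pp y) - f2 (mm t y) + 2 * \<epsilon> * t * snd y" for t y
    define num where "num t y = 2 * \<epsilon> * (1 - t) * snd y" for t and y :: "real \<times> real"
    define F1 where "F1 t y = num t y / den t y" for t y
    \<comment> \<open>Right-hand side of \<open>(1 + t) V' + 3 V = F2\<close>, obtained from
      \<open>((1 + t) V)' = (2 + E) (f3 - V)\<close> by moving the summand \<open>-2 V\<close> to
      the left.\<close>
    define F2 where "F2 t y = 2 * f3 (mm t y) + F1 t y * (f3 (mm t y) - snd y)" for t y
    have fy: "\<bar>fst y\<bar> \<le> 1 / 2" "\<bar>snd y\<bar> \<le> C" if "y \<in> X" for y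
      using that by (auto simp: X_def)
    have dpp: "\<bar>pp y - u0\<bar> \<le> \<epsilon>" if "y \<in> X" for y
      using mult_left_mono[of "\<bar>fst y\<bar>" 1 \<epsilon>] fy[OF that] e by (simp add: pp_def abs_mult)
    have dmm: "\<bar>mm t y - u0\<bar> \<le> 3 * \<epsilon>" if "t \<in> {-1..1}" "y \<in> X" for t y
    proof -
      have "\<bar>fst y + 2 * t\<bar> \<le> 3" using fy(1)[OF that(2)] that(1) unfolding atLeastAtMost_iff by linarith
      then show ?thesis using mult_left_mono[of "\<bar>fst y + 2 * t\<bar>" 3 \<epsilon>] e by (simp add: mm_def abs_mult)
    qed
    have u0: "u0 \<in> I" by (simp add: I_def)
    have ppI: "pp y \<in> I" if "y \<in> X" for y
      using dpp[OF that] e by (auto simp: I_def abs_le_iff)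
    have mmI: "mm t y \<in> I" if "t \<in> {-1..1}" "y \<in> X" for t y
      using dmm[OF that] e by (auto simp: I_def abs_le_iff)
    have Lg2: "\<bar>g2 x - g2 y\<bar> \<le> L * \<bar>x - y\<bar>" and Lf2: "\<bar>f2 x - f2 y\<bar> \<le> L * \<bar>x - y\<bar>"
      and Lf3: "\<bar>f3 x - f3 y\<bar> \<le> L * \<bar>x - y\<bar>" if "x \<in> I" "y \<in> I" for x y
      using that L(2-4) unfolding I_def
      by (auto intro!: abs_diff_le_of_derivative_bound[OF g2, of "u0 - 3" "u0 + 3"]
          abs_diff_le_of_derivative_bound[OF f2, of "u0 - 3" "u0 + 3"]
          abs_diff_le_of_derivative_bound[OF f3, of "u0 - 3" "u0 + 3"])
    have tV: "\<bar>2 * \<epsilon> * t * v\<bar> \<le> 2 * \<epsilon> * \<bar>v\<bar>" if "t \<in> {-1..1}" for t v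
      using mult_right_mono[of "\<bar>t\<bar>" 1 "\<bar>v\<bar>"] that e by (simp add: abs_mult abs_le_iff)
    have den: "den t y \<le> - \<beta>" if t: "t \<in> {-1..1}" and y: "y \<in> X" for t y
    proof -
      have "g2 (pp y) \<le> g2 u0 + L * \<epsilon>"
        using Lg2[OF ppI[OF y] u0] mult_left_mono[OF dpp[OF y], of L] L(1) by linarith
      moreover have "f2 (mm t y) \<ge> f2 u0 - L * (3 * \<epsilon>)"
        using Lf2[OF mmI[OF t y] u0] mult_left_mono[OF dmm[OF t y], of L] L(1) by linarith
      moreover have "2 * \<epsilon> * t * snd y \<le> 2 * \<epsilon> * C"
        using tV[OF t, of "snd y"] mult_left_mono[OF fy(2)[OF y], of "2 * \<epsilon>"] e by linarith
      moreover have "\<epsilon> * (4 * L + 2 * C) = 4 * (L * \<epsilon>) + 2 * \<epsilon> * C" by (simp add: algebra_simps)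
      ultimately show ?thesis using e(3) unfolding den_def \<beta>_def by (simp add: field_simps)
    qed
    have num: "\<bar>num t y\<bar> \<le> 4 * \<epsilon> * \<bar>snd y\<bar>" if t: "t \<in> {-1..1}" for t y
    proof -
      have "\<bar>1 - t\<bar> * \<bar>snd y\<bar> \<le> 2 * \<bar>snd y\<bar>" using t by (intro mult_right_mono) auto
      from mult_left_mono[OF this, of "2 * \<epsilon>"]
      have "2 * \<epsilon> * (\<bar>1 - t\<bar> * \<bar>snd y\<bar>) \<le> 4 * \<epsilon> * \<bar>snd y\<bar>" using e(1) by simp
      moreover have "\<bar>num t y\<bar> = 2 * \<epsilon> * (\<bar>1 - t\<bar> * \<bar>snd y\<bar>)" using e(1) by (simp add: num_def abs_mult)
      ultimately show ?thesis by simp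
    qed
    have numC: "\<bar>num t y\<bar> \<le> 4 * \<epsilon> * C" if t: "t \<in> {-1..1}" and y: "y \<in> X" for t y
      using num[OF t, of y] mult_left_mono[OF fy(2)[OF y], of "4 * \<epsilon>"] e by linarith
    have F1: "\<bar>F1 t y\<bar> \<le> \<epsilon> * (4 * C / \<beta>)" if t: "t \<in> {-1..1}" and y: "y \<in> X" for t y
    proof -
      have "\<bar>num t y\<bar> / \<bar>den t y\<bar> \<le> 4 * \<epsilon> * C / \<beta>"
        using den[OF t y] numC[OF t y] \<beta> e(1) C by (intro frac_le) auto
      then show ?thesis by (simp add: F1_def mult_ac)
    qed
    have f3V: "\<bar>f3 (mm t y) - snd y\<bar> \<le> L + C" if t: "t \<in> {-1..1}" and y: "y \<in> X" for t y
      using L(3)[OF mmI[OF t y]] fy[OF y] by linarith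
    have F1f: "\<bar>F1 t y * (f3 (mm t y) - snd y)\<bar> \<le> \<epsilon> * (4 * C / \<beta> * (L + C))"
      if t: "t \<in> {-1..1}" and y: "y \<in> X" for t y
      using mult_mono[OF F1[OF t y] f3V[OF t y]] L C e \<beta> by (simp add: abs_mult mult_ac)
    have dist: "\<bar>fst y - fst z\<bar> \<le> dist y z" "\<bar>snd y - snd z\<bar> \<le> dist y z" for y z :: "real \<times> real"
      using dist_fst_le[of y z] dist_snd_le[of y z] by (auto simp: dist_real_def)
    have F1_lip: "\<bar>F1 t y - F1 t z\<bar> \<le> \<epsilon> * K * dist y z"
      if t: "t \<in> {-1..1}" and y: "y \<in> X" and z: "z \<in> X" for t y z
    proof -
      have "num t y - num t z = num t (0, snd y - snd z)" by (simp add: num_def algebra_simps)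
      then have "\<bar>num t y - num t z\<bar> \<le> 4 * \<epsilon> * \<bar>snd y - snd z\<bar>"
        using num[OF t, of "(0, snd y - snd z)"] by simp
      then have 1: "\<bar>num t y - num t z\<bar> \<le> 4 * \<epsilon> * dist y z"
        using mult_left_mono[OF dist(2)[of y z], of "4 * \<epsilon>"] e(1) by linarith
      have *: "\<bar>pp y - pp z\<bar> \<le> \<epsilon> * dist y z" "\<bar>mm t y - mm t z\<bar> \<le> \<epsilon> * dist y z"
        using mult_left_mono[OF dist(1)[of y z], of \<epsilon>] e
        by (auto simp: pp_def mm_def abs_mult simp flip: right_diff_distrib)
      have "\<bar>g2 (pp y) - g2 (pp z)\<bar> \<le> L * (\<epsilon> * dist y z)"
        using Lg2[OF ppI[OF y] ppI[OF z]] mult_left_mono[OF *(1), of L] L(1) by linarith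
      moreover have "\<bar>f2 (mm t y) - f2 (mm t z)\<bar> \<le> L * (\<epsilon> * dist y z)"
        using Lf2[OF mmI[OF t y] mmI[OF t z]] mult_left_mono[OF *(2), of L] L(1) by linarith
      moreover have "\<bar>2 * \<epsilon> * t * (snd y - snd z)\<bar> \<le> 2 * \<epsilon> * dist y z"
        using tV[OF t, of "snd y - snd z"] mult_left_mono[OF dist(2)[of y z], of "2 * \<epsilon>"] e by linarith
      moreover have "den t y - den t z = (g2 (pp y) - g2 (pp z)) - (f2 (mm t y) - f2 (mm t z))
          + 2 * \<epsilon> * t * (snd y - snd z)"
        by (simp add: den_def algebra_simps)
      ultimately have "\<bar>den t y - den t z\<bar> \<le> L * (\<epsilon> * dist y z) + L * (\<epsilon> * dist y z) + 2 * \<epsilon> * dist y z"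
        by linarith
      then have 2: "\<bar>den t y - den t z\<bar> \<le> \<epsilon> * (2 * L + 2) * dist y z" by (simp add: algebra_simps)
      have "\<bar>F1 t y - F1 t z\<bar> \<le> 4 * \<epsilon> * dist y z / \<beta> + 4 * \<epsilon> * C * (\<epsilon> * (2 * L + 2) * dist y z) / \<beta>\<^sup>2"
        unfolding F1_def
        by (rule quotient_diff_le[OF \<beta> _ _ numC[OF t z] 1 2]) (use den[OF t y] den[OF t z] in linarith)+
      also have "4 * \<epsilon> * C * (\<epsilon> * (2 * L + 2) * dist y z) / \<beta>\<^sup>2 = \<epsilon> * (\<epsilon> * (4 * C * (2 * L + 2) * dist y z) / \<beta>\<^sup>2)"
        by (simp add: mult_ac)
      also have "\<dots> \<le> 1 * (\<epsilon> * (4 * C * (2 * L + 2) * dist y z) / \<beta>\<^sup>2)"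
        using e C L by (intro mult_right_mono) auto
      finally show ?thesis by (simp add: K_def algebra_simps add_divide_distrib)
    qed
    have F2_lip: "\<bar>F2 t y - F2 t z\<bar> \<le> \<epsilon> * K2 * dist y z"
      if t: "t \<in> {-1..1}" and y: "y \<in> X" and z: "z \<in> X" for t y z
    proof -
      let ?d = "dist y z"
      have tri: "\<bar>2 * a + b + c\<bar> \<le> 2 * A + B + D" if "\<bar>a\<bar> \<le> A" "\<bar>b\<bar> \<le> B" "\<bar>c\<bar> \<le> D" for a b c A B D :: real
        using that by linarith
      have "\<bar>mm t y - mm t z\<bar> \<le> \<epsilon> * ?d"
        using mult_left_mono[OF dist(1)[of y z], of \<epsilon>] e
        by (auto simp: mm_def abs_mult simp flip: right_diff_distrib)
      then have 1: "\<bar>f3 (mm t y) - f3 (mm t z)\<bar> \<le> L * (\<epsilon> * ?d)"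
        using Lf3[OF mmI[OF t y] mmI[OF t z]] mult_left_mono[of "\<bar>mm t y - mm t z\<bar>" "\<epsilon> * ?d" L] L(1) by linarith
      have "L * (\<epsilon> * ?d) \<le> L * (1 * ?d)" using e L by (intro mult_left_mono mult_right_mono) auto
      then have 2: "\<bar>(f3 (mm t y) - snd y) - (f3 (mm t z) - snd z)\<bar> \<le> (L + 1) * ?d"
        using 1 dist(2)[of y z] by (simp add: algebra_simps)
      have a1: "\<bar>(F1 t y - F1 t z) * (f3 (mm t y) - snd y)\<bar> \<le> \<epsilon> * K * ?d * (L + C)"
        unfolding abs_mult using F1_lip[OF t y z] f3V[OF t y] by (intro mult_mono) auto
      have a2: "\<bar>F1 t z * ((f3 (mm t y) - snd y) - (f3 (mm t z) - snd z))\<bar> \<le> \<epsilon> * (4 * C / \<beta>) * ((L + 1) * ?d)"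
        unfolding abs_mult using F1[OF t z] 2 by (intro mult_mono) auto
      have a3: "F2 t y - F2 t z = 2 * (f3 (mm t y) - f3 (mm t z)) + (F1 t y - F1 t z) * (f3 (mm t y) - snd y)
          + F1 t z * ((f3 (mm t y) - snd y) - (f3 (mm t z) - snd z))"
        by (simp add: F2_def algebra_simps)
      have "\<bar>F2 t y - F2 t z\<bar> \<le> 2 * (L * (\<epsilon> * ?d)) + \<epsilon> * K * ?d * (L + C) + \<epsilon> * (4 * C / \<beta>) * ((L + 1) * ?d)"
        unfolding a3 by (rule tri[OF 1 a1 a2])
      also have "\<dots> = \<epsilon> * K2 * ?d" by (simp add: K2_def algebra_simps)
      finally show ?thesis .
    qed
    have small: "c * dist y z \<le> dist y z / 4" if "c \<le> 1 / 4" for c and y z :: "real \<times> real"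
      using mult_right_mono[OF that, of "dist y z"] by simp
    have gc: "continuous_on S g2" "continuous_on S f2" "continuous_on S f3" for S
      by (rule DERIV_continuous_on[OF has_field_derivative_at_within], rule g2 f2 f3)+
    have F1_cont: "continuous_on ({-1..1} \<times> X) (\<lambda>(t, y). F1 t y)"
      unfolding F1_def case_prod_beta
    proof (intro continuous_on_divide)
      show "continuous_on ({-1..1} \<times> X) (\<lambda>z. num (fst z) (snd z))"
        unfolding num_def by (intro continuous_intros)
      show "continuous_on ({-1..1} \<times> X) (\<lambda>z. den (fst z) (snd z))"
        unfolding den_def pp_def mm_def
        by (intro continuous_intros continuous_on_compose2[OF gc(1)[of UNIV]] continuous_on_compose2[OF gc(2)[of UNIV]]) auto
      show "\<forall>z\<in>{-1..1} \<times> X. den (fst z) (snd z) \<noteq> 0" using den \<beta> by force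
    qed
    have f3m_cont: "continuous_on ({-1..1} \<times> X) (\<lambda>z. f3 (mm (fst z) (snd z)))"
      unfolding mm_def by (intro continuous_on_compose2[OF gc(3)[of UNIV]] continuous_intros) auto
    have F2_cont: "continuous_on ({-1..1} \<times> X) (\<lambda>(t, y). F2 t y)"
      unfolding F2_def case_prod_beta using F1_cont[unfolded case_prod_beta] f3m_cont
      by (intro continuous_intros)
    obtain \<phi> where \<phi>: "continuous_on {-1..1} \<phi>" "\<And>t. t \<in> {-1..1} \<Longrightarrow> \<phi> t \<in> X"
      "\<And>t. t \<in> {-1..1} \<Longrightarrow> fst (\<phi> t) = t * integral {0..1} (\<lambda>s. F1 (s * t) (\<phi> (s * t)))"
      "\<And>t. t \<in> {-1..1} \<Longrightarrow> snd (\<phi> t) =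
         integral {0..1} (\<lambda>s. s\<^sup>2 * F2 (s * (1 + t) - 1) (\<phi> (s * (1 + t) - 1)))"
    proof (rule singular_volterra_pair[of "1/2" C F1 F2, folded X_def])
      show "\<bar>F2 t y\<bar> \<le> C" if "t \<in> {-1..1}" "y \<in> X" for t y
        using F1f[OF that] e L(3)[OF mmI[OF that]] unfolding F2_def C_def by linarith
      show "\<bar>F1 t y\<bar> \<le> 1 / 2" if "t \<in> {-1..1}" "y \<in> X" for t y
        using F1[OF that] e by linarith
      show "\<bar>F1 t y - F1 t z\<bar> \<le> dist y z / 4" "\<bar>F2 t y - F2 t z\<bar> \<le> dist y z / 4"
        if "t \<in> {-1..1}" "y \<in> X" "z \<in> X" for t y z
        using F1_lip[OF that] F2_lip[OF that] small[OF e(6), of y z] small[OF e(7), of y z] by linarith+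
    qed (use C F1_cont F2_cont in \<open>auto simp: less_imp_le\<close>)
    define P where "P t = fst (\<phi> t)" for t
    define V where "V t = snd (\<phi> t)" for t
    define E where "E t = F1 t (\<phi> t)" for t
    define W where "W t = F2 t (\<phi> t)" for t
    have pair: "continuous_on {-1..1} (\<lambda>t. (t, \<phi> t))" by (intro continuous_intros \<phi>)
    have E_cont: "continuous_on {-1..1} E" and W_cont: "continuous_on {-1..1} W"
      unfolding E_def W_def
      using continuous_on_compose2[OF F1_cont pair] continuous_on_compose2[OF F2_cont pair] \<phi>(2) by (auto simp: image_subset_iff)
    have V_cont: "continuous_on {-1..1} V" unfolding V_def by (intro continuous_intros \<phi>)
    \<comment> \<open>The antiderivative starts at the left end -1 and is shifted by a constant, so
      that both signs of \<open>t\<close> are treated at once.\<close>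
    have P_eq: "P t = integral {-1..t} E - integral {-1..0} E" if t: "t \<in> {-1..1}" for t
    proof -
      have "0 + s * (t - 0) \<in> {-1..1}" if s: "s \<in> {0..1}" for s
      proof -
        have "\<bar>s * t\<bar> \<le> 1 * 1" unfolding abs_mult using t s by (intro mult_mono) auto
        then show ?thesis by auto
      qed
      from integral_along_segment[OF integral_has_real_derivative[OF E_cont], OF _ this, simplified]
      show ?thesis using \<phi>(3)[OF t] by (simp add: P_def E_def)
    qed
    have P_deriv: "(P has_real_derivative E t) (at t within {-1..1})" if t: "t \<in> {-1..1}" for t
    proof (rule has_field_derivative_transform_within[where d=1])
      show "((\<lambda>t. integral {-1..t} E - integral {-1..0} E) has_real_derivative E t) (at t within {-1..1})"
        using DERIV_diff[OF integral_has_real_derivative[OF E_cont t] DERIV_const] by simp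
    qed (use P_eq t in auto)
    \<comment> \<open>The integrating factor \<open>(1 + t)^3\<close> removes the singularity:
      \<open>H\<close> equals \<open>(1 + t)^3 V\<close> and is differentiable up to
      \<open>t = -1\<close>.\<close>
    define H where "H t = integral {-1..t} (\<lambda>s. (1 + s)\<^sup>2 * W s)" for t
    have H_deriv: "(H has_real_derivative (1 + t)\<^sup>2 * W t) (at t within {-1..1})" if "t \<in> {-1..1}" for t
      unfolding H_def by (rule integral_has_real_derivative[OF _ that]) (intro continuous_intros W_cont)
    have V_eq: "(1 + t)^3 * V t = H t" if t: "t \<in> {-1..1}" for t
    proof -
      have *: "-1 + s * (t - (-1)) \<in> {-1..1}" if s: "s \<in> {0..1}" for s
        using mult_mono[of s 1 "1 + t" 2] mult_nonneg_nonneg[of s "1 + t"] t s by (auto simp: algebra_simps)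
      have "(1 + t)^3 * V t = integral {0..1} (\<lambda>s. (1 + t)^3 * (s\<^sup>2 * W (s * (1 + t) - 1)))"
        using \<phi>(4)[OF t] by (simp add: V_def W_def)
      also have "\<dots> = integral {0..1} (\<lambda>s. (t - (-1)) * ((1 + (-1 + s * (t - (-1))))\<^sup>2 * W (-1 + s * (t - (-1)))))"
        by (rule integral_cong) (simp add: power3_eq_cube power2_eq_square algebra_simps)
      also have "\<dots> = H t - H (-1)"
        by (rule integral_along_segment[OF H_deriv *])
      finally show ?thesis by (simp add: H_def)
    qed
    have W_le: "W t \<le> f3 u0" if t: "t \<in> {-1..1}" for t
    proof -
      have "f3 (mm t (\<phi> t)) \<le> f3 u0 + L * (3 * \<epsilon>)"
        using Lf3[OF mmI[OF t \<phi>(2)[OF t]] u0] mult_left_mono[OF dmm[OF t \<phi>(2)[OF t]], of L] L(1) by linarith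
      moreover have "\<epsilon> * (6 * L + 4 * C / \<beta> * (L + C)) = 6 * (L * \<epsilon>) + \<epsilon> * (4 * C / \<beta> * (L + C))"
        by (simp add: algebra_simps)
      ultimately show ?thesis
        using F1f[OF t \<phi>(2)[OF t]] e(8) unfolding W_def F2_def by linarith
    qed
    have V_neg: "V t < 0" if t: "t \<in> {-1..1}" for t
    proof -
      have *: "s * (1 + t) - 1 \<in> {-1..1}" if s: "s \<in> {0..1}" for s
        using mult_mono[of s 1 "1 + t" 2] mult_nonneg_nonneg[of s "1 + t"] t s by (auto simp: algebra_simps)
      have W: "continuous_on {0..1} (\<lambda>s. s\<^sup>2 * W (s * (1 + t) - 1))"
        by (intro continuous_intros continuous_on_compose2[OF W_cont]) (use * in auto)
      \<comment> \<open>The weight \<open>s\<^sup>2\<close> has total mass 1/3, so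
        \<open>W \<le> f3 u0\<close> yields \<open>V \<le> f3 u0 / 3 < 0\<close>.\<close>
      have "((\<lambda>s. s\<^sup>2 * f3 u0) has_integral (1^3 / 3 * f3 u0 - 0^3 / 3 * f3 u0)) {0..1}"
        by (intro fundamental_theorem_of_calculus)
          (auto intro!: derivative_eq_intros simp flip: has_real_derivative_iff_has_vector_derivative)
      then have "((\<lambda>s. s\<^sup>2 * f3 u0) has_integral f3 u0 / 3) {0..1}" by simp
      then have "integral {0..1} (\<lambda>s. s\<^sup>2 * W (s * (1 + t) - 1)) \<le> f3 u0 / 3"
        by (rule has_integral_le[OF integrable_integral[OF integrable_continuous_real[OF W]]])
          (auto intro!: mult_left_mono W_le[OF *])
      then show ?thesis using \<phi>(4)[OF t] neg by (simp add: V_def W_def)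
    qed
    \<comment> \<open>In the interior \<open>(1 + t) V\<close> is the quotient
      \<open>H / (1 + t)^2\<close>, whose derivative is \<open>W - 2 V\<close>.\<close>
    have Z_deriv: "((\<lambda>t. (1 + t) * V t) has_real_derivative (2 + E t) * (f3 (mm t (\<phi> t)) - V t)) (at t)"
      if t: "t \<in> {-1<..<1}" for t
    proof -
      have H: "(H has_real_derivative (1 + t)\<^sup>2 * W t) (at t)"
        using H_deriv[of t] t by (simp add: at_within_Icc_at)
      have "((\<lambda>t. (1 + t)\<^sup>2) has_real_derivative 2 * (1 + t)) (at t)"
        by (auto intro!: derivative_eq_intros)
      from DERIV_divide[OF H this] have "((\<lambda>t. H t / (1 + t)\<^sup>2) has_real_derivative
          ((1 + t)\<^sup>2 * W t * (1 + t)\<^sup>2 - H t * (2 * (1 + t))) / ((1 + t)\<^sup>2 * (1 + t)\<^sup>2)) (at t)"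
        using t by simp
      also have "((1 + t)\<^sup>2 * W t * (1 + t)\<^sup>2 - H t * (2 * (1 + t))) / ((1 + t)\<^sup>2 * (1 + t)\<^sup>2) = W t - 2 * V t"
      proof -
        have "(y\<^sup>2 * w * y\<^sup>2 - y^3 * v * (2 * y)) / (y\<^sup>2 * y\<^sup>2) = w - 2 * v" if "y \<noteq> 0" for y v w :: real
          using that by (simp add: field_simps power2_eq_square power3_eq_cube)
        from this[of "1 + t" "W t" "V t"] show ?thesis using V_eq[of t] t by simp
      qed
      also have "W t - 2 * V t = (2 + E t) * (f3 (mm t (\<phi> t)) - V t)"
        by (simp add: W_def F2_def E_def V_def algebra_simps)
      finally show ?thesis
      proof (rule has_field_derivative_transform_within_open[of _ _ _ "{-1<..<1}"])
        show "H x / (1 + x)\<^sup>2 = (1 + x) * V x" if "x \<in> {-1<..<1}" for x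
          using V_eq[of x, symmetric] that by (simp add: power2_eq_square power3_eq_cube)
      qed (use t in auto)
    qed
    have mmP: "mm t (\<phi> t) = u0 + \<epsilon> * (P t + 2 * t)" for t by (simp add: mm_def P_def)
    show "\<exists>P V E.
    continuous_on {-1..1} V \<and> continuous_on {-1..1} E \<and> P 0 = 0 \<and>
    (\<forall>t\<in>{-1..1}.
      (P has_real_derivative E t) (at t within {-1..1}) \<and> \<bar>P t\<bar> < 1 \<and> V t < 0 \<and>
      g2 (u0 + \<epsilon> * P t) - f2 (u0 + \<epsilon> * (P t + 2 * t)) + 2 * \<epsilon> * t * V t < 0 \<and>
      E t * (g2 (u0 + \<epsilon> * P t) - f2 (u0 + \<epsilon> * (P t + 2 * t)) + 2 * \<epsilon> * t * V t) = 2 * \<epsilon> * (1 - t) * V t) \<and>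
    (\<forall>t\<in>{-1<..<1}. ((\<lambda>t. (1 + t) * V t) has_real_derivative
      (2 + E t) * (f3 (u0 + \<epsilon> * (P t + 2 * t)) - V t)) (at t))"
    proof (intro exI conjI ballI)
      show "P 0 = 0" using \<phi>(3)[of 0] by (simp add: P_def)
      fix t :: real assume t: "t \<in> {-1..1}"
      have d: "den t (\<phi> t) = g2 (u0 + \<epsilon> * P t) - f2 (u0 + \<epsilon> * (P t + 2 * t)) + 2 * \<epsilon> * t * V t"
        by (simp add: den_def pp_def mm_def P_def V_def)
      have "den t (\<phi> t) < 0" using den[OF t \<phi>(2)[OF t]] \<beta> by linarith
      then show "g2 (u0 + \<epsilon> * P t) - f2 (u0 + \<epsilon> * (P t + 2 * t)) + 2 * \<epsilon> * t * V t < 0"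
        "E t * (g2 (u0 + \<epsilon> * P t) - f2 (u0 + \<epsilon> * (P t + 2 * t)) + 2 * \<epsilon> * t * V t) = 2 * \<epsilon> * (1 - t) * V t"
        unfolding d[symmetric] by (auto simp: E_def F1_def num_def V_def)
      show "\<bar>P t\<bar> < 1" using fy(1)[OF \<phi>(2)[OF t]] by (simp add: P_def)
    qed (use V_cont E_cont P_deriv V_neg Z_deriv in \<open>auto simp: mmP\<close>)
  qed
qed

section \<open>Auxiliary calculus\<close>

text \<open>The prolonged spine may have corners where it meets the two boundaries, so derivative
  signs are available only off finitely many points.\<close>

lemma nonincreasing_off_finite:
  fixes f f' :: "real \<Rightarrow> real"
  assumes "a \<le> b" "finite N" "continuous_on {a..b} f"
    and deriv: "\<And>x. x \<in> {a<..<b} - N \<Longrightarrow> (f has_real_derivative f' x) (at x)"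
    and le: "\<And>x. x \<in> {a<..<b} - N \<Longrightarrow> f' x \<le> 0"
  shows "f b \<le> f a"
proof -
  define N' where "N' = N \<union> {a, b}"
  have in_open: "x \<in> {a<..<b} - N" if "x \<in> {a..b} - N'" for x
    using that unfolding N'_def by (cases "x = a"; cases "x = b") auto
  have "((\<lambda>x. if x \<in> N' then 0 else f' x) has_integral (f b - f a)) {a..b}"
    by (rule fundamental_theorem_of_calculus_strong[of N'])
      (use assms in_open in \<open>auto simp: N'_def has_real_derivative_iff_has_vector_derivative[symmetric]\<close>)
  moreover have "((\<lambda>x. 0) has_integral (0::real)) {a..b}" by simp
  ultimately have "f b - f a \<le> 0"
    by (rule has_integral_le) (use le in_open in force)
  then show ?thesis by simp
qed

lemma continuous_on_inv_strict_mono: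
  fixes f :: "real \<Rightarrow> real"
  assumes "strict_mono f" "surj f"
  shows "continuous_on UNIV (inv f)"
proof (rule continuous_onI_mono)
  have "range (inv f) = UNIV"
    using assms by (metis inj_imp_surj_inv strict_mono_imp_inj_on)
  then show "open (range (inv f))" by simp
  show "inv f x \<le> inv f y" if "x \<le> y" for x y
    using that assms by (metis strict_mono_less_eq surj_f_inv_f)
qed

text \<open>\<open>S\<close> is \<open>s\<close> as a function of \<open>x\<close>. Going through an antiderivative of \<open>k\<close> gives its
  differentiability also where \<open>dx\<close> vanishes.\<close>

lemma antiderivative_along_parametrization:
  fixes x dx k s :: "real \<Rightarrow> real"
  assumes ab: "a < b" and N: "finite N"
    and mono: "strict_mono_on {a..b} x"
    and cont: "continuous_on {a..b} x" "continuous_on {a..b} k" "continuous_on {a..b} s"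
    and dx: "\<And>l. l \<in> {a<..<b} - N \<Longrightarrow> (x has_real_derivative dx l) (at l)"
    and ds: "\<And>l. l \<in> {a<..<b} - N \<Longrightarrow> (s has_real_derivative k l * dx l) (at l)"
  obtains S \<kappa> where "continuous_on UNIV \<kappa>"
    "\<And>y. y \<in> {x a..x b} \<Longrightarrow> (S has_real_derivative \<kappa> y) (at y)"
    "\<And>l. l \<in> {a..b} \<Longrightarrow> S (x l) = s l" "\<And>l. l \<in> {a..b} \<Longrightarrow> \<kappa> (x l) = k l"
proof -
  have inj: "inj_on x {a..b}" using mono by (rule strict_mono_on_imp_inj_on)
  have mem: "x l \<in> {x a..x b}" if "l \<in> {a..b}" for l
    using that ab strict_mono_on_leD[OF mono] by auto
  have img: "y \<in> x ` {a..b}" if "y \<in> {x a..x b}" for y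
    using IVT'[of x a y b] that cont(1) ab by force
  define g where "g = inv_into {a..b} x"
  have g: "g (x l) = l" if "l \<in> {a..b}" for l
    using inj that by (simp add: g_def)
  have "continuous_on (x ` {a..b}) g"
    using g by (intro continuous_on_inv cont) auto
  then have g_cont: "continuous_on {x a..x b} g"
    using img by (auto elim!: continuous_on_subset)
  define cl where "cl y = max (x a) (min (x b) y)" for y
  have xab: "x a < x b" using mono ab by (auto simp: strict_mono_on_def)
  have cl: "cl y \<in> {x a..x b}" for y using xab by (auto simp: cl_def)
  have cl_id: "cl y = y" if "y \<in> {x a..x b}" for y using that by (auto simp: cl_def)
  have g_mem: "g y \<in> {a..b}" if "y \<in> {x a..x b}" for y
    using img[OF that] g by auto
  \<comment> \<open>Clamping \<open>y\<close> extends \<open>\<kappa>\<close> continuously to the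
    line. Together with a start of integration one unit before \<open>x a\<close>, this makes the
    derivative of \<open>S0\<close> two-sided at the ends \<open>x a\<close> and \<open>x b\<close>
    as well.\<close>
  define \<kappa> where "\<kappa> y = k (g (cl y))" for y
  have "continuous_on UNIV cl" unfolding cl_def by (intro continuous_intros)
  then have "continuous_on UNIV (\<lambda>y. g (cl y))"
    using cl by (intro continuous_on_compose2[OF g_cont]) auto
  then have \<kappa>_cont: "continuous_on UNIV \<kappa>"
    unfolding \<kappa>_def using cl g_mem by (intro continuous_on_compose2[OF cont(2)]) blast+
  have \<kappa>_x: "\<kappa> (x l) = k l" if "l \<in> {a..b}" for l
    using that by (simp add: \<kappa>_def cl_id[OF mem] g)
  define S0 where "S0 y = integral {x a - 1..y} \<kappa>" for y
  have S0: "(S0 has_real_derivative \<kappa> y) (at y)" if "y \<in> {x a..x b}" for y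
  proof -
    have "(S0 has_real_derivative \<kappa> y) (at y within {x a - 1..x b + 1})"
      unfolding S0_def using that \<kappa>_cont
      by (intro integral_has_real_derivative continuous_on_subset[OF \<kappa>_cont]) auto
    then show ?thesis using that by (simp add: at_within_Icc_at)
  qed
  have const: "S0 (x l) - s l = S0 (x a) - s a" if l: "l \<in> {a..b}" for l
  proof (rule has_derivative_zero_unique_strong_interval[of "N \<union> {a, b}" a b "\<lambda>l. S0 (x l) - s l"])
    have "continuous_on {x a..x b} S0"
      by (rule DERIV_continuous_on[OF has_field_derivative_at_within[OF S0]])
    from continuous_on_compose2[OF this cont(1)] show "continuous_on {a..b} (\<lambda>l. S0 (x l) - s l)"
      using mem by (intro continuous_on_diff cont) blast
    show "((\<lambda>l. S0 (x l) - s l) has_derivative (\<lambda>h. 0)) (at t within {a..b})"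
      if "t \<in> {a..b} - (N \<union> {a, b})" for t
    proof -
      from that have t: "t \<in> {a<..<b} - N" "t \<in> {a..b}" by auto
      have "((\<lambda>l. S0 (x l) - s l) has_real_derivative \<kappa> (x t) * dx t - k t * dx t) (at t)"
        by (rule DERIV_diff[OF DERIV_chain2[OF S0[OF mem[OF t(2)]] dx[OF t(1)]] ds[OF t(1)]])
      then have "((\<lambda>l. S0 (x l) - s l) has_real_derivative 0) (at t within {a..b})"
        by (simp add: \<kappa>_x[OF t(2)] has_field_derivative_at_within)
      moreover have "(*) 0 = (\<lambda>h::real. 0::real)" by auto
      ultimately show ?thesis by (simp add: has_field_derivative_def)
    qed
  qed (use N l in auto)
  show thesis
  proof (rule that[OF \<kappa>_cont])
    show "((\<lambda>y. S0 y - S0 (x a) + s a) has_real_derivative \<kappa> y) (at y)" if "y \<in> {x a..x b}" for y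
      using S0[OF that] by (auto intro!: derivative_eq_intros)
    show "S0 (x l) - S0 (x a) + s a = s l" if "l \<in> {a..b}" for l
      using const[OF that] by simp
  qed (use \<kappa>_x in auto)
qed

text \<open>Up to a factor, the left-hand function is the derivative of \<open>B\<close> across the ribs.\<close>

lemma transversal_slope_nonincreasing:
  fixes f1 f2 x k s w dx dk :: "real \<Rightarrow> real"
  assumes "a \<le> b" "finite N"
    and f1: "\<And>y. (f1 has_real_derivative f2 y) (at y)"
    and cont: "continuous_on {a..b} x" "continuous_on {a..b} k" "continuous_on {a..b} s"
    and dx: "\<And>l. l \<in> {a<..<b} - N \<Longrightarrow> (x has_real_derivative dx l) (at l)"
    and dk: "\<And>l. l \<in> {a<..<b} - N \<Longrightarrow> (k has_real_derivative dk l) (at l)"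
    and ds: "\<And>l. l \<in> {a<..<b} - N \<Longrightarrow> (s has_real_derivative k l * dx l) (at l)"
    and neg: "\<And>l. l \<in> {a<..<b} - N \<Longrightarrow> (f2 (x l) - k l) * dx l \<le> 0"
      "\<And>l. l \<in> {a<..<b} - N \<Longrightarrow> (f2 (x l) - k l) * dx l \<le> w l * dk l"
    and q: "\<And>l. l \<in> {a<..<b} - N \<Longrightarrow> 0 \<le> d + x l \<and> d + x l \<le> 2 * w l"
  shows "f1 (x b) - (d + x b) / 2 * k b - s b / 2 \<le> f1 (x a) - (d + x a) / 2 * k a - s a / 2"
proof (rule nonincreasing_off_finite[OF assms(1,2), of "\<lambda>l. f1 (x l) - (d + x l) / 2 * k l - s l / 2"
      "\<lambda>l. (f2 (x l) - k l) * dx l - (d + x l) / 2 * dk l"])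
  have "continuous_on UNIV f1" by (rule DERIV_continuous_on[OF f1])
  from continuous_on_compose2[OF this cont(1)]
  show "continuous_on {a..b} (\<lambda>l. f1 (x l) - (d + x l) / 2 * k l - s l / 2)"
    by (intro continuous_intros cont) auto
  fix l assume l: "l \<in> {a<..<b} - N"
  show "((\<lambda>l. f1 (x l) - (d + x l) / 2 * k l - s l / 2) has_real_derivative
      (f2 (x l) - k l) * dx l - (d + x l) / 2 * dk l) (at l)"
    by (rule derivative_eq_intros DERIV_chain2[OF f1] dx dk ds l refl | simp)+
      (simp add: field_simps)
  \<comment> \<open>This expression is affine in \<open>(d + x l) / 2\<close>, which ranges over
    \<open>[0, w l]\<close>; the two inequalities \<open>neg\<close> are its signs at the ends of
    that range.\<close>
  show "(f2 (x l) - k l) * dx l - (d + x l) / 2 * dk l \<le> 0"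
  proof (cases "0 \<le> dk l")
    case True
    then have "0 \<le> (d + x l) / 2 * dk l" using q[OF l] by simp
    then show ?thesis using neg(1)[OF l] by linarith
  next
    case False
    then have "w l * dk l \<le> (d + x l) / 2 * dk l" using q[OF l] by (intro mult_right_mono_neg) auto
    then show ?thesis using neg(2)[OF l] by linarith
  qed
qed

text \<open>If \<open>x\<close> lies outside one of the closed sets, the filter within that set is
  trivial, so the claim for it holds vacuously.\<close>

lemma has_derivative_within_closed_Un:
  assumes "closed A" "closed B" "x \<in> A \<union> B"
    and "x \<in> A \<Longrightarrow> (f has_derivative D) (at x within A)"
    and "x \<in> B \<Longrightarrow> (f has_derivative D) (at x within B)"
  shows "(f has_derivative D) (at x within A \<union> B)"
proof -
  have "bounded_linear D" using assms(3-5) by (auto dest: has_derivative_bounded_linear)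
  have bot: "at x within C = bot" if "x \<notin> C" "closed C" for C
    using that closed_limpt trivial_limit_within by blast
  have "(f has_derivative D) (at x within A)" "(f has_derivative D) (at x within B)"
    using assms bot \<open>bounded_linear D\<close> by (metis has_derivative_bot)+
  then show ?thesis unfolding has_derivative_within Lim_within_Un by blast
qed

text \<open>The gradient is only relative to \<open>S\<close>, since segments may run along its
  frontier. Restricted to the segment, the function has a nonincreasing derivative, hence lies below
  its tangents.\<close>

lemma concave_on_closed_segment_gradient:
  fixes f :: "'a::real_inner \<Rightarrow> real"
  assumes S: "closed_segment a b \<subseteq> S"
    and deriv: "\<And>x. x \<in> S \<Longrightarrow> (f has_derivative (\<lambda>h. g x \<bullet> h)) (at x within S)"
    and anti: "\<And>s t. 0 \<le> s \<Longrightarrow> s \<le> t \<Longrightarrow> t \<le> 1 \<Longrightarrow>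
      g (a + t *\<^sub>R (b - a)) \<bullet> (b - a) \<le> g (a + s *\<^sub>R (b - a)) \<bullet> (b - a)"
  shows "concave_on (closed_segment a b) f"
proof -
  define c where "c t = a + t *\<^sub>R (b - a)" for t :: real
  define D where "D t = g (c t) \<bullet> (b - a)" for t
  have c_mem: "c t \<in> closed_segment a b" if "t \<in> {0..1}" for t
    unfolding closed_segment_def c_def using that by (auto intro!: exI[of _ t] simp: algebra_simps)
  have seg: "\<exists>t\<in>{0..1}. x = c t" if "x \<in> closed_segment a b" for x
    using that by (force simp: closed_segment_def c_def algebra_simps)
  have \<phi>: "((\<lambda>t. f (c t)) has_real_derivative D t) (at t within {0..1})" if t: "t \<in> {0..1}" for t
  proof -
    have "(c has_derivative (\<lambda>h. h *\<^sub>R (b - a))) (at t within {0..1})"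
      unfolding c_def by (auto intro!: derivative_eq_intros)
    moreover have "(f has_derivative (\<lambda>h. g (c t) \<bullet> h)) (at (c t) within c ` {0..1})"
      by (rule has_derivative_subset[OF deriv]) (use S c_mem t in blast)+
    ultimately have "((\<lambda>t. f (c t)) has_derivative (\<lambda>h. g (c t) \<bullet> (h *\<^sub>R (b - a)))) (at t within {0..1})"
      by (rule has_derivative_in_compose)
    then show ?thesis by (simp add: has_field_derivative_def D_def mult_commute_abs)
  qed
  have D: "D t \<le> D s" if "0 \<le> s" "s \<le> t" "t \<le> 1" for s t
    using anti[OF that] by (simp add: D_def c_def)
  have mvt: "\<exists>z\<in>{s<..<t}. f (c t) - f (c s) = D z * (t - s)" if "0 \<le> s" "s < t" "t \<le> 1" for s t
    using that(1,3)
    by (intro mvt_simple[OF that(2)])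
      (auto intro!: has_field_derivative_subset[OF \<phi>] simp flip: has_field_derivative_def)
  have tangent: "- D s * (t - s) \<le> - f (c t) - - f (c s)" if st: "s \<in> {0..1}" "t \<in> {0..1}" for s t
  proof (cases s t rule: linorder_cases)
    case less
    with mvt[of s t] st obtain z where z: "z \<in> {s<..<t}" "f (c t) - f (c s) = D z * (t - s)" by auto
    then have "D z * (t - s) \<le> D s * (t - s)" using D[of s z] st less by (intro mult_right_mono) auto
    then show ?thesis using z by (simp add: algebra_simps)
  next
    case greater
    with mvt[of t s] st obtain z where z: "z \<in> {t<..<s}" "f (c s) - f (c t) = D z * (s - t)" by auto
    then have "D s * (s - t) \<le> D z * (s - t)" using D[of z s] st greater by (intro mult_right_mono) auto
    then show ?thesis using z by (simp add: algebra_simps)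
  qed auto
  have conv: "convex_on {0..1} (\<lambda>t. - f (c t))"
    by (rule pos_convex_function[of _ "\<lambda>s. - D s"]) (use tangent in auto)
  show ?thesis
    unfolding concave_on_def
  proof (rule convex_onI)
    show "convex (closed_segment a b)" by simp
    fix t x y assume t: "0 < t" "t < (1::real)" and xy: "x \<in> closed_segment a b" "y \<in> closed_segment a b"
    from seg[OF xy(1)] seg[OF xy(2)] obtain r q where rq: "r \<in> {0..1}" "q \<in> {0..1}" "x = c r" "y = c q" by auto
    have "(1 - t) *\<^sub>R x + t *\<^sub>R y = c ((1 - t) * r + t * q)"
      by (simp add: rq c_def algebra_simps)
    then show "- f ((1 - t) *\<^sub>R x + t *\<^sub>R y) \<le> (1 - t) * - f x + t * - f y"
      using convex_onD[OF conv, of t r q] t rq by simp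
  qed
qed

text \<open>Needed for the spine at its two ends, where the inverse is differentiated from one side
  only.\<close>

lemma has_field_derivative_inverse_within:
  fixes f g :: "real \<Rightarrow> real"
  assumes f: "(f has_real_derivative D) (at x within A)" and D: "D \<noteq> 0" and x: "x \<in> A"
    and gf: "\<And>z. z \<in> A \<Longrightarrow> g (f z) = z"
    and g: "continuous_on (f ` A) g"
  shows "(g has_real_derivative inverse D) (at (f x) within f ` A)"
proof -
  have "filterlim g (at x within A) (at (f x) within f ` A)"
    unfolding filterlim_at
  proof
    show "\<forall>\<^sub>F y in at (f x) within f ` A. g y \<in> A \<and> g y \<noteq> x"
      unfolding eventually_at_filter using gf x by (intro always_eventually) auto
    show "(g \<longlongrightarrow> x) (at (f x) within f ` A)"
      using g x gf[OF x] unfolding continuous_on_def by force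
  qed
  from filterlim_compose[OF f[unfolded has_field_derivative_iff] this]
  have "((\<lambda>y. inverse ((f (g y) - f x) / (g y - x))) \<longlongrightarrow> inverse D) (at (f x) within f ` A)"
    by (intro tendsto_inverse D)
  then show ?thesis
    unfolding has_field_derivative_iff
    by (rule Lim_transform_eventually) (use gf x in \<open>auto simp: eventually_at_filter intro!: always_eventually\<close>)
qed

text \<open>Covers both families of ribs: \<open>c = 1\<close> above the spine,
  \<open>c = -1\<close> below it.\<close>

lemma mem_sloped_segment:
  fixes c v \<tau> \<eta> :: real
  shows "x \<in> closed_segment (v, \<tau>) (v + c * (\<eta> - \<tau>), \<eta>) \<longleftrightarrow>
    fst x - v = c * (snd x - \<tau>) \<and> snd x \<in> closed_segment \<tau> \<eta>"
proof
  assume "x \<in> closed_segment (v, \<tau>) (v + c * (\<eta> - \<tau>), \<eta>)"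
  then show "fst x - v = c * (snd x - \<tau>) \<and> snd x \<in> closed_segment \<tau> \<eta>"
    by (auto simp: in_segment algebra_simps)
next
  assume x: "fst x - v = c * (snd x - \<tau>) \<and> snd x \<in> closed_segment \<tau> \<eta>"
  then obtain u where u: "0 \<le> u" "u \<le> 1" "snd x = (1 - u) * \<tau> + u * \<eta>" by (auto simp: in_segment)
  have "fst x = v + c * (snd x - \<tau>)" using x by linarith
  also have "\<dots> = (1 - u) * v + u * (v + c * (\<eta> - \<tau>))" unfolding u(3) by (simp add: algebra_simps)
  finally have "x = (1 - u) *\<^sub>R (v, \<tau>) + u *\<^sub>R (v + c * (\<eta> - \<tau>), \<eta>)" using u by (simp add: prod_eq_iff)
  then show "x \<in> closed_segment (v, \<tau>) (v + c * (\<eta> - \<tau>), \<eta>)" using u by (auto simp: in_segment)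
qed

lemma concave_on_cong:
  assumes "\<And>x. x \<in> S \<Longrightarrow> f x = g x"
  shows "concave_on S f \<longleftrightarrow> concave_on S g"
proof -
  have "concave_on S g" if "concave_on S f" "\<And>x. x \<in> S \<Longrightarrow> f x = g x" for f g
    unfolding concave_on_iff
  proof (intro conjI ballI allI impI)
    show S: "convex S" using that(1) by (simp add: concave_on_iff)
    fix x y and u v :: real assume *: "x \<in> S" "y \<in> S" "0 \<le> u" "0 \<le> v" "u + v = 1"
    have "u * f x + v * f y \<le> f (u *\<^sub>R x + v *\<^sub>R y)"
      using that(1) * unfolding concave_on_iff by blast
    then show "u * g x + v * g y \<le> g (u *\<^sub>R x + v *\<^sub>R y)"
      using that(2)[OF *(1)] that(2)[OF *(2)] that(2)[OF convexD[OF S *]] by simp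
  qed
  from this[of f g] this[of g f] assms show ?thesis by fastforce
qed

text \<open>\<open>a / c\<close> and \<open>b / c\<close> are the weights of the spine value and of
  the boundary value on a rib; the height \<open>c\<close> of the rib cancels.\<close>

lemma interpolation_affine:
  fixes a b c X y :: real
  assumes "a + b = c" "c \<noteq> 0"
  shows "a / c * (X - c * y) + b / c * X = X - a * y"
proof -
  have "a / c * (X - c * y) + b / c * X = (a + b) / c * X - a * y"
    using assms(2) by (simp add: field_simps)
  then show ?thesis using assms by simp
qed

text \<open>The explicit fissure function and the glued function are compared only on the region;
  every segment in the definition stays inside it.\<close>

lemma bellman_candidate_cong:
  assumes "bellman_candidate fp fm \<epsilon> S G" and eq: "\<And>x. x \<in> S \<Longrightarrow> G x = G' x"
  shows "bellman_candidate fp fm \<epsilon> S G'"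
proof -
  have lin: "linear_on_segment G a b \<longleftrightarrow> linear_on_segment G' a b" if "closed_segment a b \<subseteq> S" for a b
  proof -
    have "(1 - t) *\<^sub>R a + t *\<^sub>R b \<in> S" if "t \<in> {0..1}" for t
      using that \<open>closed_segment a b \<subseteq> S\<close> by (auto simp: closed_segment_def)
    moreover have "a \<in> S" "b \<in> S" using that by auto
    ultimately show ?thesis by (simp add: linear_on_segment_def eq)
  qed
  have conc: "concave_on (closed_segment a b) G \<longleftrightarrow> concave_on (closed_segment a b) G'"
    if "closed_segment a b \<subseteq> S" for a b
    by (rule concave_on_cong) (use eq that in auto)
  note G = assms(1)[unfolded bellman_candidate_def diagonally_concave_on_def]
  note G1 = G[THEN conjunct1, rule_format] and G2 = G[THEN conjunct2, THEN conjunct1, rule_format]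
    and G3 = G[THEN conjunct2, THEN conjunct2, THEN conjunct1, rule_format]
    and G4 = G[THEN conjunct2, THEN conjunct2, THEN conjunct2, THEN bspec]
  show ?thesis
    unfolding bellman_candidate_def diagonally_concave_on_def
  proof (intro conjI allI impI ballI)
    fix a b assume ab: "same_diagonal a b \<and> closed_segment a b \<subseteq> S"
    then show "concave_on (closed_segment a b) G'" using G1[OF ab] conc[of a b] by simp
  next
    fix y assume y: "(y, \<epsilon>) \<in> S"
    then show "G' (y, \<epsilon>) = fp y" using G2[OF y] eq[OF y] by simp
  next
    fix y assume y: "(y, -\<epsilon>) \<in> S"
    then show "G' (y, -\<epsilon>) = fm y" using G3[OF y] eq[OF y] by simp
  next
    fix y assume "y \<in> S"
    from G4[OF this] show "(\<exists>z\<in>strip_boundary \<epsilon>. same_diagonal y z \<and> closed_segment y z \<subseteq> S \<and> linear_on_segment G' y z) \<or>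
      (\<exists>U. open U \<and> y \<in> U \<and>
        (\<forall>a b. same_diagonal a b \<and> closed_segment a b \<subseteq> U \<inter> S \<longrightarrow> linear_on_segment G' a b))"
    proof (elim disjE bexE exE conjE)
      fix z assume z: "z \<in> strip_boundary \<epsilon>" "same_diagonal y z" "closed_segment y z \<subseteq> S" "linear_on_segment G y z"
      then have "linear_on_segment G' y z" using lin[OF z(3)] by simp
      then show ?thesis using z by blast
    next
      fix U assume U: "open U" "y \<in> U"
        "\<forall>a b. same_diagonal a b \<and> closed_segment a b \<subseteq> U \<inter> S \<longrightarrow> linear_on_segment G a b"
      have "linear_on_segment G' a b" if ab: "same_diagonal a b \<and> closed_segment a b \<subseteq> U \<inter> S" for a b
        using U(3)[rule_format, OF ab] lin[of a b] ab by simp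
      then show ?thesis using U(1,2) by blast
    qed
  qed
qed

section \<open>The candidate over a spine\<close>

text \<open>A spine parametrized by its height \<open>t = T\<close> instead of its abscissa
  \<open>u = p t + t - \<epsilon>\<close>; the ribs end at \<open>p t\<close> above and at
  \<open>p t + 2 t\<close> below. The assumptions \<open>outer_left\<close> and
  \<open>outer_right\<close> are the signs \<open>fp2_le\<close> and \<open>fm2_le\<close> continued
  to full-width chords beyond both ends of the spine, with the denominator of the chord slope
  cleared.\<close>

locale fissure =
  fixes fp fp1 fp2 fm fm1 fm2 :: "real \<Rightarrow> real" and \<epsilon> \<delta> :: real and p dp k dk :: "real \<Rightarrow> real"
  assumes e: "0 < \<epsilon>" and d: "0 < \<delta>"
    and fp: "\<And>x. (fp has_real_derivative fp1 x) (at x)"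
    and fp1: "\<And>x. (fp1 has_real_derivative fp2 x) (at x)"
    and fm: "\<And>x. (fm has_real_derivative fm1 x) (at x)"
    and fm1: "\<And>x. (fm1 has_real_derivative fm2 x) (at x)"
    and p_der: "\<And>t. t \<in> {-\<epsilon>..\<epsilon>} \<Longrightarrow> (p has_real_derivative dp t) (at t within {-\<epsilon>..\<epsilon>})"
    and dp_cont: "continuous_on {-\<epsilon>..\<epsilon>} dp"
    and dp_nonneg: "\<And>t. t \<in> {-\<epsilon>..\<epsilon>} \<Longrightarrow> 0 \<le> dp t"
    and dp_pos: "\<And>t. t \<in> {-\<epsilon>..<\<epsilon>} \<Longrightarrow> 0 < dp t"
    and k_cont: "continuous_on {-\<epsilon>..\<epsilon>} k"
    and k_der: "\<And>t. t \<in> {-\<epsilon><..<\<epsilon>} \<Longrightarrow> (k has_real_derivative dk t) (at t)"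
    and ode_p: "\<And>t. t \<in> {-\<epsilon><..<\<epsilon>} \<Longrightarrow> (\<epsilon> - t) * dk t = (fp2 (p t) - k t) * dp t"
    and ode_m: "\<And>t. t \<in> {-\<epsilon><..<\<epsilon>} \<Longrightarrow> (\<epsilon> + t) * dk t = (fm2 (p t + 2 * t) - k t) * (dp t + 2)"
    and chord: "\<And>t. t \<in> {-\<epsilon>..\<epsilon>} \<Longrightarrow> 2 * t * k t = fm1 (p t + 2 * t) - fp1 (p t)"
    and fp2_le: "\<And>t. t \<in> {-\<epsilon>..\<epsilon>} \<Longrightarrow> fp2 (p t) \<le> k t"
    and fm2_le: "\<And>t. t \<in> {-\<epsilon>..\<epsilon>} \<Longrightarrow> fm2 (p t + 2 * t) \<le> k t"
    and outer_left: "\<And>x. x \<in> {p (-\<epsilon>) - \<delta>..p (-\<epsilon>)} \<Longrightarrow>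
      2 * \<epsilon> * fp2 x \<le> fp1 x - fm1 (x - 2 * \<epsilon>) \<and> 2 * \<epsilon> * fm2 (x - 2 * \<epsilon>) \<le> fp1 x - fm1 (x - 2 * \<epsilon>)"
    and outer_right: "\<And>y. y \<in> {p \<epsilon> + 2 * \<epsilon>..p \<epsilon> + 2 * \<epsilon> + \<delta>} \<Longrightarrow>
      2 * \<epsilon> * fp2 (y - 2 * \<epsilon>) \<le> fm1 y - fp1 (y - 2 * \<epsilon>) \<and> 2 * \<epsilon> * fm2 y \<le> fm1 y - fp1 (y - 2 * \<epsilon>)"
begin

text \<open>The spine is prolonged along the bottom boundary to the left (\<open>T = -\<epsilon>\<close>) and along the top
  boundary to the right (\<open>T = \<epsilon>\<close>): with this convention the tangent functions are given by the
  formulas for the ribs, so that \<open>B\<close> consists of two pieces only.\<close>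

definition T :: "real \<Rightarrow> real" where "T l = max (-\<epsilon>) (min \<epsilon> l)"
definition P :: "real \<Rightarrow> real" where "P l = p (T l) + (l - T l)"
definition M :: "real \<Rightarrow> real" where "M l = P l + 2 * T l"
text \<open>Beyond the spine the chord relation itself serves as the definition; by
  \<open>chord\<close> the two branches match at the ends.\<close>

definition K :: "real \<Rightarrow> real" where
  "K l = (if \<bar>l\<bar> \<le> \<epsilon> then k l else (fm1 (M l) - fp1 (P l)) / (2 * T l))"
definition dT :: "real \<Rightarrow> real" where "dT l = (if \<bar>l\<bar> < \<epsilon> then 1 else 0)"
definition dP :: "real \<Rightarrow> real" where "dP l = (if \<bar>l\<bar> < \<epsilon> then dp l else 1)"
definition dM :: "real \<Rightarrow> real" where "dM l = dP l + 2 * dT l"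
definition dK :: "real \<Rightarrow> real" where
  "dK l = (if \<bar>l\<bar> < \<epsilon> then dk l else (fm2 (M l) - fp2 (P l)) / (2 * T l))"
text \<open>The x1-derivative of \<open>B\<close> on the spine as seen from the upper ribs; the
  chord relation makes it equal to the value seen from the lower ribs.\<close>

definition h :: "real \<Rightarrow> real" where "h l = fp1 (P l) - (\<epsilon> - T l) * K l"
text \<open>\<open>s\<close> and \<open>r\<close> are the derivatives of \<open>B\<close> along
  \<open>(1,1)\<close> on the upper ribs and along \<open>(1,-1)\<close> on the lower ribs. They
  solve the linear system \<open>s + r = 2 h\<close>,
  \<open>(\<epsilon> - T) s - (\<epsilon> + T) r = fp - fm\<close>, that is, agreement of gradient
  and value on the spine. At \<open>T = -\<epsilon>\<close> the term with \<open>h\<close> drops out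
  of \<open>s\<close>, at \<open>T = \<epsilon>\<close> out of \<open>r\<close>, and the slope of a
  chord across the strip is left.\<close>

definition s :: "real \<Rightarrow> real" where
  "s l = (fp (P l) - fm (M l)) / (2 * \<epsilon>) + (\<epsilon> + T l) * h l / \<epsilon>"
definition r :: "real \<Rightarrow> real" where
  "r l = (fm (M l) - fp (P l)) / (2 * \<epsilon>) + (\<epsilon> - T l) * h l / \<epsilon>"

section \<open>Regularity of the prolonged spine\<close>

lemma T_bounds: "-\<epsilon> \<le> T l" "T l \<le> \<epsilon>" "T l \<in> {-\<epsilon>..\<epsilon>}"
  using e by (auto simp: T_def)

lemma T_inner: "\<bar>l\<bar> \<le> \<epsilon> \<Longrightarrow> T l = l" and T_left: "l \<le> -\<epsilon> \<Longrightarrow> T l = -\<epsilon>" and T_right: "\<epsilon> \<le> l \<Longrightarrow> T l = \<epsilon>"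
  using e by (auto simp: T_def)

lemma T_cont: "continuous_on S T"
  unfolding T_def by (intro continuous_intros)

lemma T_mono: "l \<le> l' \<Longrightarrow> T l \<le> T l'" "l \<le> l' \<Longrightarrow> l - T l \<le> l' - T l'"
  by (auto simp: T_def max_def min_def)

lemma p_cont: "continuous_on {-\<epsilon>..\<epsilon>} p"
  by (rule DERIV_continuous_on[OF p_der])

lemma p_der_at: "\<bar>t\<bar> < \<epsilon> \<Longrightarrow> (p has_real_derivative dp t) (at t)"
  using p_der[of t] at_within_Icc_at[of "-\<epsilon>" t \<epsilon>] by (auto simp: abs_less_iff)

lemma p_strict_mono:
  assumes t: "-\<epsilon> \<le> t" "t < t'" "t' \<le> \<epsilon>"
  shows "p t < p t'"
proof (rule DERIV_pos_imp_increasing_open[OF t(2)])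
  show "\<exists>y. (p has_real_derivative y) (at x) \<and> 0 < y" if "t < x" "x < t'" for x
    using p_der_at[of x] dp_pos[of x] t that by (auto simp: abs_less_iff)
  show "continuous_on {t..t'} p"
    using t by (intro continuous_on_subset[OF p_cont]) auto
qed

lemma P_cont: "continuous_on S P"
  unfolding P_def using T_bounds by (intro continuous_intros T_cont continuous_on_compose2[OF p_cont]) auto

lemma M_cont: "continuous_on S M"
  unfolding M_def by (intro continuous_intros P_cont T_cont)

lemma P_strict_mono: "strict_mono P"
proof (rule strict_monoI)
  fix l l' :: real assume l: "l < l'"
  show "P l < P l'"
  proof (cases "T l = T l'")
    case True
    then show ?thesis using l by (simp add: P_def)
  next
    case False
    then have "p (T l) < p (T l')"
      using T_mono(1)[of l l'] l T_bounds by (intro p_strict_mono) auto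
    then show ?thesis using T_mono(2)[of l l'] l by (simp add: P_def)
  qed
qed

lemma M_strict_mono: "strict_mono M"
  using strict_monoD[OF P_strict_mono] T_mono(1)
  by (intro strict_monoI) (force simp: M_def intro: add_less_le_mono)

lemma surj_if_outer_translation:
  assumes "continuous_on UNIV f" "\<And>l. \<epsilon> \<le> l \<Longrightarrow> f l = l + a" "\<And>l. l \<le> -\<epsilon> \<Longrightarrow> f l = l + b"
  shows "surj f"
  unfolding surj_def
proof
  fix y
  define u where "u = max \<epsilon> (y - a)"
  define v where "v = min (-\<epsilon>) (y - b)"
  have "f v \<le> y" "y \<le> f u" "v \<le> u" using assms(2)[of u] assms(3)[of v] e by (auto simp: u_def v_def)
  then show "\<exists>l. y = f l"
    using IVT'[of f v y u] continuous_on_subset[OF assms(1), of "{v..u}"] by auto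
qed

lemma P_outer: "\<epsilon> \<le> l \<Longrightarrow> P l = l + (p \<epsilon> - \<epsilon>)" "l \<le> -\<epsilon> \<Longrightarrow> P l = l + (p (-\<epsilon>) + \<epsilon>)"
  by (simp_all add: P_def T_left T_right)

lemma M_outer: "\<epsilon> \<le> l \<Longrightarrow> M l = l + (p \<epsilon> + \<epsilon>)" "l \<le> -\<epsilon> \<Longrightarrow> M l = l + (p (-\<epsilon>) - \<epsilon>)"
  by (simp_all add: M_def P_outer T_left T_right)

lemma P_surj: "surj P" and M_surj: "surj M"
  using surj_if_outer_translation[OF P_cont P_outer] surj_if_outer_translation[OF M_cont M_outer] by auto

lemma inner_or_outer:
  assumes "l \<notin> {-\<epsilon>, \<epsilon>}"
  obtains "\<bar>l\<bar> < \<epsilon>" "T l = l" | "l < -\<epsilon>" "T l = -\<epsilon>" | "\<epsilon> < l" "T l = \<epsilon>"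
  using assms T_inner[of l] T_left[of l] T_right[of l] by fastforce

lemma has_real_derivative_cong_open:
  "open S \<Longrightarrow> l \<in> S \<Longrightarrow> (\<And>x. x \<in> S \<Longrightarrow> f x = g x) \<Longrightarrow> (g has_real_derivative D) (at l) \<Longrightarrow>
    (f has_real_derivative D) (at l)"
  by (metis has_field_derivative_transform_within_open)

lemma T_der: "l \<notin> {-\<epsilon>, \<epsilon>} \<Longrightarrow> (T has_real_derivative dT l) (at l)"
proof (erule inner_or_outer)
  assume "\<bar>l\<bar> < \<epsilon>"
  then show ?thesis
    by (intro has_real_derivative_cong_open[of "{-\<epsilon><..<\<epsilon>}" l T "\<lambda>x. x"]) (auto simp: T_inner dT_def)
next
  assume "l < -\<epsilon>"
  then show ?thesis using e
    by (intro has_real_derivative_cong_open[of "{..<-\<epsilon>}" l T "\<lambda>x. -\<epsilon>"]) (auto simp: T_left dT_def)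
next
  assume "\<epsilon> < l"
  then show ?thesis
    by (intro has_real_derivative_cong_open[of "{\<epsilon><..}" l T "\<lambda>x. \<epsilon>"]) (auto simp: T_right dT_def)
qed

lemma P_der: "l \<notin> {-\<epsilon>, \<epsilon>} \<Longrightarrow> (P has_real_derivative dP l) (at l)"
proof (erule inner_or_outer)
  assume "\<bar>l\<bar> < \<epsilon>"
  then show ?thesis using p_der_at
    by (intro has_real_derivative_cong_open[of "{-\<epsilon><..<\<epsilon>}" l P p]) (auto simp: P_def T_inner dP_def)
next
  assume "l < -\<epsilon>"
  then show ?thesis using e
    by (intro has_real_derivative_cong_open[of "{..<-\<epsilon>}" l P "\<lambda>x. x + (p (-\<epsilon>) + \<epsilon>)"])
      (auto simp: P_outer dP_def intro!: derivative_eq_intros)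
next
  assume "\<epsilon> < l"
  then show ?thesis
    by (intro has_real_derivative_cong_open[of "{\<epsilon><..}" l P "\<lambda>x. x + (p \<epsilon> - \<epsilon>)"])
      (auto simp: P_outer dP_def intro!: derivative_eq_intros)
qed

lemma M_der: "l \<notin> {-\<epsilon>, \<epsilon>} \<Longrightarrow> (M has_real_derivative dM l) (at l)"
  unfolding M_def[abs_def] dM_def using P_der T_der by (auto intro!: derivative_eq_intros)

lemma K_der: "l \<notin> {-\<epsilon>, \<epsilon>} \<Longrightarrow> (K has_real_derivative dK l) (at l)"
proof -
  assume l: "l \<notin> {-\<epsilon>, \<epsilon>}"
  have quot: "((\<lambda>x. (fm1 (M x) - fp1 (P x)) / (2 * c)) has_real_derivative (fm2 (M l) * dM l - fp2 (P l) * dP l) / (2 * c)) (at l)"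
    for c
    by (intro DERIV_cdivide derivative_intros DERIV_chain2[OF fm1 M_der] DERIV_chain2[OF fp1 P_der] l)
  from l show ?thesis
  proof (rule inner_or_outer)
    assume "\<bar>l\<bar> < \<epsilon>"
    then have "l \<in> {-\<epsilon><..<\<epsilon>}" by auto
    with k_der[OF this] show ?thesis
      by (intro has_real_derivative_cong_open[of "{-\<epsilon><..<\<epsilon>}" l K k]) (auto simp: K_def dK_def)
  next
    assume "l < -\<epsilon>"
    then show ?thesis using e quot[of "-\<epsilon>"]
      by (intro has_real_derivative_cong_open[of "{..<-\<epsilon>}" l K "\<lambda>x. (fm1 (M x) - fp1 (P x)) / (2 * -\<epsilon>)"])
        (auto simp: K_def dK_def dP_def dM_def dT_def T_left)
  next
    assume "\<epsilon> < l"
    then show ?thesis using e quot[of "\<epsilon>"]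
      by (intro has_real_derivative_cong_open[of "{\<epsilon><..}" l K "\<lambda>x. (fm1 (M x) - fp1 (P x)) / (2 * \<epsilon>)"])
        (auto simp: K_def dK_def dP_def dM_def dT_def T_right)
  qed
qed

lemma chord_ext: "2 * T l * K l = fm1 (M l) - fp1 (P l)"
proof (cases "\<bar>l\<bar> \<le> \<epsilon>")
  case True
  then show ?thesis using chord[of l] by (simp add: K_def M_def P_def T_inner abs_le_iff)
next
  case False
  then have "T l \<noteq> 0" using e by (auto simp: T_def)
  then show ?thesis using False by (simp add: K_def)
qed

lemma fun_cont: "continuous_on S fp" "continuous_on S fm" "continuous_on S fp1" "continuous_on S fm1"
  by (rule DERIV_continuous_on[OF has_field_derivative_at_within], rule fp fm fp1 fm1)+

lemma comp_cont: "continuous_on S (\<lambda>l. fp (P l))" "continuous_on S (\<lambda>l. fm (M l))"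
  "continuous_on S (\<lambda>l. fp1 (P l))" "continuous_on S (\<lambda>l. fm1 (M l))"
  by (rule continuous_on_compose2[OF fun_cont(1)[of UNIV] P_cont] continuous_on_compose2[OF fun_cont(2)[of UNIV] M_cont]
      continuous_on_compose2[OF fun_cont(3)[of UNIV] P_cont] continuous_on_compose2[OF fun_cont(4)[of UNIV] M_cont], simp)+

lemma K_cont: "continuous_on S K"
proof -
  have out: "continuous_on A K" if "A \<subseteq> {..-\<epsilon>} \<union> {\<epsilon>..}" for A
  proof -
    have T0: "T l \<noteq> 0" if "l \<in> A" for l
      using that \<open>A \<subseteq> _\<close> e by (auto simp: T_def)
    have "continuous_on A (\<lambda>l. (fm1 (M l) - fp1 (P l)) / (2 * T l))"
      by (intro continuous_intros comp_cont T_cont) (use T0 in auto)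
    moreover have "K l = (fm1 (M l) - fp1 (P l)) / (2 * T l)" if "l \<in> A" for l
      using chord_ext[of l] T0[OF that] by (simp add: field_simps)
    ultimately show ?thesis by (simp cong: continuous_on_cong)
  qed
  have mid: "continuous_on {-\<epsilon>..\<epsilon>} K"
    using k_cont by (rule continuous_on_eq) (auto simp: K_def)
  have "continuous_on ({-\<epsilon>..\<epsilon>} \<union> ({..-\<epsilon>} \<union> {\<epsilon>..})) K"
    by (rule continuous_on_closed_Un[OF _ _ mid out]) auto
  moreover have "x \<in> {-\<epsilon>..\<epsilon>} \<union> ({..-\<epsilon>} \<union> {\<epsilon>..})" for x
    by (cases "x \<le> -\<epsilon>"; cases "\<epsilon> \<le> x") auto
  ultimately show ?thesis by (meson continuous_on_subset subsetI)
qed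

lemma inner_simps:
  assumes "\<bar>l\<bar> < \<epsilon>"
  shows "T l = l" "P l = p l" "M l = p l + 2 * l" "K l = k l" "dT l = 1" "dP l = dp l" "dK l = dk l"
    "dM l = dp l + 2" "l \<in> {-\<epsilon><..<\<epsilon>}" "l \<in> {-\<epsilon>..\<epsilon>}"
  using assms by (auto simp: T_inner P_def M_def K_def dT_def dP_def dK_def dM_def)

section \<open>Slopes of the candidate along and across the ribs\<close>

lemma h_alt: "h l = fm1 (M l) - (\<epsilon> + T l) * K l"
  using chord_ext[of l] by (simp add: h_def algebra_simps)

lemma s_r_h: "s l + r l = 2 * h l"
proof -
  have "(X - Y) / (2 * \<epsilon>) + (\<epsilon> + t) * w / \<epsilon> + ((Y - X) / (2 * \<epsilon>) + (\<epsilon> - t) * w / \<epsilon>) = 2 * w" for X Y t w :: real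
    using e by (simp add: field_simps)
  then show ?thesis by (simp only: s_def r_def)
qed

lemma spine_value_eq: "fp (P l) - (\<epsilon> - T l) * s l = fm (M l) - (\<epsilon> + T l) * r l"
proof -
  have "X - (\<epsilon> - t) * ((X - Y) / (2 * \<epsilon>) + (\<epsilon> + t) * w / \<epsilon>) =
      Y - (\<epsilon> + t) * ((Y - X) / (2 * \<epsilon>) + (\<epsilon> - t) * w / \<epsilon>)" for X Y t w :: real
    using e by (simp add: field_simps)
  then show ?thesis by (simp only: s_def r_def)
qed

lemma h_cont: "continuous_on S h" unfolding h_def by (intro continuous_intros comp_cont K_cont T_cont)
lemma s_cont: "continuous_on S s" unfolding s_def by (intro continuous_intros comp_cont h_cont T_cont) (use e in auto)
lemma r_cont: "continuous_on S r" unfolding r_def by (intro continuous_intros comp_cont h_cont T_cont) (use e in auto)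

text \<open>Inside, \<open>ode_p\<close> gives \<open>h' = K (1 + dP)\<close>, and substituting
  \<open>h\<close> for \<open>fp1\<close> and \<open>fm1\<close> leaves only multiples of
  \<open>K\<close>. On the prolongations \<open>h\<close> enters \<open>s\<close> only with the
  factor \<open>\<epsilon> + T\<close> and \<open>r\<close> only with \<open>\<epsilon> - T\<close>,
  so it disappears on the left for \<open>s\<close> and on the right for \<open>r\<close>. The side
  conditions exclude the opposite prolongation, where the ribs of that family degenerate to boundary
  points.\<close>

lemma s_r_der:
  assumes l: "l \<notin> {-\<epsilon>, \<epsilon>}"
  shows "l < \<epsilon> \<Longrightarrow> (s has_real_derivative K l * dP l) (at l)"
    and "-\<epsilon> < l \<Longrightarrow> (r has_real_derivative K l * dM l) (at l)"
proof -
  define dh where "dh = fp2 (P l) * dP l - ((0 - dT l) * K l + dK l * (\<epsilon> - T l))"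
  have h': "(h has_real_derivative dh) (at l)"
    unfolding h_def[abs_def] dh_def
    by (rule DERIV_diff[OF DERIV_chain2[OF fp1 P_der[OF l]] DERIV_mult[OF DERIV_diff[OF DERIV_const T_der[OF l]] K_der[OF l]]])
  have s': "(s has_real_derivative (fp1 (P l) * dP l - fm1 (M l) * dM l) / (2 * \<epsilon>) + ((0 + dT l) * h l + dh * (\<epsilon> + T l)) / \<epsilon>) (at l)"
    unfolding s_def[abs_def]
    by (intro DERIV_add DERIV_cdivide DERIV_diff DERIV_mult DERIV_chain2[OF fp P_der[OF l]] DERIV_chain2[OF fm M_der[OF l]]
        DERIV_const T_der[OF l] h')
  have r': "(r has_real_derivative (fm1 (M l) * dM l - fp1 (P l) * dP l) / (2 * \<epsilon>) + ((0 - dT l) * h l + dh * (\<epsilon> - T l)) / \<epsilon>) (at l)"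
    unfolding r_def[abs_def]
    by (intro DERIV_add DERIV_cdivide DERIV_diff DERIV_mult DERIV_chain2[OF fp P_der[OF l]] DERIV_chain2[OF fm M_der[OF l]]
        DERIV_const T_der[OF l] h')
  have fp1_eq: "fp1 (P l) = h l + (\<epsilon> - T l) * K l" and fm1_eq: "fm1 (M l) = h l + (\<epsilon> + T l) * K l"
    by (simp_all add: h_def) (use h_alt[of l] in \<open>simp add: h_def\<close>)
  have inner: "dh = K l * (1 + dP l)" if "\<bar>l\<bar> < \<epsilon>"
    using ode_p[OF inner_simps(9)[OF that]] by (simp add: dh_def inner_simps[OF that] algebra_simps)
  show "(s has_real_derivative K l * dP l) (at l)" if "l < \<epsilon>"
  proof (rule DERIV_cong[OF s'])
    from l show "(fp1 (P l) * dP l - fm1 (M l) * dM l) / (2 * \<epsilon>) + ((0 + dT l) * h l + dh * (\<epsilon> + T l)) / \<epsilon> = K l * dP l"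
    proof (rule inner_or_outer)
      assume inn: "\<bar>l\<bar> < \<epsilon>"
      then show ?thesis using e unfolding inner[OF inn] fp1_eq fm1_eq
        by (simp add: dM_def dT_def field_simps)
    qed (use that e in \<open>auto simp: fp1_eq fm1_eq dM_def dT_def dP_def field_simps\<close>)
  qed
  show "(r has_real_derivative K l * dM l) (at l)" if "-\<epsilon> < l"
  proof (rule DERIV_cong[OF r'])
    from l show "(fm1 (M l) * dM l - fp1 (P l) * dP l) / (2 * \<epsilon>) + ((0 - dT l) * h l + dh * (\<epsilon> - T l)) / \<epsilon> = K l * dM l"
    proof (rule inner_or_outer)
      assume inn: "\<bar>l\<bar> < \<epsilon>"
      then show ?thesis using e unfolding inner[OF inn] fp1_eq fm1_eq
        by (simp add: dM_def dT_def field_simps)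
    qed (use that e in \<open>auto simp: fp1_eq fm1_eq dM_def dT_def dP_def field_simps\<close>)
  qed
qed

text \<open>Inside, the two sides of the second inequality are equal by \<open>ode_p\<close>. On the
  left prolongation \<open>(\<epsilon> - T) dK\<close> is \<open>fp2 - fm2\<close>, so the claims
  become \<open>fp2 \<le> K\<close> and \<open>fm2 \<le> K\<close>, which is
  \<open>outer_left\<close>.\<close>

lemma upper_sign:
  assumes "l \<in> {-\<epsilon>-\<delta><..<\<epsilon>} - {-\<epsilon>, \<epsilon>}"
  shows "(fp2 (P l) - K l) * dP l \<le> 0" "(fp2 (P l) - K l) * dP l \<le> (\<epsilon> - T l) * dK l"
proof -
  have "(fp2 (P l) - K l) * dP l \<le> 0 \<and> (fp2 (P l) - K l) * dP l \<le> (\<epsilon> - T l) * dK l"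
  proof (cases "\<bar>l\<bar> < \<epsilon>")
    case True
    then show ?thesis
      using ode_p[of l] fp2_le[of l] dp_nonneg[of l] inner_simps[OF True]
      by (simp add: mult_nonpos_nonneg)
  next
    case False
    then have l: "l < -\<epsilon>" using assms by auto
    then have T: "T l = -\<epsilon>" by (simp add: T_left)
    have M: "M l = P l - 2 * \<epsilon>" by (simp add: M_def T)
    have K: "2 * \<epsilon> * K l = fp1 (P l) - fm1 (P l - 2 * \<epsilon>)" using chord_ext[of l] by (simp add: T M)
    have "P l \<in> {p (-\<epsilon>) - \<delta>..p (-\<epsilon>)}" using l assms by (simp add: P_outer)
    from outer_left[OF this, folded K] have "fp2 (P l) \<le> K l" "fm2 (P l - 2 * \<epsilon>) \<le> K l"
      using e by (auto simp: mult_le_cancel_left_pos)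
    then show ?thesis using l e by (simp add: dP_def dK_def T M field_simps)
  qed
  then show "(fp2 (P l) - K l) * dP l \<le> 0" "(fp2 (P l) - K l) * dP l \<le> (\<epsilon> - T l) * dK l" by auto
qed

lemma lower_sign:
  assumes "l \<in> {-\<epsilon><..<\<epsilon>+\<delta>} - {-\<epsilon>, \<epsilon>}"
  shows "(fm2 (M l) - K l) * dM l \<le> 0" "(fm2 (M l) - K l) * dM l \<le> (\<epsilon> + T l) * dK l"
proof -
  have "(fm2 (M l) - K l) * dM l \<le> 0 \<and> (fm2 (M l) - K l) * dM l \<le> (\<epsilon> + T l) * dK l"
  proof (cases "\<bar>l\<bar> < \<epsilon>")
    case True
    then show ?thesis
      using ode_m[of l] fm2_le[of l] dp_nonneg[of l] inner_simps[OF True]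
      by (simp add: mult_nonpos_nonneg)
  next
    case False
    then have l: "\<epsilon> < l" using assms by auto
    then have T: "T l = \<epsilon>" by (simp add: T_right)
    have P: "P l = M l - 2 * \<epsilon>" by (simp add: M_def T)
    have K: "2 * \<epsilon> * K l = fm1 (M l) - fp1 (M l - 2 * \<epsilon>)" using chord_ext[of l] by (simp add: T P)
    have "M l \<in> {p \<epsilon> + 2 * \<epsilon>..p \<epsilon> + 2 * \<epsilon> + \<delta>}" using l assms by (simp add: M_outer)
    from outer_right[OF this, folded K] have "fp2 (M l - 2 * \<epsilon>) \<le> K l" "fm2 (M l) \<le> K l"
      using e by (auto simp: mult_le_cancel_left_pos)
    then show ?thesis using l e by (simp add: dM_def dT_def dP_def dK_def T P field_simps)
  qed
  then show "(fm2 (M l) - K l) * dM l \<le> 0" "(fm2 (M l) - K l) * dM l \<le> (\<epsilon> + T l) * dK l" by auto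
qed

text \<open>Twice these are the derivatives of \<open>B\<close> along \<open>(1,-1)\<close> over the upper ribs and along \<open>(1,1)\<close>
  over the lower ones, on the line with the other characteristic coordinate equal to \<open>c\<close>.\<close>

definition GU :: "real \<Rightarrow> real \<Rightarrow> real" where
  "GU c l = fp1 (P l) - ((2 * \<epsilon> - c) + P l) / 2 * K l - s l / 2"
definition GL :: "real \<Rightarrow> real \<Rightarrow> real" where
  "GL c l = fm1 (M l) - ((2 * \<epsilon> - c) + M l) / 2 * K l - r l / 2"

text \<open>The bounds on \<open>c\<close> say that the diagonal \<open>m = c\<close> meets every
  rib with parameter in \<open>[a, b]\<close> at a height between \<open>T\<close> and \<epsilon>;
  this is the range required of the affine weight.\<close>

lemma GU_mono:
  assumes "a \<le> b" "-\<epsilon>-\<delta> \<le> a" "b \<le> \<epsilon>" "M b \<le> c" "c \<le> P a + 2 * \<epsilon>"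
  shows "GU c b \<le> GU c a"
  unfolding GU_def
proof (rule transversal_slope_nonincreasing[OF \<open>a \<le> b\<close>, of "{-\<epsilon>, \<epsilon>}" fp1 fp2 P K s dP dK "\<lambda>l. \<epsilon> - T l"])
  fix l assume l: "l \<in> {a<..<b} - {-\<epsilon>, \<epsilon>}"
  then have "M l \<le> M b" "P a \<le> P l"
    using strict_mono_less_eq[OF M_strict_mono] strict_mono_less_eq[OF P_strict_mono] by auto
  then show "0 \<le> (2 * \<epsilon> - c) + P l \<and> (2 * \<epsilon> - c) + P l \<le> 2 * (\<epsilon> - T l)"
    using assms by (simp add: M_def)
qed (use assms upper_sign s_r_der(1) in \<open>auto intro!: P_cont K_cont s_cont fp1 P_der K_der\<close>)

lemma GL_mono:
  assumes "a \<le> b" "-\<epsilon> \<le> a" "b \<le> \<epsilon>+\<delta>" "P b \<le> c" "c \<le> M a + 2 * \<epsilon>"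
  shows "GL c b \<le> GL c a"
  unfolding GL_def
proof (rule transversal_slope_nonincreasing[OF \<open>a \<le> b\<close>, of "{-\<epsilon>, \<epsilon>}" fm1 fm2 M K r dM dK "\<lambda>l. \<epsilon> + T l"])
  fix l assume l: "l \<in> {a<..<b} - {-\<epsilon>, \<epsilon>}"
  then have "M a \<le> M l" "P l \<le> P b"
    using strict_mono_less_eq[OF M_strict_mono] strict_mono_less_eq[OF P_strict_mono] by auto
  then show "0 \<le> (2 * \<epsilon> - c) + M l \<and> (2 * \<epsilon> - c) + M l \<le> 2 * (\<epsilon> + T l)"
    using assms by (simp add: M_def)
qed (use assms lower_sign s_r_der(2) in \<open>auto intro!: M_cont K_cont r_cont fm1 M_der K_der\<close>)

text \<open>At the spine the derivative across the upper ribs becomes the slope of the lower rib, so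
  monotonicity can be continued through the spine.\<close>

lemma GU_spine: "2 * GU (M l) l = r l"
  using s_r_h[of l] by (simp add: GU_def M_def h_def field_simps)

lemma GL_spine: "2 * GL (P l) l = s l"
  using s_r_h[of l] by (simp add: GL_def M_def h_alt field_simps)

end

text \<open>Here the slopes become functions of the rib ends instead of the parameter
  \<open>l\<close>. A separate locale, because these functions come from an existence
  statement.\<close>

locale fissure_surface = fissure +
  fixes S \<kappa> R \<rho> :: "real \<Rightarrow> real"
  assumes \<kappa>_cont: "continuous_on UNIV \<kappa>" and \<rho>_cont: "continuous_on UNIV \<rho>"
    and S_der: "\<And>y. y \<in> {P (-\<epsilon>-\<delta>)..P \<epsilon>} \<Longrightarrow> (S has_real_derivative \<kappa> y) (at y)"
    and R_der: "\<And>y. y \<in> {M (-\<epsilon>)..M (\<epsilon>+\<delta>)} \<Longrightarrow> (R has_real_derivative \<rho> y) (at y)"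
    and S_P: "\<And>l. l \<in> {-\<epsilon>-\<delta>..\<epsilon>} \<Longrightarrow> S (P l) = s l" and \<kappa>_P: "\<And>l. l \<in> {-\<epsilon>-\<delta>..\<epsilon>} \<Longrightarrow> \<kappa> (P l) = K l"
    and R_M: "\<And>l. l \<in> {-\<epsilon>..\<epsilon>+\<delta>} \<Longrightarrow> R (M l) = r l" and \<rho>_M: "\<And>l. l \<in> {-\<epsilon>..\<epsilon>+\<delta>} \<Longrightarrow> \<rho> (M l) = K l"
begin

definition um :: real where "um = P (-\<epsilon>) - \<epsilon>"
definition vp :: real where "vp = M \<epsilon> - \<epsilon>"

text \<open>\<open>pc\<close> and \<open>mc\<close> are the abscissae of the ends of the diagonals through \<open>x\<close>, on the top and the
  bottom boundary.\<close>

definition pc :: "real \<times> real \<Rightarrow> real" where "pc x = fst x - snd x + \<epsilon>"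
definition mc :: "real \<times> real \<Rightarrow> real" where "mc x = fst x + snd x + \<epsilon>"
text \<open>\<open>la\<close> and \<open>lb\<close> are the parameters of the prolonged upper and
  lower rib on the two diagonals through \<open>x\<close>. In the fissure region the rib that
  contains \<open>x\<close> is the one with the smaller parameter.\<close>

definition la :: "real \<times> real \<Rightarrow> real" where "la x = inv P (pc x)"
definition lb :: "real \<times> real \<Rightarrow> real" where "lb x = inv M (mc x)"
definition W :: "(real \<times> real) set" where "W = Omega_NE \<epsilon> (um - \<delta>) (vp + \<delta>)"
text \<open>The bound \<open>la x \<le> \<epsilon>\<close> keeps out top boundary points over the
  right prolongation, where \<open>la\<close> and \<open>lb\<close> coincide and the upper rib is
  degenerate; symmetrically for \<open>L\<close>.\<close>

definition U :: "(real \<times> real) set" where "U = {x \<in> W. la x \<le> lb x \<and> la x \<le> \<epsilon>}"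
definition L :: "(real \<times> real) set" where "L = {x \<in> W. lb x \<le> la x \<and> -\<epsilon> \<le> lb x}"
definition BU :: "real \<times> real \<Rightarrow> real" where "BU x = fp (pc x) - (\<epsilon> - snd x) * S (pc x)"
definition BL :: "real \<times> real \<Rightarrow> real" where "BL x = fm (mc x) - (\<epsilon> + snd x) * R (mc x)"
definition B :: "real \<times> real \<Rightarrow> real" where "B x = (if x \<in> U then BU x else BL x)"
text \<open>\<open>w\<close> is the x1-derivative. The second component is then dictated by the
  derivative \<open>S\<close> along \<open>(1,1)\<close>, and in \<open>gL\<close> by the derivative
  \<open>R\<close> along \<open>(1,-1)\<close>.\<close>

definition gU :: "real \<times> real \<Rightarrow> real \<times> real" where
  "gU x = (let w = fp1 (pc x) - (\<epsilon> - snd x) * \<kappa> (pc x) in (w, S (pc x) - w))"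
definition gL :: "real \<times> real \<Rightarrow> real \<times> real" where
  "gL x = (let w = fm1 (mc x) - (\<epsilon> + snd x) * \<rho> (mc x) in (w, w - R (mc x)))"
definition g :: "real \<times> real \<Rightarrow> real \<times> real" where "g x = (if x \<in> U then gU x else gL x)"

section \<open>Decomposition into upper and lower ribs, and smoothness\<close>

lemma mc_pc: "mc x = pc x + 2 * snd x"
  by (simp add: mc_def pc_def)

lemma P_la: "P (la x) = pc x" and M_lb: "M (lb x) = mc x"
  using P_surj M_surj by (simp_all add: la_def lb_def surj_f_inv_f)

lemma P_le: "P l \<le> P l' \<longleftrightarrow> l \<le> l'" and M_le: "M l \<le> M l' \<longleftrightarrow> l \<le> l'"
  using strict_mono_less_eq[OF P_strict_mono] strict_mono_less_eq[OF M_strict_mono] by auto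

lemma P_eq: "P l = P l' \<longleftrightarrow> l = l'" and M_eq: "M l = M l' \<longleftrightarrow> l = l'"
  using strict_mono_eq[OF P_strict_mono] strict_mono_eq[OF M_strict_mono] by auto

lemma la_le: "la x \<le> l \<longleftrightarrow> pc x \<le> P l" "l \<le> la x \<longleftrightarrow> P l \<le> pc x" "la x \<le> la y \<longleftrightarrow> pc x \<le> pc y"
  using P_le by (metis P_la)+

lemma lb_le: "lb x \<le> l \<longleftrightarrow> mc x \<le> M l" "l \<le> lb x \<longleftrightarrow> M l \<le> mc x" "lb x \<le> lb y \<longleftrightarrow> mc x \<le> mc y"
  using M_le by (metis M_lb)+

lemma um_eq: "um = p (-\<epsilon>) - \<epsilon>" and vp_eq: "vp = p \<epsilon> + \<epsilon>"
  using e by (simp_all add: um_def vp_def P_outer M_outer)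

lemma NE_iff: "x \<in> Omega_NE \<epsilon> u v \<longleftrightarrow> -\<epsilon> \<le> snd x \<and> snd x \<le> \<epsilon> \<and> u + \<epsilon> \<le> pc x \<and> mc x \<le> v + \<epsilon>"
  by (auto simp: Omega_NE_def strip_def pc_def mc_def)

lemma W_D:
  assumes "x \<in> W"
  shows "-\<epsilon> \<le> snd x" "snd x \<le> \<epsilon>" "-\<epsilon>-\<delta> \<le> la x" "lb x \<le> \<epsilon>+\<delta>"
  using assms e d by (auto simp: W_def NE_iff la_le lb_le P_outer M_outer um_eq vp_eq)

text \<open>If \<open>la \<le> lb\<close> but \<open>la > \<epsilon>\<close>, then
  \<open>M (la x) = pc x + 2 \<epsilon>\<close> is at least \<open>mc x\<close>, which forces
  \<open>la = lb\<close> and puts the point in \<open>L\<close>. At the left end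
  \<open>lb < -\<epsilon>\<close> forces \<open>la \<le> lb\<close> in the same way.\<close>

lemma W_eq: "W = U \<union> L"
proof -
  have "x \<in> U \<union> L" if x: "x \<in> W" for x
  proof (cases "la x \<le> lb x")
    case True
    show ?thesis
    proof (cases "la x \<le> \<epsilon>")
      case False
      then have "M (la x) = pc x + 2 * \<epsilon>" using P_la[of x] by (simp add: M_def T_right)
      then have "lb x \<le> la x" using W_D[OF x] by (simp add: lb_le mc_pc)
      then show ?thesis using True False x e by (auto simp: L_def)
    qed (use True x in \<open>simp add: U_def\<close>)
  next
    case False
    have "-\<epsilon> \<le> lb x"
    proof (rule ccontr)
      assume "\<not> -\<epsilon> \<le> lb x"
      then have "P (lb x) = mc x + 2 * \<epsilon>" using M_lb[of x] by (simp add: M_def T_left)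
      then have "la x \<le> lb x" using W_D[OF x] by (simp add: la_le mc_pc)
      then show False using False by simp
    qed
    then show ?thesis using False x by (auto simp: L_def)
  qed
  then show ?thesis by (auto simp: U_def L_def)
qed

lemma overlap:
  assumes "x \<in> U" "x \<in> L"
  shows "lb x = la x" "\<bar>la x\<bar> \<le> \<epsilon>" "snd x = la x" "T (la x) = la x"
proof -
  show *: "lb x = la x" "\<bar>la x\<bar> \<le> \<epsilon>" using assms by (auto simp: U_def L_def)
  then show "T (la x) = la x" by (simp add: T_inner)
  then show "snd x = la x" using mc_pc[of x] P_la[of x] M_lb[of x] * by (simp add: M_def)
qed

lemma pc_cont: "continuous_on A pc" and mc_cont: "continuous_on A mc"
  unfolding pc_def mc_def by (intro continuous_intros)+

lemma la_cont: "continuous_on A la" and lb_cont: "continuous_on A lb"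
  unfolding la_def lb_def
  by (rule continuous_on_compose2[OF continuous_on_inv_strict_mono[OF P_strict_mono P_surj] pc_cont]
      continuous_on_compose2[OF continuous_on_inv_strict_mono[OF M_strict_mono M_surj] mc_cont], simp)+

lemma closed_NE: "closed (Omega_NE \<epsilon> u v)"
proof -
  have "Omega_NE \<epsilon> u v = {x. -\<epsilon> \<le> snd x} \<inter> {x. snd x \<le> \<epsilon>} \<inter> {x. u + \<epsilon> \<le> pc x} \<inter> {x. mc x \<le> v + \<epsilon>}"
    by (auto simp: NE_iff)
  then show ?thesis
    by (auto intro!: closed_Int closed_Collect_le continuous_intros pc_cont mc_cont)
qed

lemma closed_U: "closed U" and closed_L: "closed L"
proof -
  have "U = W \<inter> ({x. la x \<le> lb x} \<inter> {x. la x \<le> \<epsilon>})" "L = W \<inter> ({x. lb x \<le> la x} \<inter> {x. -\<epsilon> \<le> lb x})"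
    by (auto simp: U_def L_def)
  moreover have "closed ({x. la x \<le> lb x} \<inter> {x. la x \<le> \<epsilon>})" "closed ({x. lb x \<le> la x} \<inter> {x. -\<epsilon> \<le> lb x})"
    by (intro closed_Int closed_Collect_le la_cont lb_cont continuous_intros)+
  ultimately show "closed U" "closed L" using closed_NE by (auto simp: W_def)
qed

lemma U_D: "x \<in> U \<Longrightarrow> la x \<in> {-\<epsilon>-\<delta>..\<epsilon>} \<and> la x \<le> lb x \<and> x \<in> W"
  and L_D: "x \<in> L \<Longrightarrow> lb x \<in> {-\<epsilon>..\<epsilon>+\<delta>} \<and> lb x \<le> la x \<and> x \<in> W"
  using W_D by (auto simp: U_def L_def)

lemma U_pc: "x \<in> U \<Longrightarrow> pc x \<in> {P (-\<epsilon>-\<delta>)..P \<epsilon>}" and L_mc: "x \<in> L \<Longrightarrow> mc x \<in> {M (-\<epsilon>)..M (\<epsilon>+\<delta>)}"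
  using U_D L_D by (auto simp: la_le lb_le)

lemma U_fun: "x \<in> U \<Longrightarrow> S (pc x) = s (la x) \<and> \<kappa> (pc x) = K (la x)"
  and L_fun: "x \<in> L \<Longrightarrow> R (mc x) = r (lb x) \<and> \<rho> (mc x) = K (lb x)"
  using S_P \<kappa>_P R_M \<rho>_M U_D L_D by (metis P_la, metis M_lb)

text \<open>Pieces meet only on the spine, and there \<open>s\<close> and \<open>r\<close> were
  chosen to make value and gradient agree.\<close>

lemma agree:
  assumes "x \<in> U" "x \<in> L"
  shows "BU x = BL x" "gU x = gL x"
proof -
  note o = overlap[OF assms]
  have *: "pc x = P (la x)" "mc x = M (la x)" using o P_la[of x] M_lb[of x] by auto
  have f: "S (pc x) = s (la x)" "\<kappa> (pc x) = K (la x)" "R (mc x) = r (la x)" "\<rho> (mc x) = K (la x)"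
    using U_fun L_fun assms o by auto
  show "BU x = BL x"
    using spine_value_eq[of "la x"] unfolding BU_def BL_def f unfolding * o by simp
  show "gU x = gL x"
    using s_r_h[of "la x"] h_def[of "la x"] h_alt[of "la x"]
    unfolding gU_def gL_def Let_def f unfolding * o by simp
qed

lemma B_U: "x \<in> U \<Longrightarrow> B x = BU x" and B_L: "x \<in> L \<Longrightarrow> B x = BL x"
  and g_U: "x \<in> U \<Longrightarrow> g x = gU x" and g_L: "x \<in> L \<Longrightarrow> g x = gL x"
  using agree by (auto simp: B_def g_def)

lemma pc_der: "(pc has_derivative (\<lambda>v. fst v - snd v)) F" and mc_der: "(mc has_derivative (\<lambda>v. fst v + snd v)) F"
  unfolding pc_def[abs_def] mc_def[abs_def] by (auto intro!: derivative_eq_intros)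

lemma BU_der: "x \<in> U \<Longrightarrow> (BU has_derivative (\<lambda>v. gU x \<bullet> v)) (at x)"
  unfolding BU_def[abs_def]
  by (rule derivative_eq_intros DERIV_compose_FDERIV[OF fp pc_der] DERIV_compose_FDERIV[OF S_der[OF U_pc] pc_der] refl | assumption)+
    (auto simp: gU_def Let_def inner_prod_def algebra_simps)

lemma BL_der: "x \<in> L \<Longrightarrow> (BL has_derivative (\<lambda>v. gL x \<bullet> v)) (at x)"
  unfolding BL_def[abs_def]
  by (rule derivative_eq_intros DERIV_compose_FDERIV[OF fm mc_der] DERIV_compose_FDERIV[OF R_der[OF L_mc] mc_der] refl | assumption)+
    (auto simp: gL_def Let_def inner_prod_def algebra_simps)

lemma B_der: "x \<in> W \<Longrightarrow> (B has_derivative (\<lambda>v. g x \<bullet> v)) (at x within W)"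
  unfolding W_eq
proof (rule has_derivative_within_closed_Un[OF closed_U closed_L])
  show "(B has_derivative (\<lambda>v. g x \<bullet> v)) (at x within U)" if "x \<in> U"
    using has_derivative_at_withinI[OF BU_der[OF that]] that
    by (intro has_derivative_transform[OF that B_U]) (simp_all add: g_U)
  show "(B has_derivative (\<lambda>v. g x \<bullet> v)) (at x within L)" if "x \<in> L"
    using has_derivative_at_withinI[OF BL_der[OF that]] that
    by (intro has_derivative_transform[OF that B_L]) (simp_all add: g_L)
qed

lemma g_cont: "continuous_on W g"
  unfolding W_eq
proof (rule continuous_on_closed_Un[OF closed_U closed_L])
  have "continuous_on {P (-\<epsilon>-\<delta>)..P \<epsilon>} S" "continuous_on {M (-\<epsilon>)..M (\<epsilon>+\<delta>)} R"
    by (rule DERIV_continuous_on[OF has_field_derivative_at_within], rule S_der R_der, assumption)+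
  then have S: "continuous_on U (\<lambda>x. S (pc x))" and R: "continuous_on L (\<lambda>x. R (mc x))"
    using U_pc L_mc continuous_on_compose2[OF _ pc_cont, of _ S U] continuous_on_compose2[OF _ mc_cont, of _ R L] by blast+
  have "continuous_on U gU"
    unfolding gU_def Let_def
    by (intro continuous_intros S continuous_on_compose2[OF fun_cont(3)[of UNIV] pc_cont] continuous_on_compose2[OF \<kappa>_cont pc_cont]) auto
  then show "continuous_on U g" by (simp add: g_U cong: continuous_on_cong)
  have "continuous_on L gL"
    unfolding gL_def Let_def
    by (intro continuous_intros R continuous_on_compose2[OF fun_cont(4)[of UNIV] mc_cont] continuous_on_compose2[OF \<rho>_cont mc_cont]) auto
  then show "continuous_on L g" by (simp add: g_L cong: continuous_on_cong)
qed

lemma C1_B: "C1_smooth_on W B"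
  unfolding C1_smooth_on_def using g_cont B_der by blast

section \<open>Concavity along the diagonals\<close>

lemma slopes_U:
  assumes "x \<in> U"
  shows "g x \<bullet> (1, -1) = 2 * GU (mc x) (la x)" "g x \<bullet> (1, 1) = s (la x)"
  using U_fun[OF assms] P_la[of x] mc_pc[of x] unfolding g_U[OF assms] GU_def
  by (simp_all add: gU_def Let_def inner_prod_def field_simps)

lemma slopes_L:
  assumes "x \<in> L"
  shows "g x \<bullet> (1, -1) = r (lb x)" "g x \<bullet> (1, 1) = 2 * GL (pc x) (lb x)"
  using L_fun[OF assms] M_lb[of x] mc_pc[of x] unfolding g_L[OF assms] GL_def
  by (simp_all add: gL_def Let_def inner_prod_def field_simps)

text \<open>Along \<open>(1,-1)\<close> the parameter \<open>la\<close> grows while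
  \<open>lb\<close> is fixed, so a path can pass from \<open>U\<close> to \<open>L\<close> but not
  back. On \<open>L\<close> the slope is the constant \<open>r (lb x)\<close>, on \<open>U\<close>
  it is controlled by \<open>GU_mono\<close>, and at the crossing \<open>la = lb\<close> both agree
  by \<open>GU_spine\<close>.\<close>

lemma slope_nonincreasing_down:
  assumes W: "x \<in> W" "y \<in> W" and mc: "mc x = mc y" and pc: "pc x \<le> pc y"
  shows "g y \<bullet> (1, -1) \<le> g x \<bullet> (1, -1)"
proof -
  have lb: "lb y = lb x" using mc by (simp add: lb_def)
  have la: "la x \<le> la y" using pc la_le(3) by blast
  have top: "mc x \<le> P (la x) + 2 * \<epsilon>" using W_D[OF W(1)] by (simp add: P_la mc_pc)
  consider "x \<in> U" "y \<in> U" | "x \<in> U" "y \<in> L" | "x \<in> L" "y \<in> L"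
  proof -
    have "y \<in> L" if "x \<in> L" "x \<notin> U" "y \<in> U"
      using that la lb by (auto simp: U_def L_def)
    then show thesis using that W by (auto simp: W_eq)
  qed
  then show ?thesis
  proof cases
    case 1
    have "M (la y) \<le> mc x" using U_D[OF 1(2)] mc by (simp add: lb_le(2)[symmetric])
    then have "GU (mc x) (la y) \<le> GU (mc x) (la x)"
      using U_D[OF 1(1)] U_D[OF 1(2)] la top by (intro GU_mono) auto
    then show ?thesis using slopes_U(1)[OF 1(1)] slopes_U(1)[OF 1(2)] mc by simp
  next
    case 2
    have "lb x \<le> \<epsilon>"
    proof -
      have "mc x \<le> P \<epsilon> + 2 * \<epsilon>" using top U_D[OF 2(1)] P_le[of "la x" \<epsilon>] by auto
      then show ?thesis using e by (simp add: lb_le M_def T_right)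
    qed
    then have "GU (mc x) (lb x) \<le> GU (mc x) (la x)"
      using U_D[OF 2(1)] top by (intro GU_mono) (auto simp: M_lb)
    then show ?thesis
      using slopes_U(1)[OF 2(1)] slopes_L(1)[OF 2(2)] lb GU_spine[of "lb x"] by (simp add: M_lb)
  next
    case 3
    then show ?thesis using slopes_L(1) lb by simp
  qed
qed

text \<open>Mirror image: along \<open>(1,1)\<close> the parameter \<open>lb\<close> grows and
  \<open>la\<close> is fixed, so the passage is from \<open>L\<close> to \<open>U\<close>.\<close>

lemma slope_nonincreasing_up:
  assumes W: "x \<in> W" "y \<in> W" and pc: "pc x = pc y" and mc: "mc x \<le> mc y"
  shows "g y \<bullet> (1, 1) \<le> g x \<bullet> (1, 1)"
proof -
  have la: "la y = la x" using pc by (simp add: la_def)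
  have lb: "lb x \<le> lb y" using mc lb_le(3) by blast
  have bot: "pc x \<le> M (lb x) + 2 * \<epsilon>" using W_D[OF W(1)] by (simp add: M_lb mc_pc)
  consider "x \<in> L" "y \<in> L" | "x \<in> L" "y \<in> U" | "x \<in> U" "y \<in> U"
  proof -
    have "y \<in> U" if "x \<in> U" "x \<notin> L" "y \<in> L"
      using that la lb by (auto simp: U_def L_def)
    then show thesis using that W by (auto simp: W_eq)
  qed
  then show ?thesis
  proof cases
    case 1
    have "P (lb y) \<le> pc x" using L_D[OF 1(2)] pc by (simp add: la_le(2)[symmetric])
    then have "GL (pc x) (lb y) \<le> GL (pc x) (lb x)"
      using L_D[OF 1(1)] L_D[OF 1(2)] lb bot by (intro GL_mono) auto
    then show ?thesis using slopes_L(2)[OF 1(1)] slopes_L(2)[OF 1(2)] pc by simp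
  next
    case 2
    have "la x \<le> \<epsilon> + \<delta>" using U_D[OF 2(2)] la d by simp
    then have "GL (pc x) (la x) \<le> GL (pc x) (lb x)"
      using L_D[OF 2(1)] bot by (intro GL_mono) (auto simp: P_la)
    then show ?thesis
      using slopes_L(2)[OF 2(1)] slopes_U(2)[OF 2(2)] la GL_spine[of "la x"] by (simp add: P_la)
  next
    case 3
    then show ?thesis using slopes_U(2) la by simp
  qed
qed

lemma pc_segment: "pc (a + t *\<^sub>R (b - a)) = pc a + t * (pc b - pc a)"
  and mc_segment: "mc (a + t *\<^sub>R (b - a)) = mc a + t * (mc b - mc a)"
  by (simp_all add: pc_def mc_def algebra_simps)

lemma segment_memI: "t \<in> {0..1} \<Longrightarrow> a + t *\<^sub>R (b - a) \<in> closed_segment a (b :: real \<times> real)"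
  unfolding closed_segment_def by (auto intro!: exI[of _ t] simp: algebra_simps)

lemma concave_down:
  assumes seg: "closed_segment a b \<subseteq> W" and mc: "mc a = mc b" and pc: "pc a \<le> pc b"
  shows "concave_on (closed_segment a b) B"
proof (rule concave_on_closed_segment_gradient[OF seg B_der])
  fix q t :: real assume t: "0 \<le> q" "q \<le> t" "t \<le> 1"
  define c where "c = (pc b - pc a) / 2"
  have ba: "b - a = c *\<^sub>R (1, -1)" using mc by (simp add: c_def pc_def mc_def prod_eq_iff field_simps)
  have ip: "z \<bullet> (b - a) = c * (z \<bullet> (1, -1))" for z unfolding ba by (rule inner_scaleR_right)
  have "g (a + t *\<^sub>R (b - a)) \<bullet> (1, -1) \<le> g (a + q *\<^sub>R (b - a)) \<bullet> (1, -1)"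
  proof (rule slope_nonincreasing_down)
    show "a + q *\<^sub>R (b - a) \<in> W" "a + t *\<^sub>R (b - a) \<in> W"
      using subsetD[OF seg segment_memI[of q a b]] subsetD[OF seg segment_memI[of t a b]] t by auto
  qed (use t pc mc in \<open>simp_all add: pc_segment mc_segment mult_right_mono\<close>)
  moreover have "0 \<le> c" using pc by (simp add: c_def)
  ultimately show "g (a + t *\<^sub>R (b - a)) \<bullet> (b - a) \<le> g (a + q *\<^sub>R (b - a)) \<bullet> (b - a)"
    unfolding ip by (rule mult_left_mono)
qed

lemma concave_up:
  assumes seg: "closed_segment a b \<subseteq> W" and pc: "pc a = pc b" and mc: "mc a \<le> mc b"
  shows "concave_on (closed_segment a b) B"
proof (rule concave_on_closed_segment_gradient[OF seg B_der])
  fix q t :: real assume t: "0 \<le> q" "q \<le> t" "t \<le> 1"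
  define c where "c = (mc b - mc a) / 2"
  have ba: "b - a = c *\<^sub>R (1, 1)" using pc by (simp add: c_def pc_def mc_def prod_eq_iff field_simps)
  have ip: "z \<bullet> (b - a) = c * (z \<bullet> (1, 1))" for z unfolding ba by (rule inner_scaleR_right)
  have "g (a + t *\<^sub>R (b - a)) \<bullet> (1, 1) \<le> g (a + q *\<^sub>R (b - a)) \<bullet> (1, 1)"
  proof (rule slope_nonincreasing_up)
    show "a + q *\<^sub>R (b - a) \<in> W" "a + t *\<^sub>R (b - a) \<in> W"
      using subsetD[OF seg segment_memI[of q a b]] subsetD[OF seg segment_memI[of t a b]] t by auto
  qed (use t pc mc in \<open>simp_all add: pc_segment mc_segment mult_right_mono\<close>)
  moreover have "0 \<le> c" using mc by (simp add: c_def)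
  ultimately show "g (a + t *\<^sub>R (b - a)) \<bullet> (b - a) \<le> g (a + q *\<^sub>R (b - a)) \<bullet> (b - a)"
    unfolding ip by (rule mult_left_mono)
qed

lemma diagonally_concave_B: "diagonally_concave_on W B"
  unfolding diagonally_concave_on_def
proof (intro allI impI, elim conjE)
  fix a b assume seg: "closed_segment a b \<subseteq> W" and "same_diagonal a b"
  then consider "mc a = mc b" | "pc a = pc b" by (auto simp: same_diagonal_def pc_def mc_def)
  then show "concave_on (closed_segment a b) B"
  proof cases
    case 1
    show ?thesis
      using concave_down[OF seg 1] concave_down[of b a] seg 1
      by (cases "pc a \<le> pc b") (auto simp: closed_segment_commute)
  next
    case 2
    show ?thesis
      using concave_up[OF seg 2] concave_up[of b a] seg 2
      by (cases "mc a \<le> mc b") (auto simp: closed_segment_commute)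
  qed
qed

lemma NE_subset_W: "um - \<delta> \<le> u \<Longrightarrow> v \<le> vp + \<delta> \<Longrightarrow> Omega_NE \<epsilon> u v \<subseteq> W"
  by (auto simp: W_def NE_iff)

section \<open>Boundary values and linearity on ribs\<close>

lemma B_top:
  assumes "(y, \<epsilon>) \<in> W"
  shows "B (y, \<epsilon>) = fp y"
proof (cases "(y, \<epsilon>) \<in> U")
  case True
  then show ?thesis by (simp add: B_U BU_def pc_def)
next
  case False
  \<comment> \<open>Outside \<open>U\<close> the point lies over the right prolongation; there
    \<open>T = \<epsilon>\<close>, and \<open>spine_value_eq\<close> turns the lower formula into
    \<open>fp\<close>.\<close>
  let ?x = "(y, \<epsilon>)"
  have L: "?x \<in> L" using False assms by (simp add: W_eq)
  have "M (la ?x) \<le> mc ?x" using T_bounds[of "la ?x"] P_la[of ?x] by (simp add: M_def mc_pc)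
  then have "la ?x \<le> lb ?x" using lb_le(2) by blast
  then have l: "lb ?x = la ?x" "\<epsilon> < la ?x"
    using L_D[OF L] False assms unfolding U_def by auto
  then have "fp (P (la ?x)) = fm (M (la ?x)) - 2 * \<epsilon> * r (la ?x)"
    using spine_value_eq[of "la ?x"] T_right[of "la ?x"] l(2) by simp
  moreover have "P (la ?x) = y" using P_la[of ?x] by (simp add: pc_def)
  moreover have "B ?x = fm (mc ?x) - (\<epsilon> + snd ?x) * r (lb ?x)"
    using B_L[OF L] L_fun[OF L] by (simp only: BL_def)
  ultimately show ?thesis unfolding M_lb[symmetric] l(1) by simp
qed

lemma B_bottom:
  assumes "(y, -\<epsilon>) \<in> W"
  shows "B (y, -\<epsilon>) = fm y"
proof (cases "(y, -\<epsilon>) \<in> L")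
  case True
  then show ?thesis by (simp add: B_L BL_def mc_def)
next
  case False
  let ?x = "(y, -\<epsilon>)"
  have U: "?x \<in> U" using False assms by (simp add: W_eq)
  have "P (lb ?x) \<le> pc ?x" using T_bounds[of "lb ?x"] M_lb[of ?x] by (simp add: M_def mc_pc)
  then have "lb ?x \<le> la ?x" using la_le(2) by blast
  then have l: "lb ?x = la ?x" "la ?x < -\<epsilon>"
    using U_D[OF U] False assms unfolding L_def by auto
  then have "fp (P (la ?x)) - 2 * \<epsilon> * s (la ?x) = fm (M (la ?x))"
    using spine_value_eq[of "la ?x"] T_left[of "la ?x"] l(2) by simp
  moreover have "M (la ?x) = y" using M_lb[of ?x] unfolding l(1) by (simp add: mc_def)
  moreover have "B ?x = fp (pc ?x) - (\<epsilon> - snd ?x) * s (la ?x)"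
    using B_U[OF U] U_fun[OF U] by (simp only: BU_def)
  ultimately show ?thesis unfolding P_la[symmetric] by simp
qed

text \<open>Going up a rib fixes \<open>pc\<close> and raises \<open>mc\<close> to at most
  \<open>M \<epsilon> = vp + \<epsilon>\<close>, so the rib stays in the region and in
  \<open>U\<close>; there \<open>BU\<close> is affine in the height.\<close>

lemma upper_rib_linear:
  assumes N: "y \<in> U" "y \<in> Omega_NE \<epsilon> u v" and v: "vp \<le> v"
  shows "closed_segment y (pc y, \<epsilon>) \<subseteq> Omega_NE \<epsilon> u v" "linear_on_segment B y (pc y, \<epsilon>)"
proof -
  let ?w = "\<lambda>t. (1 - t) *\<^sub>R y + t *\<^sub>R (pc y, \<epsilon>)"
  have snd_y: "-\<epsilon> \<le> snd y" "snd y \<le> \<epsilon>" and W: "y \<in> W" using U_D[OF N(1)] W_D by auto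
  have pc: "pc (?w t) = pc y" for t by (simp add: pc_def algebra_simps)
  have snd_w: "snd (?w t) = snd y + t * (\<epsilon> - snd y)" for t by (simp add: algebra_simps)
  have b: "snd y \<le> snd (?w t)" "snd (?w t) \<le> \<epsilon>" if "t \<in> {0..1}" for t
    unfolding snd_w using that snd_y mult_right_mono[of t 1 "\<epsilon> - snd y"] by auto
  have "pc y \<le> P \<epsilon>" using U_pc[OF N(1)] by simp
  then have top: "mc (?w t) \<le> M \<epsilon>" if "t \<in> {0..1}" for t
    using b[OF that] e unfolding mc_pc pc by (simp add: M_def T_right)
  have N_w: "?w t \<in> Omega_NE \<epsilon> u v" if "t \<in> {0..1}" for t
    using b[OF that] top[OF that] snd_y v N(2) unfolding NE_iff pc vp_def by linarith
  have U_w: "?w t \<in> U" if t: "t \<in> {0..1}" for t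
  proof -
    have "mc y \<le> mc (?w t)" using b[OF t] unfolding mc_pc pc by simp
    then have "lb y \<le> lb (?w t)" using lb_le(3) by blast
    moreover have "la (?w t) = la y" by (simp only: la_def pc)
    moreover have "?w t \<in> W"
      using W b[OF t] top[OF t] snd_y d unfolding W_def NE_iff pc vp_def by linarith
    ultimately show ?thesis using U_D[OF N(1)] by (simp add: U_def)
  qed
  show "closed_segment y (pc y, \<epsilon>) \<subseteq> Omega_NE \<epsilon> u v"
    using N_w by (auto simp: closed_segment_def)
  have "pc (pc y, \<epsilon>) = pc y" by (simp add: pc_def)
  then show "linear_on_segment B y (pc y, \<epsilon>)"
    unfolding linear_on_segment_def using B_U[OF U_w] B_U[OF N(1)] B_U[of "(pc y, \<epsilon>)"] U_w[of 1]
    by (auto simp: BU_def pc simp del: scaleR_Pair) (simp add: algebra_simps)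
qed

lemma lower_rib_linear:
  assumes N: "y \<in> L" "y \<in> Omega_NE \<epsilon> u v" and u: "u \<le> um"
  shows "closed_segment y (mc y, -\<epsilon>) \<subseteq> Omega_NE \<epsilon> u v" "linear_on_segment B y (mc y, -\<epsilon>)"
proof -
  let ?w = "\<lambda>t. (1 - t) *\<^sub>R y + t *\<^sub>R (mc y, -\<epsilon>)"
  have snd_y: "-\<epsilon> \<le> snd y" "snd y \<le> \<epsilon>" and W: "y \<in> W" using L_D[OF N(1)] W_D by auto
  have mc: "mc (?w t) = mc y" for t by (simp add: mc_def algebra_simps)
  have pc: "pc (?w t) = mc y - 2 * snd (?w t)" for t using mc_pc[of "?w t"] mc by simp
  have snd_w: "snd (?w t) = snd y - t * (\<epsilon> + snd y)" for t by (simp add: algebra_simps)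
  have b: "snd (?w t) \<le> snd y" "-\<epsilon> \<le> snd (?w t)" if "t \<in> {0..1}" for t
    unfolding snd_w using that snd_y mult_right_mono[of t 1 "\<epsilon> + snd y"] by auto
  have le: "pc y \<le> pc (?w t)" if "t \<in> {0..1}" for t
    using b[OF that] pc[of t] mc_pc[of y] by linarith
  have N_w: "?w t \<in> Omega_NE \<epsilon> u v" if "t \<in> {0..1}" for t
    using b[OF that] le[OF that] snd_y N(2) unfolding NE_iff mc by linarith
  have L_w: "?w t \<in> L" if t: "t \<in> {0..1}" for t
  proof -
    have "la y \<le> la (?w t)" using le[OF t] la_le(3) by blast
    moreover have "lb (?w t) = lb y" by (simp only: lb_def mc)
    moreover have "?w t \<in> W"
      using W b[OF t] le[OF t] snd_y unfolding W_def NE_iff mc by linarith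
    ultimately show ?thesis using L_D[OF N(1)] by (simp add: L_def)
  qed
  show "closed_segment y (mc y, -\<epsilon>) \<subseteq> Omega_NE \<epsilon> u v"
    using N_w by (auto simp: closed_segment_def)
  have "mc (mc y, -\<epsilon>) = mc y" by (simp add: mc_def)
  then show "linear_on_segment B y (mc y, -\<epsilon>)"
    unfolding linear_on_segment_def using B_L[OF L_w] B_L[OF N(1)] B_L[of "(mc y, -\<epsilon>)"] L_w[of 1]
    by (auto simp: BL_def mc simp del: scaleR_Pair) (simp add: algebra_simps)
qed

text \<open>Stated for a range of \<open>u\<close> and \<open>v\<close> to cover two regions at
  once: the fissure alone for \<open>um\<close>, \<open>vp\<close>, and its union with the tangent
  domains for \<open>um - \<delta>\<close>, \<open>vp + \<delta>\<close>. Every point lies on a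
  prolonged rib, so the first alternative of the third condition always applies.\<close>

lemma bellman_B:
  assumes "um - \<delta> \<le> u" "u \<le> um" "vp \<le> v" "v \<le> vp + \<delta>"
  shows "bellman_candidate fp fm \<epsilon> (Omega_NE \<epsilon> u v) B"
  unfolding bellman_candidate_def
proof (intro conjI ballI allI impI disjI1)
  note sub = NE_subset_W[OF assms(1,4)]
  show "diagonally_concave_on (Omega_NE \<epsilon> u v) B"
    using diagonally_concave_B sub unfolding diagonally_concave_on_def by blast
  show "B (y, \<epsilon>) = fp y" if "(y, \<epsilon>) \<in> Omega_NE \<epsilon> u v" for y using B_top sub that by blast
  show "B (y, -\<epsilon>) = fm y" if "(y, -\<epsilon>) \<in> Omega_NE \<epsilon> u v" for y using B_bottom sub that by blast
  fix y assume y: "y \<in> Omega_NE \<epsilon> u v"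
  then consider "y \<in> U" | "y \<in> L" using sub W_eq by blast
  then show "\<exists>z\<in>strip_boundary \<epsilon>. same_diagonal y z \<and> closed_segment y z \<subseteq> Omega_NE \<epsilon> u v \<and> linear_on_segment B y z"
  proof cases
    case 1
    show ?thesis
      using upper_rib_linear[OF 1 y assms(3)]
      by (intro bexI[of _ "(pc y, \<epsilon>)"]) (auto simp: same_diagonal_def strip_boundary_def pc_def)
  next
    case 2
    show ?thesis
      using lower_rib_linear[OF 2 y assms(2)]
      by (intro bexI[of _ "(mc y, -\<epsilon>)"]) (auto simp: same_diagonal_def strip_boundary_def mc_def)
  qed
qed

section \<open>The spine as a function of its abscissa\<close>

definition abscissa :: "real \<Rightarrow> real" where "abscissa l = P l + T l - \<epsilon>"
definition spine :: "real \<Rightarrow> real" where "spine v = T (inv abscissa v)"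

lemma abscissa_strict_mono: "strict_mono abscissa"
  using strict_monoD[OF P_strict_mono] T_mono(1)
  by (intro strict_monoI) (force simp: abscissa_def intro: add_less_le_mono)

lemma abscissa_cont: "continuous_on A abscissa"
  unfolding abscissa_def by (intro continuous_intros P_cont T_cont)

lemma abscissa_surj: "surj abscissa"
  by (rule surj_if_outer_translation[OF abscissa_cont, of "p \<epsilon> - \<epsilon>" "p (-\<epsilon>) - \<epsilon>"])
    (auto simp: abscissa_def P_outer T_left T_right)

lemma inv_abscissa: "inv abscissa (abscissa l) = l"
  using strict_mono_imp_inj_on[OF abscissa_strict_mono] by simp

lemma spine_abscissa: "spine (abscissa l) = T l"
  by (simp add: spine_def inv_abscissa)

lemma abscissa_ends: "abscissa (-\<epsilon>) = um - \<epsilon>" "abscissa \<epsilon> = vp - \<epsilon>" "abscissa 0 = p 0 - \<epsilon>"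
  using e by (simp_all add: abscissa_def P_outer T_left T_right um_eq vp_eq P_def T_inner)

lemma abscissa_eq: "-\<epsilon> \<le> l \<Longrightarrow> l \<le> \<epsilon> \<Longrightarrow> abscissa l = p l + l - \<epsilon>"
  by (simp add: abscissa_def P_def T_inner abs_le_iff)

lemma abscissa_le: "abscissa l \<le> abscissa l' \<longleftrightarrow> l \<le> l'"
  using strict_mono_less_eq[OF abscissa_strict_mono] .

lemma abscissa_image: "abscissa ` {-\<epsilon>..\<epsilon>} = {um - \<epsilon>..vp - \<epsilon>}"
proof -
  have "v \<in> abscissa ` {-\<epsilon>..\<epsilon>}" if "v \<in> {um - \<epsilon>..vp - \<epsilon>}" for v
  proof -
    obtain l where "v = abscissa l" using abscissa_surj by blast
    then show ?thesis using that abscissa_le by (auto simp flip: abscissa_ends(1,2))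
  qed
  then show ?thesis using abscissa_le by (auto simp flip: abscissa_ends(1,2))
qed

lemma inv_abscissa_cont: "continuous_on A (inv abscissa)"
  using continuous_on_inv_strict_mono[OF abscissa_strict_mono abscissa_surj] by (rule continuous_on_subset) simp

lemma spine_cont: "continuous_on A spine"
  unfolding spine_def by (rule continuous_on_compose2[OF T_cont[of UNIV] inv_abscissa_cont]) simp

text \<open>The derivative is \<open>1 / (dp + 1)\<close>. It is at most 1 because \<open>dp\<close>
  is nonnegative, and can equal 1 only at the top end, the one place where \<open>dp\<close> may
  vanish.\<close>

lemma NE_fissure_spine: "NE_fissure \<epsilon> (um - \<epsilon>) (vp - \<epsilon>) spine"
proof -
  define T' where "T' v = inverse (dp (inv abscissa v) + 1)" for v
  have I: "\<exists>l\<in>{-\<epsilon>..\<epsilon>}. v = abscissa l" if "v \<in> {um - \<epsilon>..vp - \<epsilon>}" for v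
    using that unfolding abscissa_image[symmetric] by blast
  have der: "(spine has_real_derivative T' v) (at v within {um - \<epsilon>..vp - \<epsilon>})" if v: "v \<in> {um - \<epsilon>..vp - \<epsilon>}" for v
  proof -
    obtain l where l: "l \<in> {-\<epsilon>..\<epsilon>}" "v = abscissa l" using I[OF v] by blast
    have "((\<lambda>l. p l + l - \<epsilon>) has_real_derivative dp l + 1) (at l within {-\<epsilon>..\<epsilon>})"
      using DERIV_diff[OF DERIV_add[OF p_der[OF l(1)] DERIV_ident] DERIV_const] by simp
    then have "(abscissa has_real_derivative dp l + 1) (at l within {-\<epsilon>..\<epsilon>})"
      by (rule has_field_derivative_transform_within[where d=1]) (use l abscissa_eq in auto)
    moreover have "dp l + 1 \<noteq> 0" using dp_nonneg[OF l(1)] by simp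
    moreover have "spine (abscissa z) = z" if "z \<in> {-\<epsilon>..\<epsilon>}" for z
      using that by (simp add: spine_abscissa T_inner abs_le_iff)
    ultimately have "(spine has_real_derivative inverse (dp l + 1)) (at (abscissa l) within abscissa ` {-\<epsilon>..\<epsilon>})"
      by (rule has_field_derivative_inverse_within[OF _ _ l(1) _ spine_cont])
    then show ?thesis unfolding T'_def l(2) inv_abscissa abscissa_image .
  qed
  have dom: "inv abscissa v \<in> {-\<epsilon>..\<epsilon>}" if "v \<in> {um - \<epsilon>..vp - \<epsilon>}" for v
    using I[OF that] inv_abscissa by metis
  have "continuous_on {um - \<epsilon>..vp - \<epsilon>} T'"
    unfolding T'_def
  proof (intro continuous_intros)
    show "continuous_on {um - \<epsilon>..vp - \<epsilon>} (\<lambda>v. dp (inv abscissa v))"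
      by (rule continuous_on_compose2[OF dp_cont inv_abscissa_cont]) (use dom in blast)
    show "\<forall>v\<in>{um - \<epsilon>..vp - \<epsilon>}. dp (inv abscissa v) + 1 \<noteq> 0"
      using dp_nonneg[OF dom] by force
  qed
  moreover have "\<bar>T' v\<bar> \<le> 1" if "v \<in> {um - \<epsilon>..vp - \<epsilon>}" for v
    using dp_nonneg[OF dom[OF that]] by (simp add: T'_def inverse_eq_divide)
  moreover have "finite {v \<in> {um - \<epsilon>..vp - \<epsilon>}. \<not> \<bar>T' v\<bar> < 1}"
  proof (rule finite_subset)
    show "{v \<in> {um - \<epsilon>..vp - \<epsilon>}. \<not> \<bar>T' v\<bar> < 1} \<subseteq> {abscissa \<epsilon>}"
    proof safe
      fix v assume v: "v \<in> {um - \<epsilon>..vp - \<epsilon>}" "\<not> \<bar>T' v\<bar> < 1"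
      obtain l where l: "l \<in> {-\<epsilon>..\<epsilon>}" "v = abscissa l" using I[OF v(1)] by blast
      have "T' v = 1 / (dp l + 1)" unfolding T'_def l(2) inv_abscissa by (simp add: inverse_eq_divide)
      then have "\<not> 0 < dp l" using v(2) by auto
      then have "l = \<epsilon>" using dp_pos[of l] l by force
      then show "v = abscissa \<epsilon>" using l by simp
    qed
  qed simp
  moreover have "um - \<epsilon> < vp - \<epsilon>"
    using e strict_monoD[OF abscissa_strict_mono, of "-\<epsilon>" \<epsilon>] by (simp add: abscissa_ends)
  moreover have "spine ` {um - \<epsilon>..vp - \<epsilon>} \<subseteq> {-\<epsilon>..\<epsilon>}" using T_bounds by (auto simp: spine_def)
  moreover have "spine (um - \<epsilon>) = -\<epsilon>" "spine (vp - \<epsilon>) = \<epsilon>"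
    using spine_abscissa[of "-\<epsilon>"] spine_abscissa[of \<epsilon>] by (simp_all add: abscissa_ends T_left T_right)
  ultimately show ?thesis unfolding NE_fissure_def herringbone_spine_def using der by blast
qed

section \<open>Identification with the explicit formulas\<close>

lemma mem_ribs:
  assumes "l \<in> {-\<epsilon>..\<epsilon>}"
  shows "x \<in> upper_rib \<epsilon> spine (abscissa l) \<longleftrightarrow> pc x = P l \<and> l \<le> snd x \<and> snd x \<le> \<epsilon>"
    and "x \<in> lower_rib \<epsilon> spine (abscissa l) \<longleftrightarrow> mc x = M l \<and> -\<epsilon> \<le> snd x \<and> snd x \<le> l"
proof -
  have T: "spine (abscissa l) = l" "T l = l" using assms by (simp_all add: spine_abscissa T_inner abs_le_iff)
  have ends: "abscissa l - l + \<epsilon> = abscissa l + 1 * (\<epsilon> - l)" "abscissa l + l + \<epsilon> = abscissa l + -1 * (-\<epsilon> - l)"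
    by simp_all
  have pc: "pc x = P l \<longleftrightarrow> fst x - abscissa l = 1 * (snd x - l)"
    unfolding pc_def abscissa_def T(2) by auto
  have mc: "mc x = M l \<longleftrightarrow> fst x - abscissa l = -1 * (snd x - l)"
    unfolding mc_def abscissa_def M_def T(2) by auto
  show "x \<in> upper_rib \<epsilon> spine (abscissa l) \<longleftrightarrow> pc x = P l \<and> l \<le> snd x \<and> snd x \<le> \<epsilon>"
    using assms unfolding upper_rib_def T(1) ends mem_sloped_segment pc by (auto simp: closed_segment_eq_real_ivl)
  show "x \<in> lower_rib \<epsilon> spine (abscissa l) \<longleftrightarrow> mc x = M l \<and> -\<epsilon> \<le> snd x \<and> snd x \<le> l"
    using assms unfolding lower_rib_def T(1) ends mem_sloped_segment mc by (auto simp: closed_segment_eq_real_ivl)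
qed

text \<open>If \<open>x\<close> lies on the upper rib with parameter \<open>l\<close>, then
  \<open>la x = l\<close>, and \<open>l \<le> snd x\<close> gives \<open>l \<le> lb x\<close>;
  symmetrically on lower ribs. Every admissible parameter is thus the minimum.\<close>

lemma rib_param_eq:
  assumes x: "x \<in> Omega_NE \<epsilon> um vp"
  shows "rib_param \<epsilon> (um - \<epsilon>) (vp - \<epsilon>) spine x = abscissa (min (la x) (lb x))"
    and "min (la x) (lb x) \<in> {-\<epsilon>..\<epsilon>}"
proof -
  have W: "x \<in> W" using x NE_subset_W[of um vp] d by auto
  have la: "-\<epsilon> \<le> la x" and lb: "lb x \<le> \<epsilon>" using x by (auto simp: NE_iff la_le lb_le um_def vp_def)
  have "x \<in> U \<or> x \<in> L" using W W_eq by blast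
  then show l: "min (la x) (lb x) \<in> {-\<epsilon>..\<epsilon>}"
    using U_D[of x] L_D[of x] la lb by auto
  let ?l = "min (la x) (lb x)"
  show "rib_param \<epsilon> (um - \<epsilon>) (vp - \<epsilon>) spine x = abscissa ?l"
    unfolding rib_param_def
  proof (rule the_equality, intro conjI)
    show "abscissa ?l \<in> {um - \<epsilon>..vp - \<epsilon>}" using l unfolding abscissa_image[symmetric] by blast
    show "x \<in> upper_rib \<epsilon> spine (abscissa ?l) \<union> lower_rib \<epsilon> spine (abscissa ?l)"
    proof (cases "la x \<le> lb x")
      case True
      then have m: "?l = la x" by simp
      have "T (la x) = la x" using l unfolding m by (simp add: T_inner abs_le_iff)
      moreover have "M (la x) \<le> mc x" using True lb_le(2) by blast
      ultimately have "la x \<le> snd x" using P_la[of x] by (simp add: M_def mc_pc)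
      then show ?thesis using mem_ribs(1)[OF l, of x] P_la[of x] W_D(2)[OF W] unfolding m by simp
    next
      case False
      then have m: "?l = lb x" by simp
      have "T (lb x) = lb x" using l unfolding m by (simp add: T_inner abs_le_iff)
      moreover have "P (lb x) \<le> pc x" using False la_le(2)[of "lb x" x] by simp
      ultimately have "snd x \<le> lb x" using M_lb[of x] by (simp add: M_def mc_pc)
      then show ?thesis using mem_ribs(2)[OF l, of x] M_lb[of x] W_D(1)[OF W] unfolding m by simp
    qed
    fix v assume v: "v \<in> {um - \<epsilon>..vp - \<epsilon>} \<and> x \<in> upper_rib \<epsilon> spine v \<union> lower_rib \<epsilon> spine v"
    then have "v \<in> abscissa ` {-\<epsilon>..\<epsilon>}" by (simp only: abscissa_image)
    then obtain l where l: "l \<in> {-\<epsilon>..\<epsilon>}" "v = abscissa l" by blast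
    have T: "T l = l" using l by (simp add: T_inner abs_le_iff)
    from v consider "pc x = P l" "l \<le> snd x" | "mc x = M l" "snd x \<le> l"
      using mem_ribs[OF l(1), of x] unfolding l(2) by blast
    then have "?l = l"
    proof cases
      case 1
      then have "la x = l" by (metis P_eq P_la)
      moreover have "l \<le> lb x" using 1 T by (simp add: lb_le M_def mc_pc)
      ultimately show ?thesis by simp
    next
      case 2
      then have "lb x = l" by (metis M_eq M_lb)
      moreover have "l \<le> la x" using 2 T by (simp add: la_le M_def mc_pc)
      ultimately show ?thesis by simp
    qed
    then show "v = abscissa ?l" using l by simp
  qed
qed

text \<open>Written in terms of \<open>h\<close>, the bracket of the formula is
  \<open>- 2 T h\<close>. This cancels the denominator \<open>T\<close> and shows that the
  singularity at \<open>T = 0\<close> is removable.\<close>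

lemma spine_formula_eq:
  assumes l: "l \<in> {-\<epsilon>..\<epsilon>}" "l \<noteq> 0"
  shows "spine_formula fp fm \<epsilon> spine (abscissa l) = fp (P l) - (\<epsilon> - T l) * s l"
proof -
  have T: "T l = l" using l by (simp add: T_inner abs_le_iff)
  have 1: "fp1 (P l) = h l + (\<epsilon> - l) * K l" "fm1 (M l) = h l + (\<epsilon> + l) * K l"
    using h_def[of l] h_alt[of l] T by simp_all
  have "deriv fp x = fp1 x" "deriv fm x = fm1 x" for x
    using fp fm by (auto intro: DERIV_imp_deriv)
  moreover have "spine (abscissa l) = l" "abscissa l - l + \<epsilon> = P l" "abscissa l + l + \<epsilon> = M l"
    by (simp_all add: spine_abscissa T) (simp_all add: abscissa_def M_def T)
  ultimately have "spine_formula fp fm \<epsilon> spine (abscissa l) =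
     (\<epsilon>\<^sup>2 - l\<^sup>2) / (2 * \<epsilon> * l) * ((\<epsilon> - l) * fm1 (M l) - (\<epsilon> + l) * fp1 (P l))
       + ((\<epsilon> + l) * fp (P l) + (\<epsilon> - l) * fm (M l)) / (2 * \<epsilon>)"
    by (simp only: spine_formula_def Let_def)
  also have "(\<epsilon> - l) * fm1 (M l) - (\<epsilon> + l) * fp1 (P l) = - (2 * l * h l)"
    unfolding 1 by (simp add: algebra_simps)
  also have "(\<epsilon>\<^sup>2 - l\<^sup>2) / (2 * \<epsilon> * l) * - (2 * l * h l) = - ((\<epsilon> - l) * (\<epsilon> + l) * h l / \<epsilon>)"
    using l e by (simp add: field_simps power2_eq_square)
  finally show ?thesis using e unfolding s_def T by (simp add: field_simps)
qed

text \<open>At \<open>T = 0\<close> the right-hand side is continuous in the abscissa. The limit is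
  a full two-sided one, because \<open>T\<close> vanishes at a single interior point of the spine
  interval.\<close>

lemma spine_value_eq_ribs:
  assumes l: "l \<in> {-\<epsilon>..\<epsilon>}"
  shows "spine_value fp fm \<epsilon> (um - \<epsilon>) (vp - \<epsilon>) spine (abscissa l) = fp (P l) - (\<epsilon> - T l) * s l"
proof (cases "l = 0")
  case False
  then show ?thesis using l spine_formula_eq[OF l] by (simp add: spine_value_def spine_abscissa T_inner abs_le_iff)
next
  case True
  let ?A = "\<lambda>v. fp (P (inv abscissa v)) - (\<epsilon> - T (inv abscissa v)) * s (inv abscissa v)"
  let ?D = "{v \<in> {um - \<epsilon>..vp - \<epsilon>}. spine v \<noteq> 0}"
  have D: "?D = {um - \<epsilon>..vp - \<epsilon>} - {abscissa 0}"
  proof -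
    have "spine (abscissa l) = 0 \<longleftrightarrow> l = 0" if "l \<in> {-\<epsilon>..\<epsilon>}" for l
      using that by (simp add: spine_abscissa T_inner abs_le_iff)
    moreover have "abscissa l = abscissa 0 \<longleftrightarrow> l = 0" for l by (metis inv_abscissa)
    ultimately show ?thesis unfolding abscissa_image[symmetric] by auto
  qed
  have at: "at (abscissa 0) within ?D = at (abscissa 0)"
  proof -
    have "abscissa 0 \<in> {um - \<epsilon><..<vp - \<epsilon>}"
      using e strict_monoD[OF abscissa_strict_mono] by (simp flip: abscissa_ends(1,2))
    then show ?thesis unfolding D by (simp add: at_within_Icc_at at_within_def[of _ "_ - {_}"] flip: at_within_def)
  qed
  have "continuous_on UNIV ?A"
    by (intro continuous_intros continuous_on_compose2[OF comp_cont(1)[of UNIV] inv_abscissa_cont]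
        continuous_on_compose2[OF T_cont[of UNIV] inv_abscissa_cont] continuous_on_compose2[OF s_cont[of UNIV] inv_abscissa_cont]) auto
  then have "isCont ?A (abscissa 0)" by (simp add: continuous_on_eq_continuous_at)
  then have "(?A \<longlongrightarrow> ?A (abscissa 0)) (at (abscissa 0) within ?D)" by (simp only: at isCont_def)
  then have "(spine_formula fp fm \<epsilon> spine \<longlongrightarrow> ?A (abscissa 0)) (at (abscissa 0) within ?D)"
  proof (rule Lim_transform_eventually)
    have "spine_formula fp fm \<epsilon> spine v = ?A v" if "v \<in> ?D" for v
    proof -
      from that have "v \<in> abscissa ` {-\<epsilon>..\<epsilon>}" unfolding abscissa_image by blast
      then obtain l where l: "l \<in> {-\<epsilon>..\<epsilon>}" "v = abscissa l" by blast
      moreover have "l \<noteq> 0" using that l unfolding D by auto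
      ultimately show ?thesis by (simp add: spine_formula_eq inv_abscissa)
    qed
    then show "\<forall>\<^sub>F v in at (abscissa 0) within ?D. ?A v = spine_formula fp fm \<epsilon> spine v"
      by (auto simp: eventually_at_filter)
  qed
  then have "Lim (at (abscissa 0) within ?D) (spine_formula fp fm \<epsilon> spine) = ?A (abscissa 0)"
    by (rule tendsto_Lim[rotated]) (simp only: at trivial_limit_at not_False_eq_True)
  then show ?thesis
    using True e by (simp add: spine_value_def spine_abscissa T_inner inv_abscissa)
qed

text \<open>Both branches interpolate between the common spine value and the boundary value, hence
  reduce to \<open>BU\<close> and \<open>BL\<close>. The degenerate rib
  \<open>T = \<epsilon>\<close> consists of its boundary point only.\<close>

lemma fissure_function_eq_B:
  assumes x: "x \<in> Omega_NE \<epsilon> um vp"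
  shows "fissure_function fp fm \<epsilon> (um - \<epsilon>) (vp - \<epsilon>) spine x = B x"
proof -
  have W: "x \<in> W" using x NE_subset_W[of um vp] d by auto
  define l where "l = min (la x) (lb x)"
  have l: "l \<in> {-\<epsilon>..\<epsilon>}" and u: "rib_param \<epsilon> (um - \<epsilon>) (vp - \<epsilon>) spine x = abscissa l"
    using rib_param_eq[OF x] by (simp_all add: l_def)
  have T: "T l = l" using l by (simp add: T_inner abs_le_iff)
  have t: "spine (abscissa l) = l" "abscissa l - l + \<epsilon> = P l" "abscissa l + l + \<epsilon> = M l"
    by (simp_all add: spine_abscissa T) (simp_all add: abscissa_def M_def T)
  note A = spine_value_eq_ribs[OF l]
  note F = fissure_function_def[of fp fm \<epsilon> "um - \<epsilon>" "vp - \<epsilon>" spine x, unfolded Let_def u t A T]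
  show ?thesis
  proof (cases "x \<in> U")
    case True
    then have la: "la x = l" "la x \<le> lb x" using U_D by (auto simp: l_def)
    then have "l \<le> snd x" using lb_le(2)[of "la x" x] P_la[of x] T by (simp add: M_def mc_pc)
    moreover have "B x = fp (P l) - (\<epsilon> - snd x) * s l"
      using U_fun[OF True] P_la[of x] la by (simp add: B_U[OF True] BU_def)
    moreover have "snd x = \<epsilon>" if "l = \<epsilon>" using \<open>l \<le> snd x\<close> W_D[OF W] that by simp
    moreover have "(\<epsilon> - snd x) / (\<epsilon> - l) * (fp (P l) - (\<epsilon> - l) * s l) + (snd x - l) / (\<epsilon> - l) * fp (P l)
        = fp (P l) - (\<epsilon> - snd x) * s l" if "l \<noteq> \<epsilon>"
      using that by (intro interpolation_affine) auto
    ultimately show ?thesis using F by (cases "l = \<epsilon>") simp_all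
  next
    case False
    then have L: "x \<in> L" using W W_eq by blast
    then have lb: "lb x = l" using L_D by (auto simp: l_def)
    have "snd x < l"
    proof (rule ccontr)
      assume "\<not> snd x < l"
      then have "la x \<le> lb x" using M_lb[of x] lb T by (simp add: la_le M_def mc_pc)
      then show False using False L lb l by (auto simp: U_def L_def)
    qed
    moreover have "B x = fm (M l) - (\<epsilon> + snd x) * r l"
      using L_fun[OF L] M_lb[of x] lb by (simp add: B_L[OF L] BL_def)
    moreover have "0 < \<epsilon> + l" using \<open>snd x < l\<close> W_D[OF W] by simp
    moreover from this have "(\<epsilon> + snd x) / (\<epsilon> + l) * (fm (M l) - (\<epsilon> + l) * r l) + (l - snd x) / (\<epsilon> + l) * fm (M l)
        = fm (M l) - (\<epsilon> + snd x) * r l"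
      by (intro interpolation_affine) auto
    ultimately show ?thesis
      using F spine_value_eq[of l, unfolded T] by simp
  qed
qed

text \<open>Here \<open>T = -\<epsilon>\<close>, so \<open>S\<close> is the slope of the full chord
  and \<open>BU\<close> interpolates linearly between the two boundaries.\<close>

lemma B_right_tangent:
  assumes x: "x \<in> Omega_R \<epsilon> (um - \<delta>) um"
  shows "B x = right_tangent_function fp fm \<epsilon> x" "x \<in> W"
proof -
  have tangent: "X - (\<epsilon> - y) * ((X - Y) / (2 * \<epsilon>)) = (\<epsilon> + y) / (2 * \<epsilon>) * X + (\<epsilon> - y) / (2 * \<epsilon>) * Y" for X Y y
    using e by (simp add: field_simps)
  have le: "pc x \<le> P (-\<epsilon>)" using x by (simp add: Omega_R_def pc_def um_def)
  have la: "la x \<le> -\<epsilon>" using le by (simp add: la_le)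
  have strip: "-\<epsilon> \<le> snd x" "snd x \<le> \<epsilon>" using x by (auto simp: Omega_R_def strip_def)
  have "P (-\<epsilon>) + 2 * \<epsilon> \<le> M \<epsilon>" using P_le[of "-\<epsilon>" \<epsilon>] e by (simp add: M_def T_right)
  then show W: "x \<in> W" using x strip le d by (auto simp: W_def NE_iff mc_pc vp_def Omega_R_def pc_def)
  have M: "M (la x) = pc x - 2 * \<epsilon>" using la P_la[of x] by (simp add: M_def T_left)
  then have "la x \<le> lb x" using strip by (simp add: lb_le mc_pc)
  then have U: "x \<in> U" using W la e by (simp add: U_def)
  have "S (pc x) = (fp (pc x) - fm (pc x - 2 * \<epsilon>)) / (2 * \<epsilon>)"
    using U_fun[OF U] M P_la[of x] T_left[OF la] by (simp add: s_def)
  moreover have "fst x - snd x + \<epsilon> = pc x" "fst x - snd x - \<epsilon> = pc x - 2 * \<epsilon>" by (simp_all add: pc_def)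
  ultimately show "B x = right_tangent_function fp fm \<epsilon> x"
    using tangent by (simp only: B_U[OF U] BU_def right_tangent_function_def)
qed

lemma B_left_tangent:
  assumes x: "x \<in> Omega_L \<epsilon> vp (vp + \<delta>)"
  shows "B x = left_tangent_function fp fm \<epsilon> x" "x \<in> W"
proof -
  have tangent: "X - (\<epsilon> + y) * ((X - Y) / (2 * \<epsilon>)) = (\<epsilon> + y) / (2 * \<epsilon>) * Y + (\<epsilon> - y) / (2 * \<epsilon>) * X" for X Y y
    using e by (simp add: field_simps)
  have le: "M \<epsilon> \<le> mc x" using x by (simp add: Omega_L_def mc_def vp_def)
  have lb: "\<epsilon> \<le> lb x" using le by (simp add: lb_le)
  have strip: "-\<epsilon> \<le> snd x" "snd x \<le> \<epsilon>" using x by (auto simp: Omega_L_def strip_def)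
  have "P (-\<epsilon>) + 2 * \<epsilon> \<le> M \<epsilon>" using P_le[of "-\<epsilon>" \<epsilon>] e by (simp add: M_def T_right)
  moreover have "pc x = mc x - 2 * snd x" by (simp add: mc_pc)
  ultimately show W: "x \<in> W" using x strip le d by (auto simp: W_def NE_iff um_def vp_def Omega_L_def mc_def)
  have P: "P (lb x) = mc x - 2 * \<epsilon>" using lb M_lb[of x] by (simp add: M_def T_right)
  then have "lb x \<le> la x" using strip by (simp add: la_le mc_pc)
  then have L: "x \<in> L" using W lb e by (simp add: L_def)
  have "R (mc x) = (fm (mc x) - fp (mc x - 2 * \<epsilon>)) / (2 * \<epsilon>)"
    using L_fun[OF L] P M_lb[of x] T_right[OF lb] by (simp add: r_def)
  moreover have "fst x + snd x + \<epsilon> = mc x" "fst x + snd x - \<epsilon> = mc x - 2 * \<epsilon>" by (simp_all add: mc_def)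
  ultimately show "B x = left_tangent_function fp fm \<epsilon> x"
    using tangent by (simp only: B_L[OF L] BL_def left_tangent_function_def)
qed

lemma W_eq_regions: "W = Omega_R \<epsilon> (um - \<delta>) um \<union> Omega_NE \<epsilon> um vp \<union> Omega_L \<epsilon> vp (vp + \<delta>)"
proof -
  have "x \<in> Omega_R \<epsilon> (um - \<delta>) um \<union> Omega_NE \<epsilon> um vp \<union> Omega_L \<epsilon> vp (vp + \<delta>)" if "x \<in> W" for x
    using that by (auto simp: W_def Omega_NE_def Omega_R_def Omega_L_def)
  moreover have "Omega_NE \<epsilon> um vp \<subseteq> W" using NE_subset_W[of um vp] d by simp
  ultimately show ?thesis using B_right_tangent(2) B_left_tangent(2) by blast
qed

lemma fissure_exists:
  "\<exists>T vp. NE_fissure \<epsilon> (um - \<epsilon>) (vp - \<epsilon>) T \<and>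
     T (p 0 - \<epsilon>) = 0 \<and> T (um - \<epsilon>) = - \<epsilon> \<and> vp > p 0 + \<epsilon> \<and> T (vp - \<epsilon>) = \<epsilon> \<and>
     bellman_candidate fp fm \<epsilon> (Omega_NE \<epsilon> um vp) (fissure_function fp fm \<epsilon> (um - \<epsilon>) (vp - \<epsilon>) T) \<and>
     (\<exists>\<delta>>0. \<exists>G.
        (\<forall>x\<in>Omega_R \<epsilon> (um - \<delta>) um. G x = right_tangent_function fp fm \<epsilon> x) \<and>
        (\<forall>x\<in>Omega_L \<epsilon> vp (vp + \<delta>). G x = left_tangent_function fp fm \<epsilon> x) \<and>
        (\<forall>x\<in>Omega_NE \<epsilon> um vp. G x = fissure_function fp fm \<epsilon> (um - \<epsilon>) (vp - \<epsilon>) T x) \<and>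
        (let W = Omega_R \<epsilon> (um - \<delta>) um \<union> Omega_NE \<epsilon> um vp \<union> Omega_L \<epsilon> vp (vp + \<delta>)
         in C1_smooth_on W G \<and> bellman_candidate fp fm \<epsilon> W G))"
proof (intro exI conjI)
  show "NE_fissure \<epsilon> (um - \<epsilon>) (vp - \<epsilon>) spine" by (rule NE_fissure_spine)
  show "spine (p 0 - \<epsilon>) = 0" "spine (um - \<epsilon>) = - \<epsilon>" "spine (vp - \<epsilon>) = \<epsilon>"
    using e spine_abscissa[of "-\<epsilon>"] spine_abscissa[of \<epsilon>] spine_abscissa[of 0]
    by (simp_all add: abscissa_ends T_left T_right T_inner)
  show "p 0 + \<epsilon> < vp" using p_strict_mono[of 0 \<epsilon>] e by (simp add: vp_eq)
  show "bellman_candidate fp fm \<epsilon> (Omega_NE \<epsilon> um vp) (fissure_function fp fm \<epsilon> (um - \<epsilon>) (vp - \<epsilon>) spine)"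
    by (rule bellman_candidate_cong[OF bellman_B]) (use d fissure_function_eq_B in auto)
  show "0 < \<delta>" by (rule d)
  show "\<forall>x\<in>Omega_R \<epsilon> (um - \<delta>) um. B x = right_tangent_function fp fm \<epsilon> x"
    "\<forall>x\<in>Omega_L \<epsilon> vp (vp + \<delta>). B x = left_tangent_function fp fm \<epsilon> x"
    "\<forall>x\<in>Omega_NE \<epsilon> um vp. B x = fissure_function fp fm \<epsilon> (um - \<epsilon>) (vp - \<epsilon>) spine x"
    using B_right_tangent B_left_tangent fissure_function_eq_B by auto
  show "let W = Omega_R \<epsilon> (um - \<delta>) um \<union> Omega_NE \<epsilon> um vp \<union> Omega_L \<epsilon> vp (vp + \<delta>)
         in C1_smooth_on W B \<and> bellman_candidate fp fm \<epsilon> W B"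
    unfolding Let_def W_eq_regions[symmetric]
    using C1_B bellman_B[of "um - \<delta>" "vp + \<delta>"] d by (simp add: W_def)
qed

end

context fissure
begin

lemma fissure_surface_exists: "\<exists>S \<kappa> R \<rho>. fissure_surface fp fp1 fp2 fm fm1 fm2 \<epsilon> \<delta> p dp k dk S \<kappa> R \<rho>"
proof -
  have mono: "strict_mono_on A P" "strict_mono_on A M" for A
    using P_strict_mono M_strict_mono by (auto simp: strict_mono_on_def strict_mono_def)
  obtain S \<kappa> where S: "continuous_on UNIV \<kappa>"
    "\<And>y. y \<in> {P (-\<epsilon>-\<delta>)..P \<epsilon>} \<Longrightarrow> (S has_real_derivative \<kappa> y) (at y)"
    "\<And>l. l \<in> {-\<epsilon>-\<delta>..\<epsilon>} \<Longrightarrow> S (P l) = s l" "\<And>l. l \<in> {-\<epsilon>-\<delta>..\<epsilon>} \<Longrightarrow> \<kappa> (P l) = K l"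
    by (rule antiderivative_along_parametrization[of "-\<epsilon>-\<delta>" \<epsilon> "{-\<epsilon>, \<epsilon>}" P K s dP])
      (use e d s_r_der(1) in \<open>auto intro!: mono P_cont K_cont s_cont P_der\<close>)
  obtain R \<rho> where R: "continuous_on UNIV \<rho>"
    "\<And>y. y \<in> {M (-\<epsilon>)..M (\<epsilon>+\<delta>)} \<Longrightarrow> (R has_real_derivative \<rho> y) (at y)"
    "\<And>l. l \<in> {-\<epsilon>..\<epsilon>+\<delta>} \<Longrightarrow> R (M l) = r l" "\<And>l. l \<in> {-\<epsilon>..\<epsilon>+\<delta>} \<Longrightarrow> \<rho> (M l) = K l"
    by (rule antiderivative_along_parametrization[of "-\<epsilon>" "\<epsilon>+\<delta>" "{-\<epsilon>, \<epsilon>}" M K r dM])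
      (use e d s_r_der(2) in \<open>auto intro!: mono M_cont K_cont r_cont M_der\<close>)
  have "fissure_surface fp fp1 fp2 fm fm1 fm2 \<epsilon> \<delta> p dp k dk S \<kappa> R \<rho>"
    by unfold_locales (use S R in auto)
  then show ?thesis by blast
qed

end

section \<open>The fissure\<close>

lemma nonneg_near_positive:
  fixes f :: "real \<Rightarrow> real"
  assumes "continuous_on UNIV f" "0 < f a"
  obtains \<delta> where "0 < \<delta>" "\<And>x. \<bar>x - a\<bar> \<le> \<delta> \<Longrightarrow> 0 \<le> f x"
proof -
  obtain d where d: "0 < d" "\<And>x. \<bar>x - a\<bar> < d \<Longrightarrow> \<bar>f x - f a\<bar> < f a"
    using assms unfolding continuous_on_iff dist_real_def by blast
  show thesis
  proof (rule that)
    show "0 < d / 2" using d by simp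
    show "0 \<le> f x" if "\<bar>x - a\<bar> \<le> d / 2" for x using d(2)[of x] d(1) that by force
  qed
qed

text \<open>Besides undoing the scaling, this supplies the chord relation and the signs on short
  stretches of tangents beyond the spine. Three of the four outer inequalities are strict at the
  ends and persist by continuity; the one with \<open>fm2\<close> on the left starts from equality
  and is obtained from \<open>root_mono\<close>.\<close>

lemma fissure_of_rescaled_spine:
  fixes fp fp1 fp2 fm fm1 fm2 fm3 P V E :: "real \<Rightarrow> real" and \<epsilon> u0 :: real
  assumes e: "0 < \<epsilon>"
    and fp: "\<And>x. (fp has_real_derivative fp1 x) (at x)" and fp1: "\<And>x. (fp1 has_real_derivative fp2 x) (at x)"
    and fm: "\<And>x. (fm has_real_derivative fm1 x) (at x)" and fm1: "\<And>x. (fm1 has_real_derivative fm2 x) (at x)"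
    and fm2: "\<And>x. (fm2 has_real_derivative fm3 x) (at x)"
    and fp2_cont: "continuous_on UNIV fp2"
    and u0: "fp1 u0 = fm1 u0"
    and V_cont: "continuous_on {-1..1} V" and E_cont: "continuous_on {-1..1} E" and P0: "P 0 = 0"
    and P_der: "\<And>t. t \<in> {-1..1} \<Longrightarrow> (P has_real_derivative E t) (at t within {-1..1})"
    and P_small: "\<And>t. t \<in> {-1..1} \<Longrightarrow> \<bar>P t\<bar> < 1"
    and V_neg: "\<And>t. t \<in> {-1..1} \<Longrightarrow> V t < 0"
    and den: "\<And>t. t \<in> {-1..1} \<Longrightarrow> fp2 (u0 + \<epsilon> * P t) - fm2 (u0 + \<epsilon> * (P t + 2 * t)) + 2 * \<epsilon> * t * V t < 0"
    and E_eq: "\<And>t. t \<in> {-1..1} \<Longrightarrow>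
      E t * (fp2 (u0 + \<epsilon> * P t) - fm2 (u0 + \<epsilon> * (P t + 2 * t)) + 2 * \<epsilon> * t * V t) = 2 * \<epsilon> * (1 - t) * V t"
    and V_der: "\<And>t. t \<in> {-1<..<1} \<Longrightarrow> ((\<lambda>t. (1 + t) * V t) has_real_derivative
      (2 + E t) * (fm3 (u0 + \<epsilon> * (P t + 2 * t)) - V t)) (at t)"
    and root_mono: "\<And>x. x \<in> {u0 - 2 * \<epsilon>..u0 + 2 * \<epsilon>} \<Longrightarrow> fp2 x - fm2 (x - 2 * \<epsilon>) - 2 * \<epsilon> * fm3 (x - 2 * \<epsilon>) < 0"
  obtains \<delta> p dp k dk where "fissure fp fp1 fp2 fm fm1 fm2 \<epsilon> \<delta> p dp k dk"
    "p 0 = u0" "p (-\<epsilon>) \<in> {u0 - \<epsilon><..<u0 + \<epsilon>}"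
    "fm1 (p (-\<epsilon>) - 2 * \<epsilon>) - fp1 (p (-\<epsilon>)) + 2 * \<epsilon> * fm2 (p (-\<epsilon>) - 2 * \<epsilon>) = 0"
proof -
  define p where "p t = u0 + \<epsilon> * P (t / \<epsilon>)" for t
  define dp where "dp t = E (t / \<epsilon>)" for t
  define v where "v t = V (t / \<epsilon>)" for t
  define k where "k t = fm2 (p t + 2 * t) - (\<epsilon> + t) * v t" for t
  define dk where "dk t = (2 + dp t) * v t" for t
  have scale: "t / \<epsilon> \<in> {-1..1}" if "t \<in> {-\<epsilon>..\<epsilon>}" for t using that e by (auto simp: field_simps)
  have scale_open: "t / \<epsilon> \<in> {-1<..<1}" if "t \<in> {-\<epsilon><..<\<epsilon>}" for t using that e by (auto simp: field_simps)
  have m: "u0 + \<epsilon> * (P (t / \<epsilon>) + 2 * (t / \<epsilon>)) = p t + 2 * t" for t using e by (simp add: p_def field_simps)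
  have p_der: "(p has_real_derivative dp t) (at t within {-\<epsilon>..\<epsilon>})" if t: "t \<in> {-\<epsilon>..\<epsilon>}" for t
  proof -
    have "((\<lambda>t. P (t / \<epsilon>)) has_real_derivative E (t / \<epsilon>) * (1 / \<epsilon>)) (at t within {-\<epsilon>..\<epsilon>})"
    proof (rule DERIV_image_chain[of P _ "\<lambda>t. t / \<epsilon>", unfolded o_def])
      show "(P has_real_derivative E (t / \<epsilon>)) (at (t / \<epsilon>) within (\<lambda>t. t / \<epsilon>) ` {-\<epsilon>..\<epsilon>})"
        by (rule has_field_derivative_subset[OF P_der[OF scale[OF t]]]) (use scale in blast)
      show "((\<lambda>t. t / \<epsilon>) has_real_derivative 1 / \<epsilon>) (at t within {-\<epsilon>..\<epsilon>})"
        by (rule DERIV_cdivide[OF DERIV_ident])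
    qed
    from DERIV_add[OF DERIV_const DERIV_cmult[OF this, of \<epsilon>], of u0] show ?thesis
      using e by (simp add: p_def[abs_def] dp_def)
  qed
  have p_der_at: "(p has_real_derivative dp t) (at t)" if "t \<in> {-\<epsilon><..<\<epsilon>}" for t
    using p_der[of t] at_within_Icc_at[of "-\<epsilon>" t \<epsilon>] that by auto
  have p_cont: "continuous_on {-\<epsilon>..\<epsilon>} p" by (rule DERIV_continuous_on[OF p_der])
  have div_cont: "continuous_on {-\<epsilon>..\<epsilon>} (\<lambda>t. t / \<epsilon>)" using e by (intro continuous_intros) auto
  have v_cont: "continuous_on {-\<epsilon>..\<epsilon>} v" and dp_cont: "continuous_on {-\<epsilon>..\<epsilon>} dp"
    unfolding v_def[abs_def] dp_def[abs_def]
    by (rule continuous_on_compose2[OF V_cont div_cont] continuous_on_compose2[OF E_cont div_cont], use scale in blast)+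
  have fun_cont: "continuous_on A fp1" "continuous_on A fm1" "continuous_on A fm2" for A
    by (rule DERIV_continuous_on[OF has_field_derivative_at_within], rule fp1 fm1 fm2)+
  have m_cont: "continuous_on {-\<epsilon>..\<epsilon>} (\<lambda>t. p t + 2 * t)" by (intro continuous_intros p_cont)
  have k_cont: "continuous_on {-\<epsilon>..\<epsilon>} k"
    unfolding k_def[abs_def]
    by (intro continuous_intros v_cont continuous_on_compose2[OF fun_cont(3)[of UNIV] m_cont]) auto
  have v_neg: "v t < 0" if "t \<in> {-\<epsilon>..\<epsilon>}" for t using V_neg[OF scale[OF that]] by (simp add: v_def)
  have fp2_k: "fp2 (p t) - k t = (fp2 (p t) - fm2 (p t + 2 * t) + 2 * t * v t) + (\<epsilon> - t) * v t" for t
    by (simp add: k_def algebra_simps)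
  have den': "fp2 (p t) - fm2 (p t + 2 * t) + 2 * t * v t < 0"
    and E': "dp t * (fp2 (p t) - fm2 (p t + 2 * t) + 2 * t * v t) = 2 * (\<epsilon> - t) * v t"
    if t: "t \<in> {-\<epsilon>..\<epsilon>}" for t
  proof -
    have 1: "2 * \<epsilon> * (t / \<epsilon>) = 2 * t" "2 * \<epsilon> * (1 - t / \<epsilon>) = 2 * (\<epsilon> - t)" using e by (auto simp: field_simps)
    show "fp2 (p t) - fm2 (p t + 2 * t) + 2 * t * v t < 0"
      using den[OF scale[OF t]] unfolding m 1 by (simp add: p_def v_def)
    show "dp t * (fp2 (p t) - fm2 (p t + 2 * t) + 2 * t * v t) = 2 * (\<epsilon> - t) * v t"
      using E_eq[OF scale[OF t]] unfolding m 1 by (simp add: p_def v_def dp_def)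
  qed
  have fp2_less: "fp2 (p t) < k t" if t: "t \<in> {-\<epsilon>..\<epsilon>}" for t
    using fp2_k[of t] den'[OF t] mult_nonneg_nonpos[of "\<epsilon> - t" "v t"] v_neg[OF t] t by auto
  have dp_pos: "0 < dp t" if t: "t \<in> {-\<epsilon>..<\<epsilon>}" for t
  proof -
    from t have t': "t \<in> {-\<epsilon>..\<epsilon>}" by auto
    have "2 * (\<epsilon> - t) * v t < 0" using v_neg[OF t'] t by (intro mult_pos_neg) auto
    then have "dp t * (fp2 (p t) - fm2 (p t + 2 * t) + 2 * t * v t) < 0" unfolding E'[OF t'] .
    then show ?thesis using den'[OF t'] by (auto simp: mult_less_0_iff)
  qed
  have dp_nonneg: "0 \<le> dp t" if t: "t \<in> {-\<epsilon>..\<epsilon>}" for t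
  proof (cases "t = \<epsilon>")
    case True
    then show ?thesis using E'[OF t] den'[OF t] by auto
  qed (use dp_pos[of t] t in auto)
  have k_der: "(k has_real_derivative dk t) (at t)" if t: "t \<in> {-\<epsilon><..<\<epsilon>}" for t
  proof -
    let ?w = "(2 + dp t) * (fm3 (p t + 2 * t) - v t)"
    have "((\<lambda>t. t / \<epsilon>) has_real_derivative 1 / \<epsilon>) (at t)" by (rule DERIV_cdivide[OF DERIV_ident])
    from DERIV_cmult[OF DERIV_chain2[OF V_der[OF scale_open[OF t], unfolded m] this], of \<epsilon>]
    have "((\<lambda>t. \<epsilon> * ((1 + t / \<epsilon>) * v t)) has_real_derivative ?w) (at t)"
      using e by (simp add: v_def dp_def)
    moreover have "\<epsilon> * ((1 + t / \<epsilon>) * v t) = (\<epsilon> + t) * v t" for t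
      using e by (simp add: field_simps)
    ultimately have 1: "((\<lambda>t. (\<epsilon> + t) * v t) has_real_derivative ?w) (at t)" by simp
    have 2: "((\<lambda>t. fm2 (p t + 2 * t)) has_real_derivative fm3 (p t + 2 * t) * (dp t + 2)) (at t)"
      by (rule DERIV_chain2[OF fm2]) (auto intro!: derivative_eq_intros p_der_at[OF t])
    show ?thesis
      using DERIV_diff[OF 2 1] by (simp add: k_def[abs_def] dk_def algebra_simps)
  qed
  have ode_p: "(\<epsilon> - t) * dk t = (fp2 (p t) - k t) * dp t" if t: "t \<in> {-\<epsilon>..\<epsilon>}" for t
    using E'[OF t] unfolding fp2_k by (simp add: dk_def algebra_simps)
  have ode_m: "(\<epsilon> + t) * dk t = (fm2 (p t + 2 * t) - k t) * (dp t + 2)" for t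
    by (simp add: dk_def k_def algebra_simps)
  \<comment> \<open>The conserved quantity: \<open>ode_m\<close> minus \<open>ode_p\<close> says
    precisely that its derivative is zero.\<close>
  define c where "c t = 2 * t * k t - (fm1 (p t + 2 * t) - fp1 (p t))" for t
  have c_const: "c t = c (-\<epsilon>)" if "t \<in> {-\<epsilon>..\<epsilon>}" for t
  proof (rule has_derivative_zero_unique_strong_interval[OF _ _ refl _ that])
    show "finite {-\<epsilon>, \<epsilon>}" by simp
    show "continuous_on {-\<epsilon>..\<epsilon>} c"
      unfolding c_def[abs_def]
      by (intro continuous_intros k_cont continuous_on_compose2[OF fun_cont(2)[of UNIV] m_cont]
          continuous_on_compose2[OF fun_cont(1)[of UNIV] p_cont]) auto
    fix t assume "t \<in> {-\<epsilon>..\<epsilon>} - {-\<epsilon>, \<epsilon>}"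
    then have t: "t \<in> {-\<epsilon><..<\<epsilon>}" "t \<in> {-\<epsilon>..\<epsilon>}" by auto
    have "((\<lambda>t. fm1 (p t + 2 * t)) has_real_derivative fm2 (p t + 2 * t) * (dp t + 2)) (at t)"
      by (rule DERIV_chain2[OF fm1]) (auto intro!: derivative_eq_intros p_der_at[OF t(1)])
    moreover have "((\<lambda>t. 2 * t) has_real_derivative 2) (at t)" by (auto intro!: derivative_eq_intros)
    ultimately have "(c has_real_derivative 2 * k t + dk t * (2 * t) - (fm2 (p t + 2 * t) * (dp t + 2) - fp2 (p t) * dp t)) (at t)"
      unfolding c_def[abs_def]
      by (intro DERIV_diff DERIV_mult k_der[OF t(1)] DERIV_chain2[OF fp1 p_der_at[OF t(1)]])
    moreover have "2 * k t + dk t * (2 * t) - (fm2 (p t + 2 * t) * (dp t + 2) - fp2 (p t) * dp t) = 0"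
      using ode_p[OF t(2)] ode_m[of t] by (simp add: algebra_simps)
    ultimately have "(c has_real_derivative 0) (at t within {-\<epsilon>..\<epsilon>})" by (simp add: has_field_derivative_at_within)
    moreover have "(*) 0 = (\<lambda>h::real. 0::real)" by auto
    ultimately show "(c has_derivative (\<lambda>h. 0)) (at t within {-\<epsilon>..\<epsilon>})" by (simp add: has_field_derivative_def)
  qed
  have p0: "p 0 = u0" by (simp add: p_def P0)
  have "c 0 = 0" using u0 by (simp add: c_def p0)
  then have chord: "2 * t * k t = fm1 (p t + 2 * t) - fp1 (p t)" if "t \<in> {-\<epsilon>..\<epsilon>}" for t
    using c_const[OF that] c_const[of 0] e by (simp add: c_def)
  let ?a = "p (-\<epsilon>)" and ?b = "p \<epsilon> + 2 * \<epsilon>"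
  have chord_a: "2 * \<epsilon> * k (-\<epsilon>) = fp1 ?a - fm1 (?a - 2 * \<epsilon>)" and chord_b: "2 * \<epsilon> * k \<epsilon> = fm1 ?b - fp1 (?b - 2 * \<epsilon>)"
    using chord[of "-\<epsilon>"] chord[of \<epsilon>] e by simp_all
  \<comment> \<open>Regularity at the singular end. Inserted into \<open>chord_a\<close>, it becomes
    the root equation at \<open>p (-\<epsilon>) - \<epsilon>\<close>.\<close>
  have k_a: "k (-\<epsilon>) = fm2 (?a - 2 * \<epsilon>)" by (simp add: k_def)
  have a: "?a \<in> {u0 - \<epsilon><..<u0 + \<epsilon>}"
  proof -
    have "\<epsilon> * \<bar>P (-1)\<bar> < \<epsilon> * 1" using P_small[of "-1"] e by (intro mult_strict_left_mono) auto
    then have "\<bar>\<epsilon> * P (-1)\<bar> < \<epsilon>" using e by (simp add: abs_mult)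
    moreover have "?a = u0 + \<epsilon> * P (-1)" using e by (simp add: p_def)
    ultimately show ?thesis unfolding greaterThanLessThan_iff by linarith
  qed
  have comp_cont: "continuous_on UNIV (\<lambda>x. f (x + c))" if "continuous_on UNIV f" for f and c :: real
    by (rule continuous_on_compose2[OF that]) (auto intro!: continuous_intros)
  note shift_cont = comp_cont[OF fun_cont(1), of "-(2 * \<epsilon>)"] comp_cont[OF fun_cont(2), of "-(2 * \<epsilon>)"] comp_cont[OF fp2_cont, of "-(2 * \<epsilon>)"]
  obtain d1 where d1: "0 < d1" "\<And>x. \<bar>x - ?a\<bar> \<le> d1 \<Longrightarrow> 0 \<le> fp1 x - fm1 (x - 2 * \<epsilon>) - 2 * \<epsilon> * fp2 x"
  proof (rule nonneg_near_positive[of "\<lambda>x. fp1 x - fm1 (x - 2 * \<epsilon>) - 2 * \<epsilon> * fp2 x" ?a])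
    show "continuous_on UNIV (\<lambda>x. fp1 x - fm1 (x - 2 * \<epsilon>) - 2 * \<epsilon> * fp2 x)"
      using shift_cont by (intro continuous_intros fun_cont fp2_cont) auto
    show "0 < fp1 ?a - fm1 (?a - 2 * \<epsilon>) - 2 * \<epsilon> * fp2 ?a"
      unfolding chord_a[symmetric] using fp2_less[of "-\<epsilon>"] e by simp
  qed blast
  obtain d2 where d2: "0 < d2" "\<And>y. \<bar>y - ?b\<bar> \<le> d2 \<Longrightarrow> 0 \<le> fm1 y - fp1 (y - 2 * \<epsilon>) - 2 * \<epsilon> * fp2 (y - 2 * \<epsilon>)"
  proof (rule nonneg_near_positive[of "\<lambda>y. fm1 y - fp1 (y - 2 * \<epsilon>) - 2 * \<epsilon> * fp2 (y - 2 * \<epsilon>)" ?b])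
    show "continuous_on UNIV (\<lambda>y. fm1 y - fp1 (y - 2 * \<epsilon>) - 2 * \<epsilon> * fp2 (y - 2 * \<epsilon>))"
      using shift_cont by (intro continuous_intros fun_cont) auto
    show "0 < fm1 ?b - fp1 (?b - 2 * \<epsilon>) - 2 * \<epsilon> * fp2 (?b - 2 * \<epsilon>)"
      unfolding chord_b[symmetric] using fp2_less[of \<epsilon>] e by simp
  qed blast
  obtain d3 where d3: "0 < d3" "\<And>y. \<bar>y - ?b\<bar> \<le> d3 \<Longrightarrow> 0 \<le> fm1 y - fp1 (y - 2 * \<epsilon>) - 2 * \<epsilon> * fm2 y"
  proof (rule nonneg_near_positive[of "\<lambda>y. fm1 y - fp1 (y - 2 * \<epsilon>) - 2 * \<epsilon> * fm2 y" ?b])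
    show "continuous_on UNIV (\<lambda>y. fm1 y - fp1 (y - 2 * \<epsilon>) - 2 * \<epsilon> * fm2 y)"
      using shift_cont by (intro continuous_intros fun_cont) auto
    have "0 < 2 * \<epsilon> * (k \<epsilon> - fm2 ?b)"
      using v_neg[of \<epsilon>] e by (simp add: k_def mult_less_0_iff)
    then show "0 < fm1 ?b - fp1 (?b - 2 * \<epsilon>) - 2 * \<epsilon> * fm2 ?b"
      unfolding chord_b[symmetric] by (simp add: right_diff_distrib)
  qed blast
  \<comment> \<open>\<open>\<delta> \<le> \<epsilon>\<close> together with
    \<open>p (-\<epsilon>) > u0 - \<epsilon>\<close> keeps the left stretch inside the interval
    where \<open>root_mono\<close> applies.\<close>
  define \<delta> where "\<delta> = min (min d1 d2) (min d3 \<epsilon>)"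
  have \<delta>: "0 < \<delta>" "\<delta> \<le> d1" "\<delta> \<le> d2" "\<delta> \<le> d3" "\<delta> \<le> \<epsilon>" using d1 d2 d3 e by (auto simp: \<delta>_def)
  \<comment> \<open>No margin exists at \<open>?a\<close>, where equality holds; but the difference
    of the two sides is nonincreasing in \<open>x\<close>, hence nonnegative to the left of
    \<open>?a\<close>.\<close>
  have left: "2 * \<epsilon> * fm2 (x - 2 * \<epsilon>) \<le> fp1 x - fm1 (x - 2 * \<epsilon>)" if x: "x \<in> {?a - \<delta>..?a}" for x
  proof -
    let ?\<Phi> = "\<lambda>x. fp1 x - fm1 (x - 2 * \<epsilon>) - 2 * \<epsilon> * fm2 (x - 2 * \<epsilon>)"
    have "?\<Phi> ?a \<le> ?\<Phi> x"
    proof (rule DERIV_nonpos_imp_nonincreasing[of x ?a ?\<Phi>])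
      show "x \<le> ?a" using x by simp
      fix z assume z: "x \<le> z" "z \<le> ?a"
      have "((\<lambda>z. z - 2 * \<epsilon>) has_real_derivative 1) (at z)" by (auto intro!: derivative_eq_intros)
      then have "(?\<Phi> has_real_derivative fp2 z - fm2 (z - 2 * \<epsilon>) * 1 - 2 * \<epsilon> * (fm3 (z - 2 * \<epsilon>) * 1)) (at z)"
        by (intro DERIV_diff DERIV_cmult DERIV_chain2[OF fm1] DERIV_chain2[OF fm2] fp1)
      moreover have "fp2 z - fm2 (z - 2 * \<epsilon>) * 1 - 2 * \<epsilon> * (fm3 (z - 2 * \<epsilon>) * 1) \<le> 0"
        using root_mono[of z] z x a \<delta> by simp
      ultimately show "\<exists>y. (?\<Phi> has_real_derivative y) (at z) \<and> y \<le> 0" by blast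
    qed
    then show ?thesis using chord_a k_a by simp
  qed
  have "fissure fp fp1 fp2 fm fm1 fm2 \<epsilon> \<delta> p dp k dk"
  proof
    show "2 * \<epsilon> * fp2 x \<le> fp1 x - fm1 (x - 2 * \<epsilon>) \<and> 2 * \<epsilon> * fm2 (x - 2 * \<epsilon>) \<le> fp1 x - fm1 (x - 2 * \<epsilon>)"
      if "x \<in> {p (-\<epsilon>) - \<delta>..p (-\<epsilon>)}" for x
      using d1(2)[of x] left[OF that] that \<delta> by auto
    show "2 * \<epsilon> * fp2 (y - 2 * \<epsilon>) \<le> fm1 y - fp1 (y - 2 * \<epsilon>) \<and> 2 * \<epsilon> * fm2 y \<le> fm1 y - fp1 (y - 2 * \<epsilon>)"
      if "y \<in> {p \<epsilon> + 2 * \<epsilon>..p \<epsilon> + 2 * \<epsilon> + \<delta>}" for y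
      using d2(2)[of y] d3(2)[of y] that \<delta> by auto
    show "fm2 (p t + 2 * t) \<le> k t" if "t \<in> {-\<epsilon>..\<epsilon>}" for t
      using mult_nonneg_nonpos[of "\<epsilon> + t" "v t"] v_neg[OF that] that by (simp add: k_def)
    show "fp2 (p t) \<le> k t" if "t \<in> {-\<epsilon>..\<epsilon>}" for t using fp2_less[OF that] by simp
    show "(\<epsilon> - t) * dk t = (fp2 (p t) - k t) * dp t" if "t \<in> {-\<epsilon><..<\<epsilon>}" for t
      using ode_p[of t] that by simp
    show "(\<epsilon> + t) * dk t = (fm2 (p t + 2 * t) - k t) * (dp t + 2)" for t by (rule ode_m)
  qed (fact e \<delta>(1) fp fp1 fm fm1 p_der dp_cont dp_nonneg dp_pos k_cont k_der chord)+
  then show thesis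
    using that p0 a chord_a k_a by simp
qed

section \<open>Smooth data, uniqueness of the root, and assembly\<close>

lemma smooth_fun_deriv:
  assumes "smooth_fun f"
  shows "smooth_fun (deriv f)" "(f has_real_derivative deriv f x) (at x)"
proof -
  have d: "(deriv ^^ n) f field_differentiable (at x)" for n x using assms by (simp add: smooth_fun_def)
  show "smooth_fun (deriv f)"
    unfolding smooth_fun_def using d[of "Suc n" for n] by (simp add: funpow_swap1)
  show "(f has_real_derivative deriv f x) (at x)"
    using d[of 0 x] by (simp add: DERIV_deriv_iff_field_differentiable)
qed

lemma smooth_fun_continuous_on: "smooth_fun f \<Longrightarrow> continuous_on A f"
  using DERIV_continuous_on[OF has_field_derivative_at_within[OF smooth_fun_deriv(2)]] by blast

text \<open>The expression is the derivative of the function whose zero is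
  \<open>u\<^sub>- + \<epsilon>\<close>. It is jointly continuous in \<epsilon> and
  \<open>x - u0\<close>, with the negative value \<open>g2 u0 - f2 u0\<close> at the origin.\<close>

lemma eventually_root_function_mono:
  fixes g2 f2 f3 :: "real \<Rightarrow> real"
  assumes cont: "continuous_on UNIV g2" "continuous_on UNIV f2" "continuous_on UNIV f3" and less: "g2 u0 < f2 u0"
  shows "\<forall>\<^sub>F \<epsilon> in at_right 0. \<forall>x\<in>{u0 - 2 * \<epsilon>..u0 + 2 * \<epsilon>}. g2 x - f2 (x - 2 * \<epsilon>) - 2 * \<epsilon> * f3 (x - 2 * \<epsilon>) < 0"
proof -
  define \<Psi> where "\<Psi> z = g2 (u0 + snd z) - f2 (u0 + snd z - 2 * fst z) - 2 * fst z * f3 (u0 + snd z - 2 * fst z)"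
    for z :: "real \<times> real"
  have "continuous_on UNIV \<Psi>"
    unfolding \<Psi>_def[abs_def]
    by (intro continuous_intros continuous_on_compose2[OF cont(1)] continuous_on_compose2[OF cont(2)]
        continuous_on_compose2[OF cont(3)]) auto
  then have "isCont \<Psi> (0, 0)" by (simp add: continuous_on_eq_continuous_at)
  then have "(\<Psi> \<longlongrightarrow> \<Psi> (0, 0)) (nhds (0, 0))" by (simp only: isCont_def tendsto_at_iff_tendsto_nhds)
  moreover have "\<Psi> (0, 0) < 0" using less by (simp add: \<Psi>_def)
  ultimately have "\<forall>\<^sub>F z in nhds (0, 0). \<Psi> z < 0" by (rule order_tendstoD)
  then obtain d where d: "0 < d" "\<And>z. dist z (0, 0) < d \<Longrightarrow> \<Psi> z < 0"
    unfolding eventually_nhds_metric by blast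
  \<comment> \<open>The factor 4 suffices, since \<open>\<epsilon> + \<bar>x - u0\<bar>\<close> is
    at most \<open>3 \<epsilon>\<close> and has to be strictly below \<open>d\<close>.\<close>
  have "\<forall>\<^sub>F \<epsilon> in at_right 0. 0 < \<epsilon> \<and> \<epsilon> * 4 \<le> d"
    using d by (intro eventually_conj eventually_at_right_less eventually_at_right_0_mult_le)
  then show ?thesis
  proof (eventually_elim, intro ballI)
    fix \<epsilon> x :: real assume e: "0 < \<epsilon> \<and> \<epsilon> * 4 \<le> d" and x: "x \<in> {u0 - 2 * \<epsilon>..u0 + 2 * \<epsilon>}"
    have "dist (\<epsilon>, x - u0) (0, 0) \<le> \<bar>\<epsilon>\<bar> + \<bar>x - u0\<bar>"
      unfolding dist_Pair_Pair dist_real_def using sqrt_sum_squares_le_sum_abs[of \<epsilon> "x - u0"] by simp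
    also have "\<dots> < d" using e x by auto
    finally show "g2 x - f2 (x - 2 * \<epsilon>) - 2 * \<epsilon> * f3 (x - 2 * \<epsilon>) < 0" using d(2)[of "(\<epsilon>, x - u0)"] by (simp add: \<Psi>_def)
  qed
qed

theorem proposition6p4:
  fixes fp fm :: "real \<Rightarrow> real" and u0 :: real
  assumes "smooth_fun fp" and "smooth_fun fm"
    and "deriv fp u0 = deriv fm u0"
    and "deriv (deriv fp) u0 < deriv (deriv fm) u0"
    and "deriv (deriv (deriv fm)) u0 < 0"
  shows "\<forall>\<^sub>F \<epsilon> in at_right (0::real).
    (\<exists>!u. is_root_um fp fm u0 \<epsilon> u) \<and>
    (\<forall>um. is_root_um fp fm u0 \<epsilon> um \<longrightarrow>
      (\<exists>T vp. NE_fissure \<epsilon> (um - \<epsilon>) (vp - \<epsilon>) T \<and>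
         T (u0 - \<epsilon>) = 0 \<and> T (um - \<epsilon>) = - \<epsilon> \<and>
         vp > u0 + \<epsilon> \<and> T (vp - \<epsilon>) = \<epsilon> \<and>
         bellman_candidate fp fm \<epsilon> (Omega_NE \<epsilon> um vp)
           (fissure_function fp fm \<epsilon> (um - \<epsilon>) (vp - \<epsilon>) T) \<and>
         (\<exists>\<delta>>0. \<exists>G.
            (\<forall>x\<in>Omega_R \<epsilon> (um - \<delta>) um. G x = right_tangent_function fp fm \<epsilon> x) \<and>
            (\<forall>x\<in>Omega_L \<epsilon> vp (vp + \<delta>). G x = left_tangent_function fp fm \<epsilon> x) \<and>
            (\<forall>x\<in>Omega_NE \<epsilon> um vp.
               G x = fissure_function fp fm \<epsilon> (um - \<epsilon>) (vp - \<epsilon>) T x) \<and>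
            (let W = Omega_R \<epsilon> (um - \<delta>) um \<union> Omega_NE \<epsilon> um vp \<union> Omega_L \<epsilon> vp (vp + \<delta>)
             in C1_smooth_on W G \<and> bellman_candidate fp fm \<epsilon> W G))))"
proof -
  note p = assms(1) smooth_fun_deriv(1)[OF assms(1)]
  note p2 = smooth_fun_deriv(1)[OF p(2)]
  note p3 = smooth_fun_deriv(1)[OF p2]
  note m = assms(2) smooth_fun_deriv(1)[OF assms(2)]
  note m2 = smooth_fun_deriv(1)[OF m(2)]
  note m3 = smooth_fun_deriv(1)[OF m2]
  note m4 = smooth_fun_deriv(1)[OF m3]
  note der = smooth_fun_deriv(2)
  show ?thesis
    using eventually_at_right_less[of 0]
      rescaled_spine_exists[OF der[OF p2] der[OF m2] der[OF m3] smooth_fun_continuous_on[OF p3] smooth_fun_continuous_on[OF m4] assms(4,5)]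
      eventually_root_function_mono[OF smooth_fun_continuous_on[OF p2] smooth_fun_continuous_on[OF m2] smooth_fun_continuous_on[OF m3] assms(4)]
  proof eventually_elim
    case (elim \<epsilon>)
    note e = elim(1) and mono = elim(3)
    from elim(2) obtain P V E where *:
      "continuous_on {-1..1} V" "continuous_on {-1..1} E" "P 0 = 0"
      "\<And>t. t \<in> {-1..1} \<Longrightarrow> (P has_real_derivative E t) (at t within {-1..1})"
      "\<And>t. t \<in> {-1..1} \<Longrightarrow> \<bar>P t\<bar> < 1" "\<And>t. t \<in> {-1..1} \<Longrightarrow> V t < 0"
      "\<And>t. t \<in> {-1..1} \<Longrightarrow> deriv (deriv fp) (u0 + \<epsilon> * P t) - deriv (deriv fm) (u0 + \<epsilon> * (P t + 2 * t)) + 2 * \<epsilon> * t * V t < 0"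
      "\<And>t. t \<in> {-1..1} \<Longrightarrow> E t * (deriv (deriv fp) (u0 + \<epsilon> * P t) - deriv (deriv fm) (u0 + \<epsilon> * (P t + 2 * t)) + 2 * \<epsilon> * t * V t) = 2 * \<epsilon> * (1 - t) * V t"
      "\<And>t. t \<in> {-1<..<1} \<Longrightarrow> ((\<lambda>t. (1 + t) * V t) has_real_derivative
        (2 + E t) * (deriv (deriv (deriv fm)) (u0 + \<epsilon> * (P t + 2 * t)) - V t)) (at t)"
      by blast
    obtain \<delta> p dp k dk where F: "fissure fp (deriv fp) (deriv (deriv fp)) fm (deriv fm) (deriv (deriv fm)) \<epsilon> \<delta> p dp k dk"
      and p0: "p 0 = u0" and a: "p (-\<epsilon>) \<in> {u0 - \<epsilon><..<u0 + \<epsilon>}"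
      and root: "deriv fm (p (-\<epsilon>) - 2 * \<epsilon>) - deriv fp (p (-\<epsilon>)) + 2 * \<epsilon> * deriv (deriv fm) (p (-\<epsilon>) - 2 * \<epsilon>) = 0"
      by (rule fissure_of_rescaled_spine[OF e der[OF p(1)] der[OF p(2)] der[OF m(1)] der[OF m(2)] der[OF m2]
            smooth_fun_continuous_on[OF p2] assms(3) *])
        (use mono in auto)
    interpret fissure fp "deriv fp" "deriv (deriv fp)" fm "deriv fm" "deriv (deriv fm)" \<epsilon> \<delta> p dp k dk by (rule F)
    obtain S \<kappa> R \<rho> where FS: "fissure_surface fp (deriv fp) (deriv (deriv fp)) fm (deriv fm) (deriv (deriv fm)) \<epsilon> \<delta> p dp k dk S \<kappa> R \<rho>"
      using fissure_surface_exists by blast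
    interpret fissure_surface fp "deriv fp" "deriv (deriv fp)" fm "deriv fm" "deriv (deriv fm)" \<epsilon> \<delta> p dp k dk S \<kappa> R \<rho>
      by (rule FS)
    \<comment> \<open>Existence of the root is a by-product: the left end of the constructed spine
      satisfies the equation, and \<open>p (-\<epsilon>)\<close> lies between
      \<open>u0 - \<epsilon>\<close> and \<open>p 0 = u0\<close>.\<close>
    have "is_root_um fp fm u0 \<epsilon> um"
      using a root p_strict_mono[of "-\<epsilon>" 0] e p0 by (simp add: is_root_um_def um_eq)
    moreover have "u = um" if u: "is_root_um fp fm u0 \<epsilon> u" for u
    proof -
      \<comment> \<open>\<open>?\<Phi> (u + \<epsilon>)\<close> is the negative of the left-hand
        side of the root equation at \<open>u\<close>; its strict decrease gives uniqueness.\<close>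
      let ?\<Phi> = "\<lambda>x. deriv fp x - deriv fm (x - 2 * \<epsilon>) - 2 * \<epsilon> * deriv (deriv fm) (x - 2 * \<epsilon>)"
      have less: "?\<Phi> y < ?\<Phi> x" if "x < y" "x \<in> {u0 - \<epsilon><..<u0 + \<epsilon>}" "y \<in> {u0 - \<epsilon><..<u0 + \<epsilon>}" for x y
      proof (rule DERIV_neg_imp_decreasing[OF that(1), of ?\<Phi>])
        fix z assume z: "x \<le> z" "z \<le> y"
        have "((\<lambda>z. z - 2 * \<epsilon>) has_real_derivative 1) (at z)" by (auto intro!: derivative_eq_intros)
        then have "(?\<Phi> has_real_derivative deriv (deriv fp) z - deriv (deriv fm) (z - 2 * \<epsilon>) * 1
            - 2 * \<epsilon> * (deriv (deriv (deriv fm)) (z - 2 * \<epsilon>) * 1)) (at z)"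
          by (intro DERIV_diff DERIV_cmult DERIV_chain2[OF der[OF m(2)]] DERIV_chain2[OF der[OF m2]] der[OF p(2)])
        moreover have "deriv (deriv fp) z - deriv (deriv fm) (z - 2 * \<epsilon>) * 1
            - 2 * \<epsilon> * (deriv (deriv (deriv fm)) (z - 2 * \<epsilon>) * 1) < 0"
          using mono z that e by auto
        ultimately show "\<exists>d. (?\<Phi> has_real_derivative d) (at z) \<and> d < 0" by blast
      qed
      have "?\<Phi> (u + \<epsilon>) = 0" "?\<Phi> (p (-\<epsilon>)) = 0" "u + \<epsilon> \<in> {u0 - \<epsilon><..<u0 + \<epsilon>}"
        using u root by (auto simp: is_root_um_def algebra_simps)
      then have "u + \<epsilon> = p (-\<epsilon>)"
        using less[of "u + \<epsilon>" "p (-\<epsilon>)"] less[of "p (-\<epsilon>)" "u + \<epsilon>"] a by (metis less_irrefl linorder_neqE_linordered_idom)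
      then show ?thesis by (simp add: um_eq)
    qed
    ultimately show ?case using fissure_exists unfolding p0 by blast
  qed
qed

end
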